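(* Let $(f_\beta)_{\beta\in[0,\infty)}$ be the family of skew products described in the context, where $(\Theta,\mathcal{B},m)$ is a probability space, $\gamma:\Theta\to\Theta$ is a bi-measurable bijection for which $m$ is invariant and ergodic, $A:\Theta\to\mathrm{SL}(2,\mathbb{R})$ is measurable and bounded, and $h:[0,\infty)\to[0,\infty)$ is $\mathcal{C}^2$, strictly increasing, strictly concave, bounded, with $h(0)=0$, $h'(0)=1$ and $\sup_{x\ge0}h(x)\le\left(\sup_{\theta\in\Theta}\|A(\theta)\|\right)^{-1}$. Let $\beta_1^m:=e^{-\lambda_m(A)}$ and $\beta_2^m:=e^{\lambda_m(A)}$. Then there exists a $\gamma$-invariant set $\Theta_0\subseteq\Theta$ of full measure (which can be chosen inside any prescribed $\gamma$-invariant set of full measure) such that for all $\theta\in\Theta_0$ the following hold. (a) If $\beta=\beta_1^m<\beta_2^m$, then $\mathcal{A}_\beta(\theta)=\{0\}$ and there exists a set $J=J(\theta)\subseteq\mathbb{N}$ of asymptotic density $0$ such that $$\lim_{n\to\infty,\ n\notin J(\theta)}\|f^n_{\beta,\theta}(v)\|=0\quad\text{for all }v\in\mathbb{R}^2.$$ (b) If $\beta=\beta_1^m=\beta_2^m$, then $\mathcal{A}_\beta(\theta)$ is not a topological disk (not homeomorphic to the closed unit disk). More precisely, there exists $\alpha=\alpha(\theta)$ such that $r_\beta(\theta,\alpha(\theta))=0$. Further, $$\lim_{n\to\infty}\frac1n\sum_{i=0}^{n-1}\|f^i_{\beta,\theta}(v)\|=0\quad\text{for all }v\in\mathbb{R}^2.$$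 (c) If $\beta_1^m<\beta=\beta_2^m$, then $\mathcal{A}_\beta(\theta)$ is a line segment of positive length. More precisely, there exist measurable functions $\alpha_u,\alpha_s:\Theta_0\to[0,\frac12)$ such that for every $\beta\in(\beta_1^m,\beta_2^m]$ (hence in particular for $\beta=\beta_2^m$, with the same functions for all these $\beta$): for $\alpha\in[0,\frac12)$ one has $r_\beta(\theta,\alpha)>0$ if and only if $\alpha=\alpha_u(\theta)$; $$\mathcal{A}_\beta(\theta)=\{rv(\alpha_u(\theta))\mid|r|\le r_\beta(\theta,\alpha_u(\theta))\};$$ and, with $\Psi_\beta(\theta)=\{\pm r_\beta(\theta,\alpha_u(\theta))v(\alpha_u(\theta))\}$, $$\lim_{n\to\infty}d\left(f^n_{\beta,\theta}(v),\Psi_\beta(\gamma^n\theta)\right)=0\quad\text{for all }v\in\mathbb{R}^2\setminus\mathbb{R}v(\alpha_s(\theta)).$$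
   Context: For $\beta\in[0,\infty)$ the map $f_\beta:\Theta\times\mathbb{R}^2\to\Theta\times\mathbb{R}^2$ is $f_\beta(\theta,v)=(\gamma\theta,f_{\beta,\theta}(v))$ with $f_{\beta,\theta}(v)=h(\beta\|v\|)A(\theta)\frac{v}{\|v\|}$ if $v\ne0$ and $f_{\beta,\theta}(0)=0$ (Euclidean norm; operator norm on matrices). $f^n_{\beta,\theta}=f_{\beta,\gamma^{n-1}\theta}\circ\cdots\circ f_{\beta,\theta}$ denotes the fibre map of the $n$-th iterate. The bound on $\sup h$ gives $f_\beta(\Theta\times\mathbb{R}^2)\subseteq\Theta\times\overline{B_1(0)}$, where $B_1(0)$ is the open unit ball in $\mathbb{R}^2$. The global attractor is $\mathcal{A}_\beta=\bigcap_{n\in\mathbb{N}}f^n_\beta(\Theta\times\overline{B_1(0)})$, with fibres $\mathcal{A}_\beta(\theta)=\{x\in\mathbb{R}^2\mid(\theta,x)\in\mathcal{A}_\beta\}$. With $v(\alpha)=(\cos2\pi\alpha,\sin2\pi\alpha)^t$, it has the form $\mathcal{A}_\beta=\{(\theta,rv(\alpha))\mid\theta\in\Theta,\alpha\in[0,1),r\in[0,r_\beta(\theta,\alpha)]\}$, where $r_\beta:\Theta\times\mathbb{R}\to[0,\infty)$, $r_\beta(\theta,\alpha)=\max\{r\ge0\mid rv(\alpha)\in\mathcal{A}_\beta(\theta)\}$, is measurable, and is $\frac12$-periodic and upper semi-continuous in $\alpha$. The Lyapunov exponent is $\lambda_m(A)=\lim_{n\to\infty}\frac1n\int_\Theta\log\|A_n(\theta)\|\,dm(\theta)$,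 $A_n(\theta)=A(\gamma^{n-1}\theta)\cdots A(\theta)$. $d(x,S)$ is the Euclidean distance from a point to a set. A set $J\subseteq\mathbb{N}$ has asymptotic density $0$ if $\lim_{n\to\infty}\frac1n\#(J\cap\{1,\dots,n\})=0$. *)

theory Defs
  imports "HOL-Probability.Probability"
begin

definition bimeasurable_bij :: "'a measure \<Rightarrow> ('a \<Rightarrow> 'a) \<Rightarrow> bool" where
  "bimeasurable_bij M \<gamma> \<longleftrightarrow>
     bij_betw \<gamma> (space M) (space M) \<and>
     \<gamma> \<in> M \<rightarrow>\<^sub>M M \<and> inv_into (space M) \<gamma> \<in> M \<rightarrow>\<^sub>M M"

definition invariant_measure :: "'a measure \<Rightarrow> ('a \<Rightarrow> 'a) \<Rightarrow> bool" where
  "invariant_measure M \<gamma> \<longleftrightarrow>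
     (\<forall>B\<in>sets M. emeasure M (\<gamma> -` B \<inter> space M) = emeasure M B)"

definition ergodic_measure :: "'a measure \<Rightarrow> ('a \<Rightarrow> 'a) \<Rightarrow> bool" where
  "ergodic_measure M \<gamma> \<longleftrightarrow>
     (\<forall>B\<in>sets M. \<gamma> -` B \<inter> space M = B \<longrightarrow> emeasure M B = 0 \<or> emeasure M (space M - B) = 0)"

definition invariant_full_set :: "'a measure \<Rightarrow> ('a \<Rightarrow> 'a) \<Rightarrow> 'a set \<Rightarrow> bool" where
  "invariant_full_set M \<gamma> T \<longleftrightarrow> T \<in> sets M \<and> \<gamma> ` T = T \<and> emeasure M T = emeasure M (space M)"

text \<open>Derivatives are relative to \<open>S\<close>, hence one-sided at a boundary point of an interval.\<close>

definition C2_on :: "real set \<Rightarrow> (real \<Rightarrow> real) \<Rightarrow> bool" where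
  "C2_on S h \<longleftrightarrow>
     (\<exists>h' h''. (\<forall>x\<in>S. (h has_real_derivative h' x) (at x within S)) \<and>
               (\<forall>x\<in>S. (h' has_real_derivative h'' x) (at x within S)) \<and>
               continuous_on S h'')"

definition strictly_concave_on :: "real set \<Rightarrow> (real \<Rightarrow> real) \<Rightarrow> bool" where
  "strictly_concave_on S h \<longleftrightarrow> convex S \<and>
     (\<forall>x\<in>S. \<forall>y\<in>S. \<forall>t\<in>{0<..<1}. x \<noteq> y \<longrightarrow>
        (1 - t) * h x + t * h y < h ((1 - t) * x + t * y))"

text \<open>The library norm on \<open>real^2^2\<close> is the Frobenius norm, so the operator norm is taken
  through \<^const>\<open>onorm\<close>.\<close>

definition opnorm :: "real^2^2 \<Rightarrow> real" where
  "opnorm X = onorm (\<lambda>v. X *v v)"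

primrec cocycle :: "('a \<Rightarrow> 'a) \<Rightarrow> ('a \<Rightarrow> real^2^2) \<Rightarrow> nat \<Rightarrow> 'a \<Rightarrow> real^2^2" where
  "cocycle \<gamma> A 0 \<theta> = mat 1"
| "cocycle \<gamma> A (Suc n) \<theta> = A ((\<gamma> ^^ n) \<theta>) ** cocycle \<gamma> A n \<theta>"

definition lyapunov :: "'a measure \<Rightarrow> ('a \<Rightarrow> 'a) \<Rightarrow> ('a \<Rightarrow> real^2^2) \<Rightarrow> real" where
  "lyapunov M \<gamma> A = lim (\<lambda>n. 1 / real n * (\<integral>\<theta>. ln (opnorm (cocycle \<gamma> A n \<theta>)) \<partial>M))"

definition fibre_map ::
    "(real \<Rightarrow> real) \<Rightarrow> ('a \<Rightarrow> real^2^2) \<Rightarrow> real \<Rightarrow> 'a \<Rightarrow> real^2 \<Rightarrow> real^2" where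
  "fibre_map h A \<beta> \<theta> v =
     (if v = 0 then 0 else h (\<beta> * norm v) *\<^sub>R (A \<theta> *v (v /\<^sub>R norm v)))"

definition skew_map ::
    "('a \<Rightarrow> 'a) \<Rightarrow> (real \<Rightarrow> real) \<Rightarrow> ('a \<Rightarrow> real^2^2) \<Rightarrow> real \<Rightarrow> 'a \<times> (real^2) \<Rightarrow> 'a \<times> (real^2)" where
  "skew_map \<gamma> h A \<beta> = (\<lambda>(\<theta>, v). (\<gamma> \<theta>, fibre_map h A \<beta> \<theta> v))"

primrec fibre_iter ::
    "('a \<Rightarrow> 'a) \<Rightarrow> (real \<Rightarrow> real) \<Rightarrow> ('a \<Rightarrow> real^2^2) \<Rightarrow> real \<Rightarrow> nat \<Rightarrow> 'a \<Rightarrow> real^2 \<Rightarrow> real^2" where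
  "fibre_iter \<gamma> h A \<beta> 0 \<theta> v = v"
| "fibre_iter \<gamma> h A \<beta> (Suc n) \<theta> v =
     fibre_map h A \<beta> ((\<gamma> ^^ n) \<theta>) (fibre_iter \<gamma> h A \<beta> n \<theta> v)"

lemma skew_map_iterate:
  "(skew_map \<gamma> h A \<beta> ^^ n) (\<theta>, v) = ((\<gamma> ^^ n) \<theta>, fibre_iter \<gamma> h A \<beta> n \<theta> v)"
  by (induction n) (simp_all add: skew_map_def)

definition attractor ::
    "'a measure \<Rightarrow> ('a \<Rightarrow> 'a) \<Rightarrow> (real \<Rightarrow> real) \<Rightarrow> ('a \<Rightarrow> real^2^2) \<Rightarrow> real \<Rightarrow> ('a \<times> (real^2)) set" where
  "attractor M \<gamma> h A \<beta> = (\<Inter>n. (skew_map \<gamma> h A \<beta> ^^ n) ` (space M \<times> cball 0 1))"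

definition attractor_fibre ::
    "'a measure \<Rightarrow> ('a \<Rightarrow> 'a) \<Rightarrow> (real \<Rightarrow> real) \<Rightarrow> ('a \<Rightarrow> real^2^2) \<Rightarrow> real \<Rightarrow> 'a \<Rightarrow> (real^2) set" where
  "attractor_fibre M \<gamma> h A \<beta> \<theta> = {x. (\<theta>, x) \<in> attractor M \<gamma> h A \<beta>}"

definition direction :: "real \<Rightarrow> real^2" where
  "direction \<alpha> = vector [cos (2 * pi * \<alpha>), sin (2 * pi * \<alpha>)]"

definition attractor_radius ::
    "'a measure \<Rightarrow> ('a \<Rightarrow> 'a) \<Rightarrow> (real \<Rightarrow> real) \<Rightarrow> ('a \<Rightarrow> real^2^2) \<Rightarrow> real \<Rightarrow> 'a \<Rightarrow> real \<Rightarrow> real" where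
  "attractor_radius M \<gamma> h A \<beta> \<theta> \<alpha> =
     (GREATEST r. 0 \<le> r \<and> r *\<^sub>R direction \<alpha> \<in> attractor_fibre M \<gamma> h A \<beta> \<theta>)"

definition density_zero :: "nat set \<Rightarrow> bool" where
  "density_zero J \<longleftrightarrow> (\<lambda>n. 1 / real n * real (card (J \<inter> {1..n}))) \<longlonglongrightarrow> 0"

definition endpoint_pair ::
    "'a measure \<Rightarrow> ('a \<Rightarrow> 'a) \<Rightarrow> (real \<Rightarrow> real) \<Rightarrow> ('a \<Rightarrow> real^2^2) \<Rightarrow> ('a \<Rightarrow> real) \<Rightarrow>
      real \<Rightarrow> 'a \<Rightarrow> (real^2) set" where
  "endpoint_pair M \<gamma> h A \<alpha>\<^sub>u \<beta> \<theta> =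
     (let x = attractor_radius M \<gamma> h A \<beta> \<theta> (\<alpha>\<^sub>u \<theta>) *\<^sub>R direction (\<alpha>\<^sub>u \<theta>) in {x, - x})"

end

theory Submission
  imports Defs "HOL-Homology.Invariance_of_Domain"
begin

text \<open>In polar coordinates an orbit of the fibre maps is a scalar orbit
  \<open>x\<^sub>n\<^sub>+\<^sub>1 = h (\<beta> * x\<^sub>n) * (d\<^sub>n\<^sub>+\<^sub>1 / d\<^sub>n)\<close>, where \<open>d\<^sub>n\<close> is the norm of the linear orbit, and the fibre
  of the attractor is a star whose radius in the direction \<open>u\<close> is the decreasing limit of such
  pullback orbits started at radius \<open>1\<close> (\<open>d\<^sub>k\<close> is then read along the backward orbit of \<open>u\<close>).
  By strict concavity \<open>h x / x\<close> decreases from \<open>1\<close>. Hence scalar orbits with comparable \<open>d\<close> are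
  comparable, orbits whose ratio of \<open>d\<close> converges are asymptotic to each other, and every orbit with
  \<open>\<beta>\<^sup>n d\<^sub>n\<close> subexponential has averages tending to \<open>0\<close>.

  For a positive exponent, Kingman's theorem and the convergence of the most contracted directions
  yield the stable and the unstable direction. The radius vanishes on the stable direction at
  \<open>\<beta>\<^sub>2\<close> and on the unstable direction at \<open>\<beta>\<^sub>1\<close>, since its integral equals that of its
  averages along the orbit; comparison carries the zero from the stable direction to all directions
  except the unstable one. For exponent \<open>0\<close> no ergodic theory is needed to see that two independent
  directions cannot both have positive radius: backward growth would be bounded in all directions,
  and then the radii would have to increase geometrically.\<close>

section \<open>Subadditive processes over ergodic systems\<close>

text \<open>At the critical parameters there is no exponential margin:
  \<open>\<beta> ^ n * d n\<close> is only known to be subexponential, and the linear bound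
  \<open>h u <= u\<close> proves nothing. Strict concavity supplies instead a fixed loss factor at
  every visit above a given level, so such visits have frequency zero. This controls averages rather
  than single values, hence the density-zero set in part (a). For the radius, averages are enough
  because the measure is invariant. Since radii are read along backward orbits, they survive on the
  line that shrinks backwards, the unstable one, as soon as \<beta> exceeds
  \<open>exp (- l)\<close>. The stable line is critical at \<open>exp l\<close>, where the factor
  \<open>exp l ^ n\<close> just cancels its forward decay. The fibre maps are not linear, but they
  send rays to rays by the linear cocycle, and the scalar recursion sees the cocycle only through
  quotients of norms. This separates the two problems: the geometry of lines is linear, the
  nonlinearity is one-dimensional.\<close>

locale measure_preserving = prob_space M for M :: "'a measure" +
  fixes T :: "'a \<Rightarrow> 'a"
  assumes T_measurable [measurable]: "T \<in> M \<rightarrow>\<^sub>M M"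
    and emeasure_vimage_T: "B \<in> sets M \<Longrightarrow> emeasure M (T -` B \<inter> space M) = emeasure M B"
begin

lemma iterate_measurable [measurable]: "T ^^ n \<in> M \<rightarrow>\<^sub>M M"
  by (rule measurable_compose_n) (rule T_measurable)

lemma iterate_in_space: "x \<in> space M \<Longrightarrow> (T ^^ n) x \<in> space M"
  using measurable_space[OF iterate_measurable] .

lemma distr_iterate: "distr M M (T ^^ n) = M"
proof (induction n)
  case 0
  then show ?case by (simp add: distr_id[unfolded id_def] id_def)
next
  case (Suc n)
  have "distr M M (T ^^ Suc n) = distr (distr M M (T ^^ n)) M T"
    by (subst distr_distr) (auto simp: comp_def)
  also have "\<dots> = distr M M T"
    using Suc by simp
  also have "\<dots> = M"
    by (rule measure_eqI) (auto simp: emeasure_distr emeasure_vimage_T)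
  finally show ?case .
qed

lemma integral_iterate:
  fixes f :: "'a \<Rightarrow> real"
  assumes "f \<in> borel_measurable M"
  shows "(\<integral>x. f ((T ^^ n) x) \<partial>M) = (\<integral>x. f x \<partial>M)"
  using integral_distr[OF iterate_measurable[of n] assms] by (simp add: distr_iterate)

lemma AE_iterate: "AE x in M. P x \<Longrightarrow> AE x in M. P ((T ^^ n) x)"
  using AE_distrD[OF iterate_measurable[of n], of P] unfolding distr_iterate .

end

locale ergodic_system = measure_preserving +
  assumes ergodic: "B \<in> sets M \<Longrightarrow> T -` B \<inter> space M = B \<Longrightarrow>
    emeasure M B = 0 \<or> emeasure M (space M - B) = 0"
begin

text \<open>The preimage of \<open>B\<close> is contained in \<open>B\<close> and has the same
  measure, so \<open>B\<close> is invariant up to a null set. One-sided sets of this kind arise from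
  asymptotic conditions that tolerate one extra step.\<close>

lemma zero_one_law:
  assumes B [measurable]: "B \<in> sets M" and sub: "\<And>x. x \<in> space M \<Longrightarrow> T x \<in> B \<Longrightarrow> x \<in> B"
  shows "(AE x in M. x \<in> B) \<or> (AE x in M. x \<notin> B)"
proof -
  \<comment> \<open>Ergodicity is stated for strictly invariant sets. The points whose whole forward
    orbit stays in \<open>B\<close> form such a set, and it differs from \<open>B\<close> by a null
    set.\<close>
  define C where "C = {x \<in> space M. \<forall>n. (T ^^ n) x \<in> B}"
  have C [measurable]: "C \<in> sets M"
    unfolding C_def by measurable
  have pre: "T -` B \<inter> space M \<subseteq> B"
    using sub by auto
  have "emeasure M (B - (T -` B \<inter> space M)) = emeasure M B - emeasure M (T -` B \<inter> space M)"
    by (rule emeasure_Diff) (use pre in auto)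
  also have "\<dots> = 0"
    by (simp add: emeasure_vimage_T)
  finally have null: "B - (T -` B \<inter> space M) \<in> null_sets M"
    by (auto simp: null_sets_def)
  have step: "AE x in M. x \<in> B \<longrightarrow> T x \<in> B"
    by (rule AE_I'[OF null]) auto
  have "AE x in M. (T ^^ n) x \<in> B \<longrightarrow> T ((T ^^ n) x) \<in> B" for n
    by (rule AE_iterate[OF step])
  then have "AE x in M. \<forall>n. (T ^^ n) x \<in> B \<longrightarrow> T ((T ^^ n) x) \<in> B"
    by (simp add: AE_all_countable)
  then have BC: "AE x in M. x \<in> B \<longrightarrow> x \<in> C"
  proof eventually_elim
    case (elim x)
    show ?case
    proof
      assume x: "x \<in> B"
      have "(T ^^ n) x \<in> B" for n
        using x elim by (induction n) auto
      moreover have "x \<in> space M"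
        using x sets.sets_into_space[OF B] by auto
      ultimately show "x \<in> C"
        by (auto simp: C_def)
    qed
  qed
  have CB: "C \<subseteq> B"
    unfolding C_def by (auto dest: spec[of _ 0])
  have "T x \<in> C \<longleftrightarrow> x \<in> C" if x: "x \<in> space M" for x
  proof -
    have Tx: "T x \<in> space M"
      using iterate_in_space[OF x, of 1] by simp
    have shift: "(T ^^ n) (T x) = (T ^^ Suc n) x" for n
      by (simp add: funpow_swap1)
    have "(\<forall>n. (T ^^ Suc n) x \<in> B) \<longleftrightarrow> (\<forall>n. (T ^^ n) x \<in> B)"
      using sub[OF x] by (metis funpow_0 funpow_simps_right(1) id_apply not0_implies_Suc shift)
    then show ?thesis
      using x Tx by (simp add: C_def shift del: funpow.simps)
  qed
  then have "T -` C \<inter> space M = C"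
    by (auto simp: C_def)
  from ergodic[OF C this] show ?thesis
  proof
    assume "emeasure M C = 0"
    then have "AE x in M. x \<notin> C"
      by (intro AE_I'[of C]) (auto simp: null_sets_def)
    with BC have "AE x in M. x \<notin> B"
      by eventually_elim auto
    then show ?thesis ..
  next
    assume "emeasure M (space M - C) = 0"
    then have "AE x in M. x \<in> C"
      by (intro AE_I'[of "space M - C"]) (auto simp: null_sets_def)
    then have "AE x in M. x \<in> B"
      using CB by auto
    then show ?thesis ..
  qed
qed

end

section \<open>Kingman's subadditive ergodic theorem\<close>

locale subadditive_process = ergodic_system +
  fixes F :: "nat \<Rightarrow> 'a \<Rightarrow> real" and L :: real
  assumes F_measurable [measurable]: "F n \<in> borel_measurable M"
    and F_bound: "x \<in> space M \<Longrightarrow> \<bar>F n x\<bar> \<le> real n * L"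
    and F_subadditive: "x \<in> space M \<Longrightarrow> F (n + m) x \<le> F n x + F m ((T ^^ n) x)"
begin

lemma L_nonneg: "0 \<le> L"
proof -
  obtain x where "x \<in> space M"
    using not_empty by auto
  from F_bound[OF this, of 1] show ?thesis by simp
qed

lemma F_integrable: "integrable M (F n)"
  by (rule integrable_const_bound[of _ "real n * L"]) (auto simp: F_bound)

text \<open>The greedy decomposition of Katznelson and Weiss: an orbit segment is cut into blocks of
  length at most \<open>N\<close> on which \<open>F\<close> is small, and into exceptional points.\<close>

lemma greedy_decomposition:
  fixes \<psi> :: "'a \<Rightarrow> real"
  assumes N: "N \<ge> 1" and D: "D \<ge> 0"
    and \<psi>: "\<And>x. x \<in> space M \<Longrightarrow> - D \<le> \<psi> x"
    and block: "\<And>x. x \<in> space M \<Longrightarrow> \<exists>k\<in>{1..N}. F k x \<le> (\<Sum>j<k. \<psi> ((T ^^ j) x))"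
  shows "x \<in> space M \<Longrightarrow> F n x \<le> (\<Sum>j<n. \<psi> ((T ^^ j) x)) + real N * (L + D)"
proof (induction n arbitrary: x rule: less_induct)
  case (less n)
  show ?case
  proof (cases "n < N")
    case True
    \<comment> \<open>The remaining piece is shorter than \<open>N\<close>: it costs at most
      \<open>N * L\<close> in \<open>F\<close> and at most \<open>N * D\<close> in the sum, which
      explains the additive constant.\<close>
    have "- (real N * D) \<le> - (real n * D)"
      using True D by (simp add: mult_right_mono)
    also have "\<dots> = (\<Sum>j<n. - D)"
      by simp
    also have "\<dots> \<le> (\<Sum>j<n. \<psi> ((T ^^ j) x))"
      by (intro sum_mono \<psi> iterate_in_space less.prems)
    finally have "- (real N * D) \<le> (\<Sum>j<n. \<psi> ((T ^^ j) x))" .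
    moreover have "F n x \<le> real N * L"
    proof -
      have "F n x \<le> real n * L"
        using F_bound[OF less.prems, of n] by simp
      also have "\<dots> \<le> real N * L"
        using True L_nonneg by (intro mult_right_mono) auto
      finally show ?thesis .
    qed
    ultimately show ?thesis
      by (simp add: algebra_simps)
  next
    case False
    obtain k where k: "1 \<le> k" "k \<le> N" and Fk: "F k x \<le> (\<Sum>j<k. \<psi> ((T ^^ j) x))"
      using block[OF less.prems] by auto
    have kn: "k + (n - k) = n"
      using k False by simp
    have "F n x \<le> F k x + F (n - k) ((T ^^ k) x)"
      using F_subadditive[OF less.prems, of k "n - k"] kn by simp
    also have "\<dots> \<le> (\<Sum>j<k. \<psi> ((T ^^ j) x)) +
        ((\<Sum>j<n-k. \<psi> ((T ^^ j) ((T ^^ k) x))) + real N * (L + D))"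
      using less.IH[of "n - k" "(T ^^ k) x"] k False Fk iterate_in_space[OF less.prems]
      by (intro add_mono) auto
    also have "(\<Sum>j<n-k. \<psi> ((T ^^ j) ((T ^^ k) x))) = (\<Sum>j=k..<n. \<psi> ((T ^^ j) x))"
    proof -
      have "(\<Sum>j=k..<n. \<psi> ((T ^^ j) x)) = (\<Sum>j=0+k..<(n-k)+k. \<psi> ((T ^^ j) x))"
        using kn by (simp add: add.commute)
      also have "\<dots> = (\<Sum>j<n-k. \<psi> ((T ^^ (j + k)) x))"
        by (subst sum.shift_bounds_nat_ivl) (simp add: atLeast0LessThan)
      finally show ?thesis
        by (simp add: funpow_add)
    qed
    also have "(\<Sum>j<k. \<psi> ((T ^^ j) x)) + ((\<Sum>j=k..<n. \<psi> ((T ^^ j) x)) + real N * (L + D))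
        = (\<Sum>j<n. \<psi> ((T ^^ j) x)) + real N * (L + D)"
      using sum.atLeastLessThan_concat[of 0 k n "\<lambda>j. \<psi> ((T ^^ j) x)"] kn
      by (simp add: atLeast0LessThan)
    finally show ?thesis .
  qed
qed

text \<open>For large \<open>N\<close> all but a small set of points have a good block of length at
  most \<open>N\<close>. In the greedy decomposition the other points cost at most \<open>L\<close>
  each, and integrating it makes the boundary term negligible for long orbits.\<close>

lemma integral_upper_bound:
  assumes small: "AE x in M. \<exists>n\<ge>1. F n x \<le> real n * c" and "c < c'"
  shows "\<exists>n\<ge>1. (\<integral>x. F n x \<partial>M) < real n * c'"
proof (cases "L < c'")
  case True
  have "(\<integral>x. F 1 x \<partial>M) \<le> (\<integral>x. L \<partial>M)"
    using F_bound[of _ 1] by (intro integral_mono F_integrable) (auto simp: abs_le_iff)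
  then show ?thesis
    using True by (intro exI[of _ 1]) (simp add: prob_space)
next
  case False
  then have cL: "c < L"
    using assms by simp
  define G where "G N = {x \<in> space M. \<exists>n\<in>{1..N}. F n x \<le> real n * c}" for N
  have G [measurable]: "G N \<in> sets M" for N
    unfolding G_def by measurable
  have "(\<lambda>N. measure M (G N)) \<longlonglongrightarrow> measure M (\<Union>N. G N)"
    by (rule finite_Lim_measure_incseq) (auto simp: incseq_def G_def)
  moreover have "measure M (\<Union>N. G N) = 1"
  proof (subst prob_eq_1)
    show "AE x in M. x \<in> (\<Union>N. G N)"
      using small AE_space
    proof eventually_elim
      case (elim x)
      then obtain n where "n \<ge> 1" "F n x \<le> real n * c" by auto
      then have "x \<in> G n"
        using elim by (auto simp: G_def)
      then show ?case by auto
    qed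
  qed auto
  ultimately have lim: "(\<lambda>N. measure M (G N)) \<longlonglongrightarrow> 1" by simp
  \<comment> \<open>Replacing \<open>c\<close> by \<open>L\<close> on a set of measure \<eta> raises
    the mean by \<open>(L - c) * \<eta>\<close>, here half of the gap \<open>c' - c\<close>.\<close>
  define \<eta> where "\<eta> = (c' - c) / (2 * (L - c))"
  have \<eta>: "\<eta> > 0"
    using assms cL by (simp add: \<eta>_def)
  have "eventually (\<lambda>N. measure M (G N) > 1 - \<eta>) sequentially"
    by (rule order_tendstoD(1)[OF lim]) (use \<eta> in auto)
  moreover have "eventually (\<lambda>N. N \<ge> (1::nat)) sequentially"
    by (rule eventually_ge_at_top)
  ultimately have "eventually (\<lambda>N. measure M (G N) > 1 - \<eta> \<and> N \<ge> 1) sequentially"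
    by eventually_elim auto
  then obtain N where N: "measure M (G N) > 1 - \<eta>" "N \<ge> 1"
    by (auto simp: eventually_sequentially)
  \<comment> \<open>An exceptional point forms a block of length 1 and pays \<open>L\<close>. Points
    inside a good block may be exceptional too, so only \<open>c <= \<psi>\<close> is used along a
    block.\<close>
  define \<psi> where "\<psi> x = L - (L - c) * indicator (G N) x" for x
  have \<psi>_meas [measurable]: "\<psi> \<in> borel_measurable M"
    unfolding \<psi>_def by measurable
  have \<psi>_ge: "\<psi> x \<ge> c" for x
    using cL by (auto simp: \<psi>_def indicator_def)
  have "integrable M (\<lambda>x. indicator (G N) x :: real)"
    by (rule integrable_const_bound[of _ 1]) (auto simp: indicator_def)
  then have "(\<integral>x. \<psi> x \<partial>M) = L - (L - c) * measure M (G N)"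
    unfolding \<psi>_def by (subst Bochner_Integration.integral_diff)
      (auto intro!: integrable_mult_right simp: prob_space)
  also have "\<dots> \<le> L - (L - c) * (1 - \<eta>)"
    using N(1) cL by (intro diff_left_mono mult_left_mono) auto
  also have "\<dots> = (c + c') / 2"
    using cL by (simp add: \<eta>_def field_simps)
  finally have \<psi>_le: "(\<integral>x. \<psi> x \<partial>M) \<le> (c + c') / 2" .
  have block: "\<exists>k\<in>{1..N}. F k x \<le> (\<Sum>j<k. \<psi> ((T ^^ j) x))" if x: "x \<in> space M" for x
  proof (cases "x \<in> G N")
    case True
    then obtain k where k: "k \<in> {1..N}" "F k x \<le> real k * c"
      by (auto simp: G_def)
    have "real k * c = (\<Sum>j<k. c)"
      by simp
    also have "\<dots> \<le> (\<Sum>j<k. \<psi> ((T ^^ j) x))"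
      by (intro sum_mono \<psi>_ge)
    finally show ?thesis
      using k by (intro bexI[of _ k]) auto
  next
    case False
    then show ?thesis
      using N(2) F_bound[OF x, of 1] by (intro bexI[of _ 1]) (auto simp: \<psi>_def)
  qed
  define C where "C = real N * (L + \<bar>c\<bar>)"
  have "- \<bar>c\<bar> \<le> \<psi> x" for x
    using \<psi>_ge[of x] by linarith
  then have bound: "F n x \<le> (\<Sum>j<n. \<psi> ((T ^^ j) x)) + C" if "x \<in> space M" for x n
    unfolding C_def by (intro greedy_decomposition N(2) block that) auto
  have \<psi>T_int: "integrable M (\<lambda>x. \<psi> ((T ^^ j) x))" for j
    by (rule integrable_const_bound[of _ "\<bar>L\<bar> + \<bar>L - c\<bar>"]) (auto simp: \<psi>_def indicator_def)
  have int: "(\<integral>x. F n x \<partial>M) \<le> real n * ((c + c') / 2) + C" for n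
  proof -
    have "(\<integral>x. F n x \<partial>M) \<le> (\<integral>x. (\<Sum>j<n. \<psi> ((T ^^ j) x)) + C \<partial>M)"
      using bound by (intro integral_mono F_integrable Bochner_Integration.integrable_add
          Bochner_Integration.integrable_sum \<psi>T_int) auto
    also have "\<dots> = (\<Sum>j<n. \<integral>x. \<psi> ((T ^^ j) x) \<partial>M) + C"
      by (subst Bochner_Integration.integral_add)
        (auto intro!: Bochner_Integration.integrable_sum \<psi>T_int simp: prob_space Bochner_Integration.integral_sum \<psi>T_int)
    also have "\<dots> = real n * (\<integral>x. \<psi> x \<partial>M) + C"
      by (simp add: integral_iterate)
    also have "\<dots> \<le> real n * ((c + c') / 2) + C"
      using \<psi>_le by (intro add_right_mono mult_left_mono) auto
    finally show ?thesis .
  qed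
  \<comment> \<open>The other half of the gap, accumulated over \<open>n\<close> steps, exceeds the
    boundary constant \<open>C\<close>.\<close>
  obtain n :: nat where n: "2 * C / (c' - c) < real n"
    using reals_Archimedean2 by blast
  have "C \<ge> 0"
    using L_nonneg by (simp add: C_def)
  then have "n \<ge> 1"
    using n assms by (cases n) (auto simp: field_simps)
  moreover have "real n * ((c + c') / 2) + C < real n * c'"
    using n assms by (simp add: field_simps)
  ultimately show ?thesis
    using int[of n] by (intro exI[of _ n]) auto
qed

text \<open>The set where the bound fails infinitely often obeys the zero-one law, and if it had
  full measure, \<open>integral_upper_bound\<close> would produce an integral below the assumed
  lower bound.\<close>

lemma eventually_lower_bound:
  assumes low: "\<And>n. n \<ge> 1 \<Longrightarrow> real n * c \<le> (\<integral>x. F n x \<partial>M)" and "c' < c"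
  shows "AE x in M. eventually (\<lambda>n. real n * c' < F n x) sequentially"
proof -
  \<comment> \<open>Levels decreasing to \<open>c'\<close>: one more step of the orbit changes
    \<open>F\<close> by at most \<open>L\<close>, and the passage from level
    \<open>r (Suc k)\<close> to the higher level \<open>r k\<close> absorbs this for large
    times.\<close>
  define r where "r k = c' + 1 / real (Suc k)" for k
  define B where "B = {x \<in> space M. \<forall>k m. \<exists>n\<ge>m. F n x \<le> real n * r k}"
  have B [measurable]: "B \<in> sets M"
    unfolding B_def by measurable
  have inv: "x \<in> B" if x: "x \<in> space M" "T x \<in> B" for x
    unfolding B_def
  proof (intro CollectI conjI x allI)
    fix k m
    define \<delta> where "\<delta> = r k - r (Suc k)"
    have \<delta>: "\<delta> > 0"
      by (simp add: \<delta>_def r_def frac_less2)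
    obtain m' :: nat where m': "(L + \<bar>r k\<bar>) / \<delta> < real m'"
      using reals_Archimedean2 by blast
    obtain n where n: "n \<ge> max m m'" "F n (T x) \<le> real n * r (Suc k)"
      using x(2) unfolding B_def by blast
    have "F (Suc n) x \<le> L + F n (T x)"
      using F_subadditive[OF x(1), of 1 n] F_bound[OF x(1), of 1] by simp
    also have "\<dots> \<le> L + real n * r (Suc k)"
      using n by simp
    also have "\<dots> \<le> real (Suc n) * r k"
    proof -
      have "L + \<bar>r k\<bar> \<le> real m' * \<delta>"
        using m' \<delta> by (simp add: field_simps)
      also have "\<dots> \<le> real n * \<delta>"
        using n \<delta> by (intro mult_right_mono) auto
      finally show ?thesis
        by (simp add: \<delta>_def algebra_simps)
    qed
    finally show "\<exists>n\<ge>m. F n x \<le> real n * r k"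
      using n by (intro exI[of _ "Suc n"]) auto
  qed
  have "\<not> (AE x in M. x \<in> B)"
  proof
    assume AE: "AE x in M. x \<in> B"
    obtain k :: nat where k: "inverse (real (Suc k)) < c - c'"
      using reals_Archimedean[of "c - c'"] assms by auto
    have "AE x in M. \<exists>n\<ge>1. F n x \<le> real n * r k"
      using AE by eventually_elim (auto simp: B_def)
    moreover have "r k < c"
      using k by (simp add: r_def field_simps)
    ultimately obtain n where "n \<ge> 1" "(\<integral>x. F n x \<partial>M) < real n * c"
      using integral_upper_bound by blast
    with low[of n] show False by simp
  qed
  then have "AE x in M. x \<notin> B"
    using zero_one_law[OF B inv] by auto
  with AE_space show ?thesis
  proof eventually_elim
    case (elim x)
    then obtain k m where km: "\<And>n. n \<ge> m \<Longrightarrow> F n x > real n * r k"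
      unfolding B_def not_le[symmetric] by blast
    have "real n * c' \<le> real n * r k" for n
      by (intro mult_left_mono) (auto simp: r_def)
    with km show ?case
      by (auto simp: eventually_sequentially intro: le_less_trans)
  qed
qed

end

context ergodic_system
begin

text \<open>The negated Birkhoff sums are additive, hence also a subadditive process, and their
  lower bound is the required upper bound.\<close>

lemma birkhoff_eventually_less:
  fixes \<phi> :: "'a \<Rightarrow> real"
  assumes [measurable]: "\<phi> \<in> borel_measurable M"
    and bound: "\<And>x. x \<in> space M \<Longrightarrow> \<bar>\<phi> x\<bar> \<le> L" and c: "(\<integral>x. \<phi> x \<partial>M) < c"
  shows "AE x in M. eventually (\<lambda>n. (\<Sum>j<n. \<phi> ((T ^^ j) x)) < real n * c) sequentially"
proof -
  define F where "F n x = - (\<Sum>j<n. \<phi> ((T ^^ j) x))" for n x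
  interpret subadditive_process M T F L
  proof
    show "F n \<in> borel_measurable M" for n
      unfolding F_def by measurable
    show "\<bar>F n x\<bar> \<le> real n * L" if "x \<in> space M" for n x
      unfolding F_def abs_minus_cancel
      by (rule order_trans[OF sum_abs]) (rule order_trans[OF sum_mono[of _ _ "\<lambda>_. L"]],
          auto intro!: bound iterate_in_space that)
    show "F (n + m) x \<le> F n x + F m ((T ^^ n) x)" for n m x
    proof -
      have "(\<Sum>j<n+m. \<phi> ((T ^^ j) x)) =
          (\<Sum>j<n. \<phi> ((T ^^ j) x)) + (\<Sum>j=n..<n+m. \<phi> ((T ^^ j) x))"
        using sum.atLeastLessThan_concat[of 0 n "n + m" "\<lambda>j. \<phi> ((T ^^ j) x)"]
        by (simp add: atLeast0LessThan)
      also have "(\<Sum>j=n..<n+m. \<phi> ((T ^^ j) x)) = (\<Sum>j<m. \<phi> ((T ^^ (j + n)) x))"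
        using sum.shift_bounds_nat_ivl[of "\<lambda>j. \<phi> ((T ^^ j) x)" 0 n m]
        by (simp add: atLeast0LessThan add.commute)
      finally show ?thesis
        by (simp add: F_def funpow_add)
    qed
  qed
  have int: "integrable M (\<lambda>x. \<phi> ((T ^^ j) x))" for j
    by (rule integrable_const_bound[of _ L]) (auto intro!: bound iterate_in_space)
  have "(\<integral>x. F n x \<partial>M) = real n * - (\<integral>x. \<phi> x \<partial>M)" for n
    unfolding F_def by (simp add: Bochner_Integration.integral_sum int integral_iterate)
  then have "AE x in M. eventually (\<lambda>n. real n * - c < F n x) sequentially"
    by (intro eventually_lower_bound[of "- (\<integral>x. \<phi> x \<partial>M)"]) (use c in auto)
  then show ?thesis
    by (simp add: F_def)
qed

end

context subadditive_process
begin

text \<open>Averaging over the \<open>k\<close> shifts of a decomposition into blocks of length \<open>k\<close>.\<close>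

lemma block_average:
  assumes x: "x \<in> space M"
  shows "real k * F (m + k) x \<le> (\<Sum>j<m. F k ((T ^^ j) x)) + 3 * real k * (real k * L)"
proof -
  \<comment> \<open>One summand for each of the \<open>k\<close> offsets of the block grid.
    Advancing the base point by one step permutes the summands except the first, which is cut once;
    so each step costs exactly one \<open>F k\<close>.\<close>
  define U where "U m x = (\<Sum>i<k. F (m + k - i) ((T ^^ i) x))" for m x
  have U_step: "U (Suc m) x \<le> F k x + U m (T x)" if x: "x \<in> space M" for m x
  proof (cases k)
    case 0
    then show ?thesis using F_bound[OF x, of 0] by (simp add: U_def)
  next
    case (Suc l)
    have "U (Suc m) x = F (Suc m + k) x + (\<Sum>i<l. F (m + k - i) ((T ^^ i) (T x)))"
      unfolding U_def Suc by (subst sum.lessThan_Suc_shift) (simp add: funpow_swap1)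
    moreover have "U m (T x) = (\<Sum>i<l. F (m + k - i) ((T ^^ i) (T x))) + F (Suc m) ((T ^^ k) x)"
      unfolding U_def Suc by (simp add: funpow_swap1)
    moreover have "F (Suc m + k) x \<le> F k x + F (Suc m) ((T ^^ k) x)"
      using F_subadditive[OF x, of k "Suc m"] by (simp add: add.commute)
    ultimately show ?thesis by simp
  qed
  have U0: "U 0 x \<le> real k * (real k * L)" if x: "x \<in> space M" for x
  proof -
    have "U 0 x \<le> (\<Sum>i<k. real k * L)"
      unfolding U_def
    proof (rule sum_mono)
      fix i assume "i \<in> {..<k}"
      have "F (0 + k - i) ((T ^^ i) x) \<le> real (k - i) * L"
        using F_bound[OF iterate_in_space[OF x], of "k - i" i] by simp
      also have "\<dots> \<le> real k * L"
        using L_nonneg by (intro mult_right_mono) auto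
      finally show "F (0 + k - i) ((T ^^ i) x) \<le> real k * L" .
    qed
    then show ?thesis by simp
  qed
  have U_le: "U m x \<le> (\<Sum>j<m. F k ((T ^^ j) x)) + real k * (real k * L)" if "x \<in> space M" for x
    using that
  proof (induction m arbitrary: x)
    case 0
    then show ?case using U0 by simp
  next
    case (Suc m)
    have "U (Suc m) x \<le> F k x + U m (T x)"
      by (rule U_step[OF Suc.prems])
    also have "\<dots> \<le> F k x + ((\<Sum>j<m. F k ((T ^^ j) (T x))) + real k * (real k * L))"
      using Suc.IH[of "T x"] iterate_in_space[OF Suc.prems, of 1] by simp
    also have "F k x + ((\<Sum>j<m. F k ((T ^^ j) (T x))) + real k * (real k * L))
       = (\<Sum>j<Suc m. F k ((T ^^ j) x)) + real k * (real k * L)"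
      by (subst sum.lessThan_Suc_shift) (simp add: funpow_swap1)
    finally show ?case .
  qed
  have "real k * F (m + k) x = (\<Sum>i<k. F (m + k) x)"
    by simp
  also have "\<dots> \<le> (\<Sum>i<k. real k * L + F (m + k - i) ((T ^^ i) x))"
  proof (rule sum_mono)
    fix i assume i: "i \<in> {..<k}"
    have "F (m + k) x \<le> F i x + F (m + k - i) ((T ^^ i) x)"
      using F_subadditive[OF x, of i "m + k - i"] i by simp
    moreover have "F i x \<le> real k * L"
    proof -
      have "F i x \<le> real i * L"
        using F_bound[OF x, of i] by simp
      also have "\<dots> \<le> real k * L"
        using L_nonneg i by (intro mult_right_mono) auto
      finally show ?thesis .
    qed
    ultimately show "F (m + k) x \<le> real k * L + F (m + k - i) ((T ^^ i) x)" by simp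
  qed
  also have "\<dots> = real k * (real k * L) + U m x"
    by (simp add: U_def sum.distrib)
  also have "\<dots> \<le> (\<Sum>j<m. F k ((T ^^ j) x)) + 3 * real k * (real k * L)"
  proof -
    have "0 \<le> real k * (real k * L)"
      using L_nonneg by simp
    then show ?thesis
      using U_le[OF x] by (simp only: mult.assoc)
  qed
  finally show ?thesis .
qed

lemma eventually_upper_bound:
  assumes k: "k \<ge> 1" and c: "(\<integral>x. F k x \<partial>M) < real k * c"
  shows "AE x in M. eventually (\<lambda>n. F n x < real n * c) sequentially"
proof -
  \<comment> \<open>The midpoint between the average and \<open>c\<close>: Birkhoff's bound is spent
    on \<open>c'\<close>, and the rest of the gap absorbs the constant of
    \<open>block_average\<close>.\<close>
  define c' where "c' = ((\<integral>x. F k x \<partial>M) / real k + c) / 2"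
  have c': "(\<integral>x. F k x \<partial>M) < real k * c'" "c' < c"
    using k c by (auto simp: c'_def field_simps)
  define C where "C = 3 * real k * (real k * L) + real k * (real k * \<bar>c\<bar>)"
  have "AE x in M. eventually (\<lambda>n. (\<Sum>j<n. F k ((T ^^ j) x)) < real n * (real k * c')) sequentially"
    by (rule birkhoff_eventually_less[where L = "real k * L"]) (auto simp: F_bound c')
  with AE_space show ?thesis
  proof eventually_elim
    case (elim x)
    obtain m0 :: nat where m0: "C / (real k * (c - c')) < real m0"
      using reals_Archimedean2 by blast
    have "eventually (\<lambda>m. F (m + k) x < real (m + k) * c) sequentially"
      using elim(2) eventually_ge_at_top[of m0]
    proof eventually_elim
      fix m assume le: "(\<Sum>j<m. F k ((T ^^ j) x)) < real m * (real k * c')" and m: "m0 \<le> m"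
      have "C < real m0 * (real k * (c - c'))"
        using m0 c' k by (simp add: field_simps)
      also have "\<dots> \<le> real m * (real k * (c - c'))"
        using m c' k by (intro mult_right_mono) auto
      finally have "C < real m * (real k * (c - c'))" .
      moreover have "real k * F (m + k) x \<le> (\<Sum>j<m. F k ((T ^^ j) x)) + 3 * real k * (real k * L)"
        by (rule block_average[OF elim(1)])
      moreover have "- (real k * (real k * \<bar>c\<bar>)) \<le> real k * (real k * c)"
        by (cases "c \<ge> 0") (auto simp: mult_nonneg_nonneg)
      ultimately have "real k * F (m + k) x < real k * (real (m + k) * c)"
        using le by (simp add: C_def algebra_simps)
      then show "F (m + k) x < real (m + k) * c"
        using k by simp
    qed
    then show ?case
      using eventually_sequentially_seg[of "\<lambda>n. F n x < real n * c" k] by simp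
  qed
qed

text \<open>The infimum lies below every average, which feeds the lower bound, and is nearly
  attained at some \<open>k\<close>, which feeds the upper bound. The integrals then converge by
  dominated convergence from the pointwise limit.\<close>

theorem kingman:
  defines "\<Lambda> \<equiv> (INF n\<in>{1..}. (\<integral>x. F n x \<partial>M) / real n)"
  shows "AE x in M. (\<lambda>n. F n x / real n) \<longlonglongrightarrow> \<Lambda>"
    and "(\<lambda>n. 1 / real n * (\<integral>x. F n x \<partial>M)) \<longlonglongrightarrow> \<Lambda>"
proof -
  have abs: "\<bar>\<integral>x. F n x \<partial>M\<bar> \<le> real n * L" for n
  proof -
    have "\<bar>\<integral>x. F n x \<partial>M\<bar> \<le> (\<integral>x. \<bar>F n x\<bar> \<partial>M)"
      by (rule integral_abs_bound)
    also have "\<dots> \<le> (\<integral>x. real n * L \<partial>M)"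
      by (intro integral_mono integrable_abs F_integrable) (auto simp: F_bound)
    finally show ?thesis by (simp add: prob_space)
  qed
  have bdd: "bdd_below ((\<lambda>n. (\<integral>x. F n x \<partial>M) / real n) ` {1..})"
  proof (rule bdd_belowI2)
    show "- L \<le> (\<integral>x. F n x \<partial>M) / real n" if "n \<in> {1..}" for n
      using abs[of n] that by (simp add: field_simps abs_le_iff)
  qed
  have low: "real n * \<Lambda> \<le> (\<integral>x. F n x \<partial>M)" if "n \<ge> 1" for n
    using cINF_lower[OF bdd, of n] that by (simp add: \<Lambda>_def field_simps)
  have lo: "AE x in M. \<forall>j. eventually (\<lambda>n. real n * (\<Lambda> - 1 / real (Suc j)) < F n x) sequentially"
    unfolding AE_all_countable by (intro allI eventually_lower_bound[OF low]) auto
  have up: "AE x in M. \<forall>j. eventually (\<lambda>n. F n x < real n * (\<Lambda> + 1 / real (Suc j))) sequentially"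
    unfolding AE_all_countable
  proof
    fix j
    have "\<exists>n\<in>{1..}. (\<integral>x. F n x \<partial>M) / real n < \<Lambda> + 1 / real (Suc j)"
      using cINF_less_iff[OF _ bdd, of "\<Lambda> + 1 / real (Suc j)"] by (auto simp: \<Lambda>_def)
    then obtain k where "k \<ge> 1" "(\<integral>x. F k x \<partial>M) < real k * (\<Lambda> + 1 / real (Suc j))"
      by (auto simp: field_simps)
    then show "AE x in M. eventually (\<lambda>n. F n x < real n * (\<Lambda> + 1 / real (Suc j))) sequentially"
      by (rule eventually_upper_bound)
  qed
  from lo up show lim: "AE x in M. (\<lambda>n. F n x / real n) \<longlonglongrightarrow> \<Lambda>"
  proof eventually_elim
    case (elim x)
    show ?case
    proof (rule tendstoI)
      fix e :: real assume "e > 0"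
      then obtain j where j: "inverse (real (Suc j)) < e"
        using reals_Archimedean by blast
      show "eventually (\<lambda>n. dist (F n x / real n) \<Lambda> < e) sequentially"
        using elim(1)[rule_format, of j] elim(2)[rule_format, of j] eventually_ge_at_top[of 1]
      proof eventually_elim
        fix n assume n: "real n * (\<Lambda> - 1 / real (Suc j)) < F n x"
          "F n x < real n * (\<Lambda> + 1 / real (Suc j))" "1 \<le> n"
        have "\<Lambda> - 1 / real (Suc j) < F n x / real n" "F n x / real n < \<Lambda> + 1 / real (Suc j)"
          using n by (simp_all add: pos_less_divide_eq pos_divide_less_eq mult.commute)
        then show "dist (F n x / real n) \<Lambda> < e"
          using j by (simp add: dist_real_def inverse_eq_divide abs_less_iff)
      qed
    qed
  qed
  have "(\<lambda>n. \<integral>x. F n x / real n \<partial>M) \<longlonglongrightarrow> (\<integral>x. \<Lambda> \<partial>M)"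
  proof (rule integral_dominated_convergence[where w = "\<lambda>_. L"])
    show "AE x in M. norm (F n x / real n) \<le> L" for n
    proof (cases "n = 0")
      case False
      then show ?thesis
        using F_bound[of _ n] by (auto simp: abs_divide field_simps)
    qed (auto simp: L_nonneg)
  qed (use lim in auto)
  then show "(\<lambda>n. 1 / real n * (\<integral>x. F n x \<partial>M)) \<longlonglongrightarrow> \<Lambda>"
    by (simp add: prob_space)
qed

end

section \<open>Scalar recursions with a concave response\<close>

locale concave_response =
  fixes h :: "real \<Rightarrow> real"
  assumes h_0: "h 0 = 0"
    and h_strict_mono: "strict_mono_on {0..} h"
    and h_concave: "strictly_concave_on {0..} h"
    and h_continuous: "continuous_on {0..} h"
    and h_deriv: "(h has_real_derivative 1) (at 0 within {0..})"
begin

lemma h_less: "0 \<le> x \<Longrightarrow> x < y \<Longrightarrow> h x < h y"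
  using h_strict_mono by (auto simp: strict_mono_on_def)

lemma h_mono: "0 \<le> x \<Longrightarrow> x \<le> y \<Longrightarrow> h x \<le> h y"
  using h_less[of x y] by (cases "x = y") auto

lemma h_pos: "0 < x \<Longrightarrow> 0 < h x"
  using h_less[of 0 x] by (simp add: h_0)

lemma h_nonneg: "0 \<le> x \<Longrightarrow> 0 \<le> h x"
  using h_mono[of 0 x] by (simp add: h_0)

text \<open>The value at \<open>0\<close> is the limit of \<open>h x / x\<close>.\<close>

definition slope :: "real \<Rightarrow> real" where
  "slope x = (if x = 0 then 1 else h x / x)"

lemma h_eq_slope: "h x = slope x * x"
  by (simp add: slope_def h_0)

lemma slope_pos: "0 \<le> x \<Longrightarrow> 0 < slope x"
  by (simp add: slope_def h_pos)

lemma slope_tendsto: "(slope \<longlongrightarrow> 1) (at 0 within {0..})"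
proof -
  have "((\<lambda>y. (h y - h 0) / (y - 0)) \<longlongrightarrow> 1) (at 0 within {0..})"
    using h_deriv by (simp add: has_field_derivative_iff)
  then show ?thesis
    by (rule Lim_transform_eventually)
      (auto simp: eventually_at_filter slope_def h_0 intro: always_eventually)
qed

lemma slope_continuous: "continuous_on {0..} slope"
  unfolding continuous_on_eq_continuous_within
proof
  fix x :: real assume x: "x \<in> {0..}"
  show "continuous (at x within {0..}) slope"
  proof (cases "x = 0")
    case True
    then show ?thesis
      using slope_tendsto by (simp add: continuous_within slope_def)
  next
    case False
    have "continuous (at x within {0..}) h"
      using h_continuous x by (auto simp: continuous_on_eq_continuous_within)
    then have "continuous (at x within {0..}) (\<lambda>x. h x / x)"
      using False by (intro continuous_intros)
    then show ?thesis
    proof (rule continuous_transform_within[where \<delta> = x])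
      show "h x' / x' = slope x'" if "x' \<in> {0..}" "dist x' x < x" for x'
        using that by (auto simp: slope_def dist_real_def)
    qed (use x False in auto)
  qed
qed

lemma slope_less_pos:
  assumes "0 < x" "x < y"
  shows "slope y < slope x"
proof -
  define t where "t = x / y"
  have t: "t \<in> {0<..<1}"
    using assms by (auto simp: t_def)
  have "\<forall>x\<in>{0..}. \<forall>y\<in>{0..}. \<forall>t\<in>{0<..<1}. x \<noteq> y \<longrightarrow>
      (1 - t) * h x + t * h y < h ((1 - t) * x + t * y)"
    using h_concave by (simp add: strictly_concave_on_def)
  from this[rule_format, of 0 y t] have "(1 - t) * h 0 + t * h y < h ((1 - t) * 0 + t * y)"
    using assms t by simp
  then show ?thesis
    using assms by (simp add: t_def h_0 slope_def field_simps)
qed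

lemma slope_less:
  assumes "0 \<le> x" "x < y"
  shows "slope y < slope x"
proof (cases "x = 0")
  case True
  have y: "y > 0" using assms by simp
  \<comment> \<open>A limit at 0 yields only a weak inequality. It is taken at \<open>y/2\<close>,
    and the step from \<open>y/2\<close> to \<open>y\<close> restores strictness.\<close>
  have "eventually (\<lambda>z. z \<in> {0<..<y/2}) (at_right 0)"
    using y by (intro eventually_at_right_real) auto
  then have "eventually (\<lambda>z. slope (y/2) \<le> slope z) (at_right 0)"
    by eventually_elim (use slope_less_pos in \<open>auto intro: less_imp_le\<close>)
  moreover have "(slope \<longlongrightarrow> 1) (at_right 0)"
    using slope_tendsto by (simp add: at_within_Ici_at_right)
  ultimately have "slope (y/2) \<le> 1"
    by (intro tendsto_lowerbound) auto
  moreover have "slope y < slope (y/2)"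
    using y by (intro slope_less_pos) auto
  ultimately show ?thesis
    using True by (simp add: slope_def[of 0])
qed (use slope_less_pos assms in auto)

lemma slope_antimono: "0 \<le> x \<Longrightarrow> x \<le> y \<Longrightarrow> slope y \<le> slope x"
  using slope_less[of x y] by (cases "x = y") auto

lemma slope_le_1: "0 \<le> x \<Longrightarrow> slope x \<le> 1"
  using slope_antimono[of 0 x] by (simp add: slope_def)

lemma h_le_self: "0 \<le> x \<Longrightarrow> h x \<le> x"
  using mult_right_mono[OF slope_le_1, of x x] by (simp add: h_eq_slope)

text \<open>A factor between two radii is never amplified by \<open>h\<close>. The forward and the
  pullback comparison both rest on this.\<close>

lemma h_scale:
  assumes "1 \<le> Q" "0 \<le> x"
  shows "h (Q * x) \<le> Q * h x"
proof -
  have "slope (Q * x) * (Q * x) \<le> slope x * (Q * x)"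
    using assms by (intro mult_right_mono slope_antimono) (auto simp: mult_le_cancel_right1)
  then show ?thesis
    by (simp add: h_eq_slope mult_ac)
qed

lemma h_linear_lower:
  assumes "\<kappa> < 1"
  obtains \<delta> where "0 < \<delta>" "\<And>x. 0 \<le> x \<Longrightarrow> x \<le> \<delta> \<Longrightarrow> \<kappa> * x \<le> h x"
proof -
  have "(slope \<longlongrightarrow> 1) (at_right 0)"
    using slope_tendsto by (simp add: at_within_Ici_at_right)
  then have "eventually (\<lambda>x. \<kappa> < slope x) (at_right 0)"
    using assms by (rule order_tendstoD)
  then obtain b where b: "b > 0" "\<And>x. 0 < x \<Longrightarrow> x < b \<Longrightarrow> \<kappa> < slope x"
    by (auto simp: eventually_at_right_field)
  have "\<kappa> * x \<le> h x" if "0 \<le> x" "x \<le> b / 2" for x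
    using b(2)[of x] b(1) that by (cases "x = 0") (auto simp: h_eq_slope intro!: mult_right_mono)
  then show ?thesis
    using b(1) by (intro that[of "b/2"]) auto
qed

section \<open>Forward scalar orbits: comparison, averages and merging\<close>

definition response_orbit :: "real \<Rightarrow> (nat \<Rightarrow> real) \<Rightarrow> (nat \<Rightarrow> real) \<Rightarrow> bool" where
  "response_orbit \<beta> d x \<longleftrightarrow>
     (\<forall>n. 0 < d n) \<and> 0 < x 0 \<and> (\<forall>n. x (Suc n) = h (\<beta> * x n) * (d (Suc n) / d n))"

lemma response_orbitD:
  assumes "response_orbit \<beta> d x"
  shows "0 < d n" "x (Suc n) = h (\<beta> * x n) * (d (Suc n) / d n)"
  using assms by (auto simp: response_orbit_def)

lemma response_orbit_pos:
  assumes "response_orbit \<beta> d x" "0 < \<beta>"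
  shows "0 < x n"
proof (induction n)
  case 0
  then show ?case using assms by (simp add: response_orbit_def)
next
  case (Suc n)
  then show ?case
    using assms(2) response_orbitD[OF assms(1)] by (simp add: h_pos)
qed

lemma response_orbit_shift:
  assumes "response_orbit \<beta> d x" "0 < \<beta>"
  shows "response_orbit \<beta> (\<lambda>k. d (N + k)) (\<lambda>k. x (N + k))"
  using response_orbitD[OF assms(1)] response_orbit_pos[OF assms, of N]
  by (simp add: response_orbit_def)

text \<open>The factor \<open>Q * (d n / (c * d' n))\<close> is always at least 1, so
  \<open>h_scale\<close> pulls it out of \<open>h\<close>; the two stretching quotients then update
  it exactly to its value at the next index.\<close>

lemma response_comparison:
  assumes x: "response_orbit \<beta> d x" and y: "response_orbit \<beta> d' y" and \<beta>: "0 < \<beta>"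
    and c: "0 < c" and low: "\<And>n. c * d' n \<le> d n"
    and Q: "1 \<le> Q" and init: "x 0 \<le> Q * (d 0 / (c * d' 0)) * y 0"
  shows "x n \<le> Q * (d n / (c * d' n)) * y n"
proof (induction n)
  case 0
  then show ?case by (rule init)
next
  case (Suc n)
  note d = response_orbitD(1)[OF x] and d' = response_orbitD(1)[OF y]
  define R where "R = Q * (d n / (c * d' n))"
  have "1 * 1 \<le> Q * (d n / (c * d' n))"
    using low[of n] c d'[of n] Q by (intro mult_mono) auto
  then have R: "1 \<le> R"
    by (simp add: R_def)
  have "\<beta> * x n \<le> \<beta> * (R * y n)"
    using Suc \<beta> unfolding R_def by (intro mult_left_mono) auto
  then have "h (\<beta> * x n) \<le> h (R * (\<beta> * y n))"
    using \<beta> response_orbit_pos[OF x \<beta>, of n] by (intro h_mono) (auto simp: mult_ac)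
  also have "\<dots> \<le> R * h (\<beta> * y n)"
    using R \<beta> response_orbit_pos[OF y \<beta>, of n] by (intro h_scale) auto
  finally have "h (\<beta> * x n) * (d (Suc n) / d n) \<le> R * h (\<beta> * y n) * (d (Suc n) / d n)"
    using d[of n] d[of "Suc n"] by (intro mult_right_mono) auto
  also have "\<dots> = Q * (d (Suc n) / (c * d' (Suc n))) * (h (\<beta> * y n) * (d' (Suc n) / d' n))"
    using d[of n] d[of "Suc n"] d'[of n] d'[of "Suc n"] c by (simp add: R_def field_simps)
  finally show ?case
    using response_orbitD(2)[OF x] response_orbitD(2)[OF y] by simp
qed

text \<open>Each visit to the level \<epsilon> or above multiplies the linear bound by
  \<open>g < 1\<close>. As that bound grows subexponentially, too many visits would force the orbit
  below \<epsilon> at a visit; so visits are rare, and each contributes at most \<open>X\<close> to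
  the sum.\<close>

lemma response_cesaro:
  assumes x: "response_orbit \<beta> d x" and \<beta>: "0 < \<beta>" and X: "\<And>n. x n \<le> X"
    and subexp: "\<And>\<delta>. 0 < \<delta> \<Longrightarrow> \<exists>C>0. \<forall>n. \<beta> ^ n * d n \<le> C * exp (\<delta> * real n)"
  shows "(\<lambda>n. 1 / real n * (\<Sum>i<n. x i)) \<longlonglongrightarrow> 0"
proof (rule LIMSEQ_I)
  fix e :: real assume e: "e > 0"
  note d = response_orbitD(1)[OF x] and pos = response_orbit_pos[OF x \<beta>]
  have X0: "0 < X"
    using X[of 0] pos[of 0] by simp
  define \<epsilon> where "\<epsilon> = e / 3"
  have \<epsilon>: "\<epsilon> > 0" using e by (simp add: \<epsilon>_def)
  define g where "g = slope (\<beta> * \<epsilon>)"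
  have g: "0 < g" "g < 1"
    using slope_pos[of "\<beta> * \<epsilon>"] slope_less[of 0 "\<beta> * \<epsilon>"] \<beta> \<epsilon> by (auto simp: g_def slope_def)
  define c where "c = - ln g"
  have c: "c > 0" using g by (simp add: c_def)
  define N where "N n = card {j. j < n \<and> \<epsilon> \<le> x j}" for n
  have N_Suc: "N (Suc n) = N n + (if \<epsilon> \<le> x n then 1 else 0)" for n
  proof -
    have "{j. j < Suc n \<and> \<epsilon> \<le> x j} = {j. j < n \<and> \<epsilon> \<le> x j} \<union> (if \<epsilon> \<le> x n then {n} else {})"
      by (auto simp: less_Suc_eq)
    then show ?thesis by (auto simp: N_def)
  qed
  have growth: "x n * d 0 \<le> x 0 * (\<beta> ^ n * d n) * g ^ N n" for n
  proof (induction n)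
    case 0
    then show ?case by (simp add: N_def)
  next
    case (Suc n)
    have "slope (\<beta> * x n) \<le> g ^ (if \<epsilon> \<le> x n then 1 else 0)"
      using \<beta> \<epsilon> pos[of n] by (auto simp: g_def intro!: slope_antimono slope_le_1)
    then have "slope (\<beta> * x n) * (x n * d 0) \<le>
        g ^ (if \<epsilon> \<le> x n then 1 else 0) * (x 0 * (\<beta> ^ n * d n) * g ^ N n)"
      by (rule mult_mono[OF _ Suc]) (use pos[of n] d[of 0] g in auto)
    then have "slope (\<beta> * x n) * (x n * d 0) * (\<beta> * (d (Suc n) / d n)) \<le>
        g ^ (if \<epsilon> \<le> x n then 1 else 0) * (x 0 * (\<beta> ^ n * d n) * g ^ N n) * (\<beta> * (d (Suc n) / d n))"
      by (rule mult_right_mono) (use \<beta> d[of n] d[of "Suc n"] in auto)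
    moreover have "x (Suc n) * d 0 = slope (\<beta> * x n) * (x n * d 0) * (\<beta> * (d (Suc n) / d n))"
      by (simp add: response_orbitD(2)[OF x] h_eq_slope)
    ultimately have "x (Suc n) * d 0 \<le>
        g ^ (if \<epsilon> \<le> x n then 1 else 0) * (x 0 * (\<beta> ^ n * d n) * g ^ N n) * (\<beta> * (d (Suc n) / d n))"
      by simp
    also have "\<dots> = x 0 * (\<beta> ^ Suc n * d (Suc n)) * g ^ N (Suc n)"
      using d[of n] by (simp add: N_Suc power_add field_simps)
    finally show ?case .
  qed
  \<comment> \<open>The allowed frequency of visits is \<open>\<delta> / c\<close>, which times
    \<open>X\<close> is a third of \<open>e\<close>. Another third is the level \<epsilon>, and the
    last one absorbs the constant \<open>K\<close>.\<close>
  define \<delta> where "\<delta> = c * (e / (3 * X))"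
  have \<delta>: "\<delta> > 0" using c e X0 by (simp add: \<delta>_def)
  obtain C where C: "C > 0" "\<And>n. \<beta> ^ n * d n \<le> C * exp (\<delta> * real n)"
    using subexp[OF \<delta>] by auto
  \<comment> \<open>The growth bound is informative only at a visit, where \<open>x n\<close> is at
    least \<epsilon>. The summand 1 pays for counting that visit; between visits the count does not
    change.\<close>
  define K where "K = \<bar>ln (x 0 * C / (\<epsilon> * d 0))\<bar> / c + 1"
  have visits: "real (N n) \<le> K + e / (3 * X) * real n" for n
  proof (induction n)
    case 0
    have "K \<ge> 0" using c by (auto simp: K_def intro!: add_nonneg_nonneg divide_nonneg_pos)
    then show ?case by (simp add: N_def)
  next
    case (Suc n)
    show ?case
    proof (cases "\<epsilon> \<le> x n")
      case True
      have "\<epsilon> * d 0 \<le> x n * d 0"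
        using True d[of 0] by (intro mult_right_mono) auto
      also have "\<dots> \<le> x 0 * (\<beta> ^ n * d n) * g ^ N n"
        by (rule growth)
      also have "\<dots> \<le> x 0 * (C * exp (\<delta> * real n)) * g ^ N n"
        using C(2)[of n] pos[of 0] g by (intro mult_right_mono mult_left_mono) auto
      finally have "ln (\<epsilon> * d 0) \<le> ln (x 0 * (C * exp (\<delta> * real n)) * g ^ N n)"
        using \<epsilon> d[of 0] pos[of 0] C(1) g by (subst ln_le_cancel_iff) auto
      also have "\<dots> = ln (x 0 * C) + \<delta> * real n - c * real (N n)"
        using pos[of 0] C(1) g by (simp add: ln_mult ln_realpow c_def)
      finally have "c * real (N n) \<le> ln (x 0 * C) - ln (\<epsilon> * d 0) + \<delta> * real n"
        by simp
      also have "ln (x 0 * C) - ln (\<epsilon> * d 0) = ln (x 0 * C / (\<epsilon> * d 0))"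
        using pos[of 0] C(1) \<epsilon> d[of 0] by (subst ln_div) auto
      also have "\<dots> + \<delta> * real n \<le> \<bar>ln (x 0 * C / (\<epsilon> * d 0))\<bar> + \<delta> * real n"
        by simp
      also have "\<dots> = c * (K - 1 + e / (3 * X) * real n)"
        using c by (simp add: K_def \<delta>_def field_simps)
      finally have "real (N n) \<le> K - 1 + e / (3 * X) * real n"
        using c by (simp only: mult_le_cancel_left_pos)
      moreover have "e / (3 * X) * real n \<le> e / (3 * X) * real (Suc n)"
        using e X0 by (intro mult_left_mono) auto
      ultimately show ?thesis
        using True by (simp add: N_Suc)
    next
      case False
      have "e / (3 * X) * real n \<le> e / (3 * X) * real (Suc n)"
        using e X0 by (intro mult_left_mono) auto
      then show ?thesis
        using False Suc by (simp add: N_Suc)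
    qed
  qed
  have sum: "(\<Sum>i<n. x i) \<le> \<epsilon> * real n + X * real (N n)" for n
  proof (induction n)
    case (Suc n)
    have "x n \<le> \<epsilon> + X * (if \<epsilon> \<le> x n then 1 else 0)"
      using X[of n] \<epsilon> by auto
    then show ?case
      using Suc by (auto simp: N_Suc algebra_simps)
  qed (simp add: N_def)
  obtain n0 :: nat where n0: "3 * X * K / e < real n0"
    using reals_Archimedean2 by blast
  show "\<exists>no. \<forall>n\<ge>no. norm (1 / real n * (\<Sum>i<n. x i) - 0) < e"
  proof (intro exI[of _ "Suc n0"] allI impI)
    fix n assume n: "n \<ge> Suc n0"
    have "(\<Sum>i<n. x i) \<le> \<epsilon> * real n + X * (K + e / (3 * X) * real n)"
      using sum[of n] visits[of n] X0 by (intro order_trans[OF sum] add_left_mono mult_left_mono) auto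
    also have "\<dots> = 2 * e / 3 * real n + X * K"
      using X0 by (simp add: \<epsilon>_def field_simps)
    also have "\<dots> < 2 * e / 3 * real n + e / 3 * real n"
    proof -
      have "3 * X * K < e * real n0"
        using n0 e by (simp add: field_simps)
      also have "\<dots> \<le> e * real n"
        using n e by (intro mult_left_mono) auto
      finally show ?thesis by simp
    qed
    finally have "(\<Sum>i<n. x i) < e * real n"
      by simp
    moreover have "0 \<le> (\<Sum>i<n. x i)"
      by (intro sum_nonneg less_imp_le pos)
    ultimately show "norm (1 / real n * (\<Sum>i<n. x i) - 0) < e"
      using n by (simp add: field_simps)
  qed
qed

text \<open>Monotonicity of the slope reduces every \<open>y\<close> to
  \<open>x + \<epsilon>\<close>, and the resulting quotient is continuous and below 1 on the compact
  interval, so its maximum serves as \<tau>.\<close>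

lemma slope_gap:
  assumes \<beta>: "0 < \<beta>" and \<epsilon>: "0 < \<epsilon>"
  obtains \<tau> where "\<tau> < 1"
    "\<And>x y. 0 \<le> x \<Longrightarrow> x \<le> 1 \<Longrightarrow> x + \<epsilon> \<le> y \<Longrightarrow> slope (\<beta> * y) \<le> \<tau> * slope (\<beta> * x)"
proof -
  define f where "f x = slope (\<beta> * (x + \<epsilon>)) / slope (\<beta> * x)" for x
  have slope_ne: "slope (\<beta> * x) \<noteq> 0" if "x \<in> {0..1}" for x
    using slope_pos[of "\<beta> * x"] \<beta> that by auto
  have "continuous_on {0..1} f"
    unfolding f_def using \<beta> \<epsilon> slope_ne
    by (intro continuous_intros continuous_on_compose2[OF slope_continuous]) auto
  then obtain z where z: "z \<in> {0..1}" "\<And>x. x \<in> {0..1} \<Longrightarrow> f x \<le> f z"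
    using continuous_attains_sup[of "{0..1::real}" f] by auto
  show ?thesis
  proof (rule that[of "f z"])
    show "f z < 1"
      unfolding f_def using z(1) \<beta> \<epsilon> slope_pos[of "\<beta> * z"]
      by (subst divide_less_eq_1_pos) (auto intro!: slope_less)
    fix x y :: real assume xy: "0 \<le> x" "x \<le> 1" "x + \<epsilon> \<le> y"
    have "slope (\<beta> * y) \<le> slope (\<beta> * (x + \<epsilon>))"
      using xy \<beta> \<epsilon> by (intro slope_antimono mult_left_mono) auto
    also have "\<dots> = f x * slope (\<beta> * x)"
      using slope_ne[of x] xy by (simp add: f_def)
    also have "\<dots> \<le> f z * slope (\<beta> * x)"
      using z(2)[of x] xy \<beta> slope_pos[of "\<beta> * x"] by (intro mult_right_mono) auto
    finally show "slope (\<beta> * y) \<le> f z * slope (\<beta> * x)" .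
  qed
qed

text \<open>With common \<open>d\<close> the stretching cancels in the quotient
  \<open>y n / x n\<close>, which decreases to a limit. A gap of size \<epsilon> would shrink it by
  a fixed factor, and this is impossible once it is close to its limit.\<close>

lemma response_orbits_merge_ordered:
  assumes x: "response_orbit \<beta> d x" and y: "response_orbit \<beta> d y" and \<beta>: "0 < \<beta>"
    and le1: "\<And>n. x n \<le> 1" and init: "x 0 \<le> y 0"
  shows "(\<lambda>n. y n - x n) \<longlonglongrightarrow> 0"
proof (rule LIMSEQ_I)
  fix \<epsilon> :: real assume \<epsilon>: "\<epsilon> > 0"
  note d = response_orbitD(1)[OF x]
  note xpos = response_orbit_pos[OF x \<beta>] and ypos = response_orbit_pos[OF y \<beta>]
  have ord: "x n \<le> y n" for n
  proof (induction n)
    case (Suc n)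
    then show ?case
      using \<beta> xpos[of n] d[of n] d[of "Suc n"]
      by (auto simp: response_orbitD(2)[OF x] response_orbitD(2)[OF y] intro!: mult_right_mono divide_right_mono h_mono)
  qed (rule init)
  define t where "t n = y n / x n" for n
  have t_ge: "1 \<le> t n" for n
    using ord[of n] xpos[of n] by (simp add: t_def)
  have t_Suc: "t (Suc n) = t n * (slope (\<beta> * y n) / slope (\<beta> * x n))" for n
    using d[of n] d[of "Suc n"] xpos[of n] \<beta>
    by (simp add: t_def response_orbitD(2)[OF x] response_orbitD(2)[OF y] h_eq_slope mult_ac)
  have ratio_le: "slope (\<beta> * y n) / slope (\<beta> * x n) \<le> 1" for n
    using slope_pos[of "\<beta> * x n"] slope_antimono[of "\<beta> * x n" "\<beta> * y n"] \<beta> ord[of n] xpos[of n]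
    by simp
  have "t (Suc n) \<le> t n" for n
    unfolding t_Suc using ratio_le[of n] t_ge[of n] by (intro mult_left_le) auto
  then have dec: "decseq t"
    by (rule decseq_SucI)
  obtain l where l: "t \<longlonglongrightarrow> l" "\<And>n. l \<le> t n"
    using decseq_convergent[OF dec, of 1] t_ge by auto
  have l1: "1 \<le> l"
    by (rule LIMSEQ_le_const[OF l(1)]) (use t_ge in auto)
  obtain \<tau>' where \<tau>': "\<tau>' < 1"
    "\<And>x y. 0 \<le> x \<Longrightarrow> x \<le> 1 \<Longrightarrow> x + \<epsilon> \<le> y \<Longrightarrow> slope (\<beta> * y) \<le> \<tau>' * slope (\<beta> * x)"
    using slope_gap[OF \<beta> \<epsilon>] by blast
  \<comment> \<open>The maximum with 1/2 keeps \<tau> positive, so that \<open>l / \<tau>\<close> is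
    a level strictly above the limit \<open>l\<close>.\<close>
  define \<tau> where "\<tau> = max \<tau>' (1/2)"
  have \<tau>: "0 < \<tau>" "\<tau> < 1" "\<tau>' \<le> \<tau>"
    using \<tau>'(1) by (auto simp: \<tau>_def)
  have "l < l / \<tau>"
    using l1 \<tau> by (simp add: less_divide_eq)
  then have "eventually (\<lambda>n. t n < l / \<tau>) sequentially"
    by (rule order_tendstoD(2)[OF l(1)])
  then obtain n0 where n0: "\<And>n. n \<ge> n0 \<Longrightarrow> t n < l / \<tau>"
    by (auto simp: eventually_sequentially)
  show "\<exists>no. \<forall>n\<ge>no. norm (y n - x n - 0) < \<epsilon>"
  proof (intro exI[of _ n0] allI impI)
    fix n assume n: "n \<ge> n0"
    have "y n < x n + \<epsilon>"
    proof (rule ccontr)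
      assume "\<not> ?thesis"
      then have "slope (\<beta> * y n) \<le> \<tau>' * slope (\<beta> * x n)"
        using \<tau>'(2)[of "x n" "y n"] xpos[of n] le1[of n] by simp
      also have "\<dots> \<le> \<tau> * slope (\<beta> * x n)"
        using \<tau>(3) slope_pos[of "\<beta> * x n"] \<beta> xpos[of n] by (intro mult_right_mono) auto
      finally have "slope (\<beta> * y n) / slope (\<beta> * x n) \<le> \<tau>"
        using slope_pos[of "\<beta> * x n"] \<beta> xpos[of n] by (simp add: divide_le_eq)
      then have "t (Suc n) \<le> t n * \<tau>"
        unfolding t_Suc using t_ge[of n] by (intro mult_left_mono) auto
      also have "\<dots> < l"
        using n0[OF n] \<tau> by (simp add: field_simps)
      finally show False
        using l(2)[of "Suc n"] by simp
    qed
    then show "norm (y n - x n - 0) < \<epsilon>"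
      using ord[of n] by simp
  qed
qed

lemma response_orbits_merge:
  assumes x: "response_orbit \<beta> d x" and y: "response_orbit \<beta> d y" and \<beta>: "0 < \<beta>"
    and "\<And>n. x n \<le> 1" "\<And>n. y n \<le> 1"
  shows "(\<lambda>n. y n - x n) \<longlonglongrightarrow> 0"
proof (cases "x 0 \<le> y 0")
  case True
  then show ?thesis
    using response_orbits_merge_ordered assms by blast
next
  case False
  then have "(\<lambda>n. x n - y n) \<longlonglongrightarrow> 0"
    using response_orbits_merge_ordered assms by simp
  then have "(\<lambda>n. - (x n - y n)) \<longlonglongrightarrow> - 0"
    by (rule tendsto_minus)
  then show ?thesis by simp
qed

text \<open>The orbit \<open>z\<close> below starts at \<open>x N\<close> but is driven by \<open>d'\<close>, so that it stays
  within a factor close to \<open>1\<close> of \<open>x\<close> and merges with \<open>y\<close>.\<close>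

lemma response_orbits_asymptotic:
  assumes x: "response_orbit \<beta> d x" and y: "response_orbit \<beta> d' y" and \<beta>: "0 < \<beta>"
    and x1: "\<And>n. n \<ge> 1 \<Longrightarrow> x n \<le> 1" and y1: "\<And>n. y n \<le> 1"
    and bound: "\<And>u n. 0 \<le> u \<Longrightarrow> h u * (d' (Suc n) / d' n) \<le> 1"
    and ratio: "(\<lambda>n. d n / d' n) \<longlonglongrightarrow> q" and q: "0 < q"
  shows "(\<lambda>n. x n - y n) \<longlonglongrightarrow> 0"
proof (rule LIMSEQ_I)
  fix \<epsilon> :: real assume \<epsilon>: "\<epsilon> > 0"
  note d = response_orbitD(1)[OF x] and d' = response_orbitD(1)[OF y]
  \<comment> \<open>Since \<eta> is at most 1/2, \<open>(1 + \<eta>) / (1 - \<eta>)\<close> is at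
    most \<open>1 + 4 * \<eta>\<close>; the bound by \<open>\<epsilon> / 8\<close> turns the error
    \<open>4 * \<eta>\<close> into half of \<epsilon>.\<close>
  define \<eta> where "\<eta> = min (1/2) (\<epsilon> / 8)"
  have \<eta>: "0 < \<eta>" "\<eta> \<le> 1/2" "\<eta> \<le> \<epsilon> / 8"
    using \<epsilon> by (auto simp: \<eta>_def)
  have "eventually (\<lambda>n. \<bar>d n / d' n - q\<bar> < \<eta> * q) sequentially"
    using tendstoD[OF ratio, of "\<eta> * q"] \<eta> q by (simp add: dist_real_def)
  then obtain N0 where N0: "\<And>n. n \<ge> N0 \<Longrightarrow> \<bar>d n / d' n - q\<bar> < \<eta> * q"
    by (auto simp: eventually_sequentially)
  \<comment> \<open>At least 1, because the initial value \<open>x 0\<close> may exceed 1.\<close>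
  define N where "N = max N0 1"
  define c1 where "c1 = q * (1 - \<eta>)"
  define c2 where "c2 = q * (1 + \<eta>)"
  have c1: "c1 > 0" using q \<eta> by (simp add: c1_def)
  have c2: "c2 > 0" using q \<eta> by (simp add: c2_def)
  have "c1 \<le> d (N + n) / d' (N + n) \<and> d (N + n) / d' (N + n) \<le> c2" for n
  proof -
    have "N0 \<le> N + n"
      by (simp add: N_def)
    from N0[OF this] show ?thesis
      by (auto simp: c1_def c2_def abs_less_iff algebra_simps)
  qed
  then have low: "c1 * d' (N + n) \<le> d (N + n)" and high: "d (N + n) \<le> c2 * d' (N + n)" for n
    using d'[of "N + n"] by (metis pos_le_divide_eq, metis pos_divide_le_eq)
  define z where "z = rec_nat (x N) (\<lambda>n z. h (\<beta> * z) * (d' (N + Suc n) / d' (N + n)))"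
  have z_Suc: "z (Suc n) = h (\<beta> * z n) * (d' (N + Suc n) / d' (N + n))" for n
    by (simp add: z_def)
  have z0: "z 0 = x N"
    by (simp add: z_def)
  have z: "response_orbit \<beta> (\<lambda>k. d' (N + k)) z"
    unfolding response_orbit_def using d' z_Suc z0 response_orbit_pos[OF x \<beta>, of N] by simp
  have z1: "z n \<le> 1" for n
  proof (cases n)
    case 0
    then show ?thesis using x1[of N] by (simp add: z0 N_def)
  next
    case (Suc m)
    then show ?thesis
      using bound[of "\<beta> * z m" "N + m"] \<beta> response_orbit_pos[OF z \<beta>, of m] by (simp add: z_Suc)
  qed
  note xN = response_orbit_shift[OF x \<beta>, of N] and yN = response_orbit_shift[OF y \<beta>, of N]
  have xNpos: "x (N + n) > 0" for n
    by (rule response_orbit_pos[OF x \<beta>])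
  have zpos: "z n > 0" for n
    by (rule response_orbit_pos[OF z \<beta>])
  have ratio_c: "c2 / c1 \<le> 1 + 4 * \<eta>"
  proof -
    have "(1 + \<eta>) \<le> (1 + 4 * \<eta>) * (1 - \<eta>)"
      using \<eta> by (simp add: algebra_simps)
    then have "(1 + \<eta>) / (1 - \<eta>) \<le> 1 + 4 * \<eta>"
      using \<eta> by (simp add: divide_le_eq)
    then show ?thesis using q by (simp add: c1_def c2_def)
  qed
  have xz: "x (N + n) \<le> (1 + 4 * \<eta>) * z n" for n
  proof -
    have "x (N + n) \<le> 1 * (d (N + n) / (c1 * d' (N + n))) * z n"
    proof (rule response_comparison[OF xN z \<beta> c1 low])
      show "x (N + 0) \<le> 1 * (d (N + 0) / (c1 * d' (N + 0))) * z 0"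
        using low[of 0] c1 d'[of N] xNpos[of 0] by (simp add: z0 field_simps)
    qed simp
    also have "\<dots> \<le> (c2 / c1) * z n"
      using high[of n] c1 d'[of "N + n"] zpos[of n] by (intro mult_right_mono) (auto simp: field_simps)
    also have "\<dots> \<le> (1 + 4 * \<eta>) * z n"
      using zpos[of n] by (intro mult_right_mono ratio_c) auto
    finally show ?thesis .
  qed
  have zx: "z n \<le> (1 + 4 * \<eta>) * x (N + n)" for n
  proof -
    have "z n \<le> 1 * (d' (N + n) / (1 / c2 * d (N + n))) * x (N + n)"
    proof (rule response_comparison[OF z xN \<beta>])
      show "1 / c2 * d (N + n) \<le> d' (N + n)" for n
        using high[of n] c2 by (simp add: field_simps)
      show "z 0 \<le> 1 * (d' (N + 0) / (1 / c2 * d (N + 0))) * x (N + 0)"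
        using high[of 0] c2 d[of N] xNpos[of 0] by (simp add: z0 field_simps)
    qed (use c2 in auto)
    also have "\<dots> \<le> (c2 / c1) * x (N + n)"
      using low[of n] c1 c2 d[of "N + n"] xNpos[of n] by (intro mult_right_mono) (auto simp: field_simps)
    also have "\<dots> \<le> (1 + 4 * \<eta>) * x (N + n)"
      using xNpos[of n] by (intro mult_right_mono ratio_c) auto
    finally show ?thesis .
  qed
  have close: "\<bar>x (N + n) - z n\<bar> \<le> \<epsilon> / 2" for n
  proof -
    have "4 * \<eta> * z n \<le> 4 * \<eta> * 1" "4 * \<eta> * x (N + n) \<le> 4 * \<eta> * 1"
      using z1[of n] x1[of "N + n"] \<eta> by (auto simp: N_def intro!: mult_left_mono)
    moreover have "x (N + n) \<le> z n + 4 * \<eta> * z n" "z n \<le> x (N + n) + 4 * \<eta> * x (N + n)"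
      using xz[of n] zx[of n] by (simp_all add: algebra_simps)
    ultimately show ?thesis
      using \<eta>(3) by linarith
  qed
  have "(\<lambda>n. y (N + n) - z n) \<longlonglongrightarrow> 0"
    by (rule response_orbits_merge[OF z yN \<beta>]) (use z1 y1 in auto)
  then obtain n1 where n1: "\<And>n. n \<ge> n1 \<Longrightarrow> \<bar>y (N + n) - z n\<bar> < \<epsilon> / 2"
    using LIMSEQ_D[of _ 0 "\<epsilon> / 2"] \<epsilon> by fastforce
  show "\<exists>no. \<forall>n\<ge>no. norm (x n - y n - 0) < \<epsilon>"
  proof (intro exI[of _ "N + n1"] allI impI)
    fix n assume n: "n \<ge> N + n1"
    then have "N + (n - N) = n" "n - N \<ge> n1" by auto
    then have "\<bar>x n - z (n - N)\<bar> \<le> \<epsilon> / 2" "\<bar>y n - z (n - N)\<bar> < \<epsilon> / 2"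
      using close[of "n - N"] n1[of "n - N"] by auto
    then show "norm (x n - y n - 0) < \<epsilon>"
      unfolding real_norm_def by arith
  qed
qed

section \<open>Pullback radii and their limits\<close>

text \<open>The radius reached at time \<open>0\<close> by the orbit that starts at time \<open>-n\<close> with radius \<open>1\<close>;
  the norm of the underlying vector at time \<open>-k\<close> is \<open>d k\<close>.\<close>

primrec pullback_radius :: "real \<Rightarrow> nat \<Rightarrow> (nat \<Rightarrow> real) \<Rightarrow> real" where
  "pullback_radius \<beta> 0 d = 1"
| "pullback_radius \<beta> (Suc n) d = h (\<beta> * pullback_radius \<beta> n (\<lambda>k. d (Suc k))) * (d 0 / d 1)"

definition limit_radius :: "real \<Rightarrow> (nat \<Rightarrow> real) \<Rightarrow> real" where
  "limit_radius \<beta> d = (INF n. pullback_radius \<beta> n d)"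

text \<open>The second condition says that one step lands in the unit interval from whatever radius
  it starts. This is the form in which the bound on the supremum of \<open>h\<close> enters.\<close>

definition admissible :: "(nat \<Rightarrow> real) \<Rightarrow> bool" where
  "admissible d \<longleftrightarrow> (\<forall>n. 0 < d n) \<and> (\<forall>n u. 0 \<le> u \<longrightarrow> h u * (d n / d (Suc n)) \<le> 1)"

lemma admissible_pos: "admissible d \<Longrightarrow> 0 < d n"
  by (simp add: admissible_def)

lemma admissible_Suc: "admissible d \<Longrightarrow> admissible (\<lambda>k. d (Suc k))"
  unfolding admissible_def by blast

lemma admissible_shift: "admissible d \<Longrightarrow> admissible (\<lambda>k. d (n + k))"
  unfolding admissible_def add_Suc_right by blast

lemma pullback_radius_pos: "admissible d \<Longrightarrow> 0 < \<beta> \<Longrightarrow> 0 < pullback_radius \<beta> n d"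
proof (induction n arbitrary: d)
  case (Suc n)
  then have "0 < pullback_radius \<beta> n (\<lambda>k. d (Suc k))"
    using admissible_Suc by blast
  then show ?case
    using Suc.prems admissible_pos[OF Suc.prems(1)] by (simp add: h_pos)
qed simp

lemma pullback_radius_le_1:
  assumes "admissible d" "0 < \<beta>"
  shows "pullback_radius \<beta> n d \<le> 1"
proof (cases n)
  case (Suc m)
  have "0 \<le> \<beta> * pullback_radius \<beta> m (\<lambda>k. d (Suc k))"
    using pullback_radius_pos[OF admissible_Suc[OF assms(1)] assms(2), of m] assms(2) by simp
  then have "h (\<beta> * pullback_radius \<beta> m (\<lambda>k. d (Suc k))) * (d 0 / d (Suc 0)) \<le> 1"
    using assms(1) unfolding admissible_def by blast
  then show ?thesis
    by (simp add: Suc)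
qed simp

text \<open>An orbit started one step earlier with radius 1 has radius at most 1 at the old starting
  time, and every later step is increasing in the radius.\<close>

lemma pullback_radius_decreasing:
  "admissible d \<Longrightarrow> 0 < \<beta> \<Longrightarrow> pullback_radius \<beta> (Suc n) d \<le> pullback_radius \<beta> n d"
proof (induction n arbitrary: d)
  case 0
  then show ?case using pullback_radius_le_1[of d \<beta> 1] by simp
next
  case (Suc n)
  define d' where "d' = (\<lambda>k. d (Suc k))"
  have d': "admissible d'"
    using Suc.prems admissible_Suc by (auto simp: d'_def)
  have "h (\<beta> * pullback_radius \<beta> (Suc n) d') * (d 0 / d 1) \<le> h (\<beta> * pullback_radius \<beta> n d') * (d 0 / d 1)"
    using Suc.IH[OF d'] Suc.prems pullback_radius_pos[OF d' Suc.prems(2), of "Suc n"]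
      admissible_pos[OF Suc.prems(1), of 0] admissible_pos[OF Suc.prems(1), of 1]
    by (intro mult_right_mono h_mono) (auto simp del: pullback_radius.simps)
  then show ?case by (simp only: pullback_radius.simps d'_def)
qed

context
  fixes \<beta> :: real and d :: "nat \<Rightarrow> real"
  assumes adm: "admissible d" and \<beta>: "0 < \<beta>"
begin

lemma pullback_radius_bdd_below: "bdd_below (range (\<lambda>n. pullback_radius \<beta> n d))"
  using pullback_radius_pos[OF adm \<beta>] by (intro bdd_belowI2[of _ 0]) (auto intro: less_imp_le)

lemma limit_radius_le: "limit_radius \<beta> d \<le> pullback_radius \<beta> n d"
  unfolding limit_radius_def by (rule cINF_lower[OF pullback_radius_bdd_below]) simp

lemma limit_radius_ge:
  assumes "\<And>n. c \<le> pullback_radius \<beta> n d"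
  shows "c \<le> limit_radius \<beta> d"
  unfolding limit_radius_def by (rule cINF_greatest) (use assms in auto)

lemma limit_radius_nonneg: "0 \<le> limit_radius \<beta> d"
  by (rule limit_radius_ge) (use pullback_radius_pos[OF adm \<beta>] in \<open>auto intro: less_imp_le\<close>)

lemma limit_radius_le_1: "limit_radius \<beta> d \<le> 1"
  using limit_radius_le[of 0] by simp

lemma pullback_radius_tendsto: "(\<lambda>n. pullback_radius \<beta> n d) \<longlonglongrightarrow> limit_radius \<beta> d"
  unfolding limit_radius_def
  by (rule LIMSEQ_decseq_INF[OF pullback_radius_bdd_below])
    (rule decseq_SucI, rule pullback_radius_decreasing[OF adm \<beta>])

end

lemma limit_radius_Suc:
  assumes adm: "admissible d" and \<beta>: "0 < \<beta>"
  shows "limit_radius \<beta> d = h (\<beta> * limit_radius \<beta> (\<lambda>k. d (Suc k))) * (d 0 / d 1)"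
proof -
  define d' where "d' = (\<lambda>k. d (Suc k))"
  have d': "admissible d'"
    using adm admissible_Suc by (auto simp: d'_def)
  have "(\<lambda>n. \<beta> * pullback_radius \<beta> n d') \<longlonglongrightarrow> \<beta> * limit_radius \<beta> d'"
    by (intro tendsto_intros pullback_radius_tendsto d' \<beta>)
  then have "(\<lambda>n. h (\<beta> * pullback_radius \<beta> n d')) \<longlonglongrightarrow> h (\<beta> * limit_radius \<beta> d')"
    by (rule continuous_on_tendsto_compose[OF h_continuous])
      (use \<beta> pullback_radius_pos[OF d' \<beta>] limit_radius_nonneg[OF d' \<beta>] in
        \<open>auto intro!: always_eventually less_imp_le\<close>)
  then have "(\<lambda>n. pullback_radius \<beta> (Suc n) d) \<longlonglongrightarrow> h (\<beta> * limit_radius \<beta> d') * (d 0 / d 1)"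
    unfolding pullback_radius.simps d'_def by (intro tendsto_intros)
  moreover have "(\<lambda>n. pullback_radius \<beta> (Suc n) d) \<longlonglongrightarrow> limit_radius \<beta> d"
    using pullback_radius_tendsto[OF adm \<beta>] by (rule LIMSEQ_Suc)
  ultimately show ?thesis
    unfolding d'_def by (rule LIMSEQ_unique[symmetric])
qed

lemma pullback_radius_mono:
  "admissible d \<Longrightarrow> 0 < \<beta> \<Longrightarrow> \<beta> \<le> \<beta>' \<Longrightarrow> pullback_radius \<beta> n d \<le> pullback_radius \<beta>' n d"
proof (induction n arbitrary: d)
  case (Suc n)
  have d': "admissible (\<lambda>k. d (Suc k))"
    using Suc.prems admissible_Suc by auto
  show ?case
    unfolding pullback_radius.simps
    using Suc.IH[OF d'] Suc.prems pullback_radius_pos[OF d' Suc.prems(2), of n]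
      admissible_pos[OF Suc.prems(1), of 0] admissible_pos[OF Suc.prems(1), of 1]
    by (intro mult_right_mono h_mono mult_mono) auto
qed simp

lemma limit_radius_mono:
  assumes "admissible d" "0 < \<beta>" "\<beta> \<le> \<beta>'"
  shows "limit_radius \<beta> d \<le> limit_radius \<beta>' d"
proof (rule limit_radius_ge)
  show "limit_radius \<beta> d \<le> pullback_radius \<beta>' n d" for n
    using limit_radius_le[OF assms(1,2), of n] pullback_radius_mono[OF assms, of n] by simp
qed (use assms in auto)

text \<open>Only quotients of \<open>d\<close> occur, so the radius will depend on the line spanned
  by a vector and not on the vector.\<close>

lemma pullback_radius_scale: "c \<noteq> 0 \<Longrightarrow> pullback_radius \<beta> n (\<lambda>k. c * d k) = pullback_radius \<beta> n d"
  by (induction n arbitrary: d) simp_all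

lemma limit_radius_scale: "c \<noteq> 0 \<Longrightarrow> limit_radius \<beta> (\<lambda>k. c * d k) = limit_radius \<beta> d"
  by (simp add: limit_radius_def pullback_radius_scale)

text \<open>The backward counterpart of \<open>response_comparison\<close>. The induction runs over
  tails: the factor belonging to the tail is at least 1, leaves \<open>h\<close> by
  \<open>h_scale\<close>, and is converted by the stretching quotients into the factor at index
  0.\<close>

lemma pullback_radius_comparison:
  "admissible d \<Longrightarrow> admissible d' \<Longrightarrow> 0 < \<beta> \<Longrightarrow> 0 < c \<Longrightarrow> (\<And>n. c * d' n \<le> d n) \<Longrightarrow>
    pullback_radius \<beta> n d \<le> d 0 / (c * d' 0) * pullback_radius \<beta> n d'"
proof (induction n arbitrary: d d')
  case 0
  then show ?case
    using admissible_pos[of d' 0] by simp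
next
  case (Suc n)
  define s where "s = (\<lambda>k. d (Suc k))"
  define s' where "s' = (\<lambda>k. d' (Suc k))"
  have s: "admissible s" and s': "admissible s'"
    using Suc.prems admissible_Suc by (auto simp: s_def s'_def)
  define Q where "Q = s 0 / (c * s' 0)"
  have IH: "pullback_radius \<beta> n s \<le> Q * pullback_radius \<beta> n s'"
    unfolding Q_def by (rule Suc.IH[OF s s' Suc.prems(3,4)]) (simp add: s_def s'_def Suc.prems(5))
  note pos = admissible_pos[OF Suc.prems(1)] admissible_pos[OF Suc.prems(2)]
  have Q: "1 \<le> Q"
    using Suc.prems(4) Suc.prems(5)[of 1] pos(2)[of 1] by (simp add: Q_def s_def s'_def)
  have "h (\<beta> * pullback_radius \<beta> n s) \<le> h (Q * (\<beta> * pullback_radius \<beta> n s'))"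
    using IH Suc.prems(3) pullback_radius_pos[OF s Suc.prems(3), of n]
    by (intro h_mono) (auto simp: mult_ac)
  also have "\<dots> \<le> Q * h (\<beta> * pullback_radius \<beta> n s')"
    using Q Suc.prems(3) pullback_radius_pos[OF s' Suc.prems(3), of n] by (intro h_scale) auto
  finally have "h (\<beta> * pullback_radius \<beta> n s) * (d 0 / d 1) \<le>
      Q * h (\<beta> * pullback_radius \<beta> n s') * (d 0 / d 1)"
    using pos(1)[of 0] pos(1)[of 1] by (intro mult_right_mono) auto
  also have "\<dots> = d 0 / (c * d' 0) * (h (\<beta> * pullback_radius \<beta> n s') * (d' 0 / d' 1))"
    using pos(1)[of 0] pos(1)[of 1] pos(2)[of 0] pos(2)[of 1] Suc.prems(4)
    by (simp add: Q_def s_def s'_def field_simps)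
  finally show ?case
    by (simp only: pullback_radius.simps s_def s'_def)
qed

lemma limit_radius_zero_comparison:
  assumes d: "admissible d" and d': "admissible d'" and \<beta>: "0 < \<beta>" and c: "0 < c"
    and le: "\<And>n. c * d' n \<le> d n" and zero: "limit_radius \<beta> d' = 0"
  shows "limit_radius \<beta> d = 0"
proof -
  have "(\<lambda>n. d 0 / (c * d' 0) * pullback_radius \<beta> n d') \<longlonglongrightarrow> d 0 / (c * d' 0) * 0"
    using pullback_radius_tendsto[OF d' \<beta>] zero by (intro tendsto_intros) simp
  then have "limit_radius \<beta> d \<le> d 0 / (c * d' 0) * 0"
    by (rule LIMSEQ_le[OF pullback_radius_tendsto[OF d \<beta>]])
      (use pullback_radius_comparison[OF d d' \<beta> c le] in blast)
  then show ?thesis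
    using limit_radius_nonneg[OF d \<beta>] by simp
qed

text \<open>Iterates the recursion with \<open>h u <= u\<close>. Radii are at most 1, so for \<beta>
  up to 1 a positive radius keeps the backward norms bounded; \<open>radius_two_directions\<close>
  uses it in this way.\<close>

lemma limit_radius_shift_le:
  assumes d: "admissible d" and \<beta>: "0 < \<beta>"
  shows "limit_radius \<beta> d \<le> \<beta> ^ n * (d 0 / d n) * limit_radius \<beta> (\<lambda>k. d (n + k))"
proof (induction n)
  case 0
  then show ?case using admissible_pos[OF d, of 0] by simp
next
  case (Suc n)
  define r where "r = limit_radius \<beta> (\<lambda>k. d (Suc n + k))"
  have "limit_radius \<beta> (\<lambda>k. d (n + k)) = h (\<beta> * r) * (d n / d (Suc n))"
    using limit_radius_Suc[OF admissible_shift[OF d, of n] \<beta>] by (simp add: r_def)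
  also have "\<dots> \<le> (\<beta> * r) * (d n / d (Suc n))"
    using \<beta> limit_radius_nonneg[OF admissible_shift[OF d, of "Suc n"] \<beta>]
      admissible_pos[OF d, of n] admissible_pos[OF d, of "Suc n"]
    by (intro mult_right_mono h_le_self) (auto simp: r_def)
  finally have "\<beta> ^ n * (d 0 / d n) * limit_radius \<beta> (\<lambda>k. d (n + k)) \<le>
      \<beta> ^ n * (d 0 / d n) * ((\<beta> * r) * (d n / d (Suc n)))"
    using \<beta> admissible_pos[OF d, of n] admissible_pos[OF d, of 0] by (intro mult_left_mono) auto
  also have "\<dots> = \<beta> ^ Suc n * (d 0 / d (Suc n)) * r"
    using admissible_pos[OF d, of n] by simp
  finally show ?case
    using Suc by (simp add: r_def)
qed

text \<open>\<open>r\<^sub>n / d n\<close> grows at least geometrically, because the radii \<open>r\<^sub>n\<close> stay away from \<open>0\<close>.\<close>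

lemma limit_radius_eq_0:
  assumes d: "admissible d" and \<beta>: "0 < \<beta>" "\<beta> \<le> 1" and c: "0 < c" "\<And>n. c \<le> d n"
  shows "limit_radius \<beta> d = 0"
proof (rule ccontr)
  assume "limit_radius \<beta> d \<noteq> 0"
  then have r0: "limit_radius \<beta> d > 0"
    using limit_radius_nonneg[OF d \<beta>(1)] by simp
  define r where "r n = limit_radius \<beta> (\<lambda>k. d (n + k))" for n
  define t where "t n = r n / d n" for n
  have pos: "0 < d n" for n
    by (rule admissible_pos[OF d])
  have r: "0 \<le> r n" "r n \<le> 1" for n
    unfolding r_def by (rule limit_radius_nonneg limit_radius_le_1, rule admissible_shift[OF d], rule \<beta>)+
  have step: "t n = slope (\<beta> * r (Suc n)) * \<beta> * t (Suc n)" for n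
    using limit_radius_Suc[OF admissible_shift[OF d, of n] \<beta>(1)] pos[of n]
    by (simp add: t_def r_def h_eq_slope)
  have t0: "0 < t 0"
    using r0 pos[of 0] by (simp add: t_def r_def)
  have t_nonneg: "0 \<le> t n" for n
    using r(1)[of n] pos[of n] by (simp add: t_def)
  have t_le: "t n \<le> t (Suc n)" for n
  proof -
    have "slope (\<beta> * r (Suc n)) * \<beta> \<le> 1 * 1"
      using \<beta> r(1)[of "Suc n"] by (intro mult_mono slope_le_1) auto
    then show ?thesis
      unfolding step[of n] using t_nonneg[of "Suc n"] by (intro mult_left_le_one_le)
        (use \<beta> slope_pos[of "\<beta> * r (Suc n)"] r(1)[of "Suc n"] in auto)
  qed
  then have "t 0 \<le> t n" for n
    by (induction n) (auto intro: order_trans)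
  then have r_ge: "t 0 * c \<le> r n" for n
  proof -
    have "t 0 * c \<le> t n * d n"
      using \<open>t 0 \<le> t n\<close> c(2)[of n] t0 c(1) t_nonneg[of n] by (intro mult_mono) auto
    then show ?thesis using pos[of n] by (simp add: t_def)
  qed
  define g where "g = slope (\<beta> * (t 0 * c))"
  have g: "0 < g" "g < 1"
    using slope_pos[of "\<beta> * (t 0 * c)"] slope_less[of 0 "\<beta> * (t 0 * c)"] \<beta> c t0
    by (auto simp: g_def slope_def)
  have geom: "t n \<le> g * t (Suc n)" for n
  proof -
    have "slope (\<beta> * r (Suc n)) * \<beta> \<le> g * 1"
      unfolding g_def using \<beta> t0 c(1) r_ge[of "Suc n"] slope_pos[of "\<beta> * (t 0 * c)"]
      by (intro mult_mono slope_antimono) auto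
    then show ?thesis
      unfolding step[of n] using t_nonneg[of "Suc n"] by (intro mult_right_mono) auto
  qed
  have "t 0 \<le> g ^ n * t n" for n
  proof (induction n)
    case (Suc n)
    have "g ^ n * t n \<le> g ^ n * (g * t (Suc n))"
      using geom[of n] g by (intro mult_left_mono) auto
    then show ?case using Suc by (simp add: mult_ac)
  qed simp
  \<comment> \<open>Radii are at most 1 and \<open>d\<close> is at least \<open>c\<close>, so
    \<open>t\<close> is bounded, against its geometric growth.\<close>
  moreover have "t n \<le> 1 / c" for n
    unfolding t_def using r(2)[of n] c(2)[of n] c(1) by (intro frac_le) auto
  ultimately have "t 0 \<le> g ^ n * (1 / c)" for n
    using g by (meson mult_left_mono order_trans zero_le_power less_imp_le)
  moreover have "(\<lambda>n. g ^ n * (1 / c)) \<longlonglongrightarrow> 0 * (1 / c)"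
    using g by (intro tendsto_intros LIMSEQ_realpow_zero) auto
  ultimately have "t 0 \<le> 0 * (1 / c)"
    by (intro LIMSEQ_le_const) auto
  then show False using t0 by simp
qed

text \<open>Near 0 the response is at least \<kappa> times linear, so
  \<open>\<delta> * b * d\<close> is a lower solution of the recursion as long as it stays in the
  linear range. The assumed decay of \<open>d\<close> at rate \<open>\<kappa> * \<beta>\<close>
  guarantees that.\<close>

lemma limit_radius_pos:
  assumes d: "admissible d" and \<beta>: "0 < \<beta>" and \<kappa>: "0 < \<kappa>" "\<kappa> < 1"
    and b: "0 < b" "\<And>n. b * d n \<le> (\<kappa> * \<beta>) ^ n"
  shows "0 < limit_radius \<beta> d"
proof -
  obtain \<delta>' where \<delta>': "0 < \<delta>'" "\<And>x. 0 \<le> x \<Longrightarrow> x \<le> \<delta>' \<Longrightarrow> \<kappa> * x \<le> h x"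
    using h_linear_lower[OF \<kappa>(2)] by blast
  \<comment> \<open>At most 1, so that the lower solution starts below the radius 1, and small
    enough that \<open>\<beta> * \<delta>\<close> stays in the range of the linear estimate.\<close>
  define \<delta> where "\<delta> = min 1 (\<delta>' / \<beta>)"
  have \<delta>: "0 < \<delta>" "\<delta> \<le> 1" "\<beta> * \<delta> \<le> \<delta>'"
    using \<delta>'(1) \<beta> by (auto simp: \<delta>_def min_def field_simps)
  have "\<delta> * b * d 0 \<le> pullback_radius \<beta> n d" for n
    using d b
  proof (induction n arbitrary: d b)
    case 0
    then have "b * d 0 \<le> 1"
      using 0(3)[of 0] by simp
    then have "\<delta> * (b * d 0) \<le> 1 * 1"
      using \<delta> 0 admissible_pos[OF 0(1), of 0] by (intro mult_mono) auto
    then show ?case by (simp add: mult_ac)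
  next
    case (Suc n)
    note pos = admissible_pos[OF Suc.prems(1)]
    \<comment> \<open>The decay hypothesis for the tail has one power of
      \<open>\<kappa> * \<beta>\<close> less, and the constant is adjusted accordingly.\<close>
    define b' where "b' = b / (\<kappa> * \<beta>)"
    define x where "x = \<delta> * b' * d 1"
    have le: "x \<le> pullback_radius \<beta> n (\<lambda>k. d (Suc k))"
      unfolding x_def One_nat_def
    proof (rule Suc.IH[OF admissible_Suc[OF Suc.prems(1)]])
      show "0 < b'" using Suc.prems \<kappa> \<beta> by (simp add: b'_def)
      show "b' * d (Suc n) \<le> (\<kappa> * \<beta>) ^ n" for n
        using Suc.prems(3)[of "Suc n"] \<kappa> \<beta> by (simp add: b'_def divide_le_eq mult_ac)
    qed
    have b'1: "b' * d 1 \<le> 1"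
      using Suc.prems(3)[of 1] \<kappa> \<beta> by (simp add: b'_def divide_le_eq)
    have b'pos: "0 < b' * d 1"
      using Suc.prems(2) \<kappa> \<beta> pos[of 1] by (simp add: b'_def)
    have x: "0 \<le> x" "x \<le> \<delta>"
      using \<delta> b'1 b'pos mult_left_mono[of "b' * d 1" 1 \<delta>] by (auto simp: x_def mult_ac)
    have "\<kappa> * (\<beta> * x) \<le> h (\<beta> * x)"
      using \<beta> x \<delta> by (intro \<delta>'(2)) (auto intro: order_trans[OF mult_left_mono])
    also have "\<dots> \<le> h (\<beta> * pullback_radius \<beta> n (\<lambda>k. d (Suc k)))"
      using le x \<beta> by (intro h_mono mult_left_mono) auto
    finally have "\<kappa> * (\<beta> * x) * (d 0 / d 1) \<le> pullback_radius \<beta> (Suc n) d"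
      using pos[of 0] pos[of 1] by (simp add: mult_right_mono divide_right_mono)
    moreover have "\<kappa> * (\<beta> * x) * (d 0 / d 1) = \<delta> * b * d 0"
      using \<kappa> \<beta> pos[of 1] by (simp add: x_def b'_def)
    ultimately show ?case by simp
  qed
  then have "\<delta> * b * d 0 \<le> limit_radius \<beta> d"
    by (rule limit_radius_ge[OF d \<beta>])
  moreover have "0 < \<delta> * b * d 0"
    using \<delta> b(1) admissible_pos[OF d, of 0] by simp
  ultimately show ?thesis by simp
qed

end

section \<open>Linear algebra in the plane\<close>

definition det2 :: "real^2 \<Rightarrow> real^2 \<Rightarrow> real" where
  "det2 u v = u$1 * v$2 - u$2 * v$1"

lemma vec2_eq_iff: "u = v \<longleftrightarrow> u$1 = v$1 \<and> u$2 = v$2" for u v :: "real^2"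
  by (simp add: vec_eq_iff forall_2)

lemma matrix_vector_mult_2:
  "((X::real^2^2) *v v)$1 = X$1$1 * v$1 + X$1$2 * v$2"
  "((X::real^2^2) *v v)$2 = X$2$1 * v$1 + X$2$2 * v$2"
  by (simp_all add: matrix_vector_mult_def sum_2)

lemma norm_vec2_squared: "(norm v)\<^sup>2 = (v$1)\<^sup>2 + (v$2)\<^sup>2" for v :: "real^2"
  by (simp add: norm_vec_def L2_set_def sum_2)

lemma det2_matrix: "det2 (X *v u) (X *v v) = det X * det2 u v"
  by (simp add: det2_def matrix_vector_mult_2 det_2 algebra_simps)

lemma det2_swap: "det2 u v = - det2 v u"
  by (simp add: det2_def)

lemma det2_self [simp]: "det2 u u = 0"
  by (simp add: det2_def)

lemma det2_scaleR [simp]: "det2 (c *\<^sub>R u) v = c * det2 u v" "det2 u (c *\<^sub>R v) = c * det2 u v"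
  by (simp_all add: det2_def algebra_simps)

lemma abs_det2_le: "\<bar>det2 u v\<bar> \<le> norm u * norm v"
proof (rule power2_le_imp_le)
  \<comment> \<open>Lagrange's identity in the plane.\<close>
  have "(norm u * norm v)\<^sup>2 - (det2 u v)\<^sup>2 = (u$1 * v$1 + u$2 * v$2)\<^sup>2"
    by (simp add: power_mult_distrib norm_vec2_squared det2_def) (simp add: power2_eq_square algebra_simps)
  then have "0 \<le> (norm u * norm v)\<^sup>2 - (det2 u v)\<^sup>2"
    by simp
  then show "\<bar>det2 u v\<bar>\<^sup>2 \<le> (norm u * norm v)\<^sup>2"
    by simp
qed simp

lemma det2_plucker: "det2 u w *\<^sub>R v = det2 u v *\<^sub>R w + det2 v w *\<^sub>R u"
  by (simp add: vec2_eq_iff det2_def algebra_simps)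

text \<open>For unit vectors \<open>\<bar>det2 u v\<bar>\<close> is the sine of the angle between
  the lines, so it serves as a metric on the space of lines. The linear relation between three plane
  vectors gives the triangle inequality.\<close>

lemma abs_det2_triangle:
  assumes "norm u = 1" "norm v = 1" "norm w = 1"
  shows "\<bar>det2 u w\<bar> \<le> \<bar>det2 u v\<bar> + \<bar>det2 v w\<bar>"
proof -
  have "\<bar>det2 u w\<bar> = norm (det2 u w *\<^sub>R v)"
    using assms by simp
  also have "\<dots> = norm (det2 u v *\<^sub>R w + det2 v w *\<^sub>R u)"
    by (rule arg_cong[OF det2_plucker])
  also have "\<dots> \<le> \<bar>det2 u v\<bar> + \<bar>det2 v w\<bar>"
    using norm_triangle_ineq[of "det2 u v *\<^sub>R w" "det2 v w *\<^sub>R u"] assms by simp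
  finally show ?thesis .
qed

lemma det2_eq_0_imp_parallel:
  assumes "det2 u v = 0" "u \<noteq> 0"
  obtains c where "v = c *\<^sub>R u"
proof (cases "u$1 = 0")
  case True
  then have "v = (v$2 / u$2) *\<^sub>R u"
    using assms by (auto simp: vec2_eq_iff det2_def)
  then show ?thesis by (rule that)
next
  case False
  then have "v = (v$1 / u$1) *\<^sub>R u"
    using assms by (auto simp: vec2_eq_iff det2_def field_simps)
  then show ?thesis by (rule that)
qed

text \<open>Cramer's rule in the basis \<open>u\<close>, \<open>w\<close>.\<close>

lemma det2_ne_0_decompose:
  assumes "det2 u w \<noteq> 0"
  shows "v = (det2 v w / det2 u w) *\<^sub>R u + (det2 u v / det2 u w) *\<^sub>R w"
proof -
  have "det2 u w *\<^sub>R v = det2 u w *\<^sub>R ((det2 v w / det2 u w) *\<^sub>R u + (det2 u v / det2 u w) *\<^sub>R w)"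
    using assms det2_plucker[of u w v] by (simp add: scaleR_add_right add.commute)
  then show ?thesis
    using assms by (simp only: scaleR_cancel_left) simp
qed

lemma continuous_det2 [continuous_intros]:
  assumes "continuous_on S f" "continuous_on S g"
  shows "continuous_on S (\<lambda>x. det2 (f x) (g x))"
  unfolding det2_def by (intro continuous_intros assms)

lemma tendsto_det2 [tendsto_intros]:
  assumes "(f \<longlongrightarrow> a) F" "(g \<longlongrightarrow> b) F"
  shows "((\<lambda>x. det2 (f x) (g x)) \<longlongrightarrow> det2 a b) F"
  unfolding det2_def by (intro tendsto_intros assms)

lemma direction_nth [simp]: "direction \<alpha> $ 1 = cos (2 * pi * \<alpha>)" "direction \<alpha> $ 2 = sin (2 * pi * \<alpha>)"
  by (simp_all add: direction_def)

lemma norm_direction [simp]: "norm (direction \<alpha>) = 1"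
proof -
  have "(norm (direction \<alpha>))\<^sup>2 = 1"
    by (simp add: norm_vec2_squared)
  then show ?thesis
    by (metis norm_ge_zero power2_eq_1_iff zero_neq_neg_one one_neq_neg_one neg_0_le_iff_le not_one_le_zero)
qed

lemma direction_nonzero [simp]: "direction \<alpha> \<noteq> 0"
  using norm_direction[of \<alpha>] by (metis norm_zero zero_neq_one)

lemma continuous_on_direction [continuous_intros]:
  fixes f :: "real \<Rightarrow> real"
  shows "continuous_on S f \<Longrightarrow> continuous_on S (\<lambda>x. direction (f x))"
proof -
  have "direction \<alpha> = cos (2 * pi * \<alpha>) *\<^sub>R axis 1 1 + sin (2 * pi * \<alpha>) *\<^sub>R axis 2 1" for \<alpha>
    by (simp add: vec2_eq_iff axis_def)
  then show "continuous_on S f \<Longrightarrow> continuous_on S (\<lambda>x. direction (f x))"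
    by (simp only:) (intro continuous_on_add continuous_on_scaleR continuous_on_cos continuous_on_sin
        continuous_on_mult continuous_on_const)
qed

lemma det2_direction: "det2 (direction \<alpha>) (direction \<alpha>') = sin (2 * pi * (\<alpha>' - \<alpha>))"
  by (simp add: det2_def right_diff_distrib sin_diff)

lemma det2_direction_eq_0_iff:
  assumes "\<alpha> \<in> {0..<1/2}" "\<alpha>' \<in> {0..<1/2}"
  shows "det2 (direction \<alpha>) (direction \<alpha>') = 0 \<longleftrightarrow> \<alpha> = \<alpha>'"
proof
  assume "det2 (direction \<alpha>) (direction \<alpha>') = 0"
  then have *: "sin (pi * (2 * (\<alpha>' - \<alpha>))) = 0"
    by (simp add: det2_direction mult_ac)
  have "sin (pi * x) \<noteq> 0" if "0 < x" "x < 1" for x :: real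
    using sin_gt_zero[of "pi * x"] that by simp
  from this[of "2 * (\<alpha>' - \<alpha>)"] this[of "2 * (\<alpha> - \<alpha>')"] * assms show "\<alpha> = \<alpha>'"
    by (cases \<alpha> \<alpha>' rule: linorder_cases)
      (auto simp: algebra_simps sin_diff)
qed simp

lemma parallel_direction_exists:
  assumes "v \<noteq> 0"
  obtains \<alpha> c where "\<alpha> \<in> {0..<1/2}" "c \<noteq> 0" "v = c *\<^sub>R direction \<alpha>"
proof -
  have nv: "norm v > 0" using assms by simp
  have "(v$1 / norm v)\<^sup>2 + (v$2 / norm v)\<^sup>2 = (norm v)\<^sup>2 / (norm v)\<^sup>2"
    by (simp only: norm_vec2_squared power_divide add_divide_distrib[symmetric])
  then have "(v$1 / norm v)\<^sup>2 + (v$2 / norm v)\<^sup>2 = 1"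
    using nv by simp
  then obtain t where t: "0 \<le> t" "t < 2 * pi" and ct: "v$1 / norm v = cos t" "v$2 / norm v = sin t"
    by (rule sincos_total_2pi)
  have v: "v$1 = norm v * cos t" "v$2 = norm v * sin t"
    unfolding ct[symmetric] using nv by simp_all
  show ?thesis
  proof (cases "t < pi")
    case True
    show ?thesis
    proof (rule that[of "t / (2 * pi)" "norm v"])
      show "t / (2 * pi) \<in> {0..<1/2}"
        using t(1) True by (simp add: divide_less_eq)
      show "v = norm v *\<^sub>R direction (t / (2 * pi))"
        using v by (simp add: vec2_eq_iff)
    qed (use nv in simp)
  next
    case False
    show ?thesis
    proof (rule that[of "(t - pi) / (2 * pi)" "- norm v"])
      show "(t - pi) / (2 * pi) \<in> {0..<1/2}"
        using t(2) False by (simp add: divide_less_eq)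
      show "v = (- norm v) *\<^sub>R direction ((t - pi) / (2 * pi))"
        using v by (simp add: vec2_eq_iff)
    qed (use nv in simp)
  qed
qed

section \<open>Operator norms and contracted directions in SL(2,R)\<close>

lemma norm_matrix_vector_le: "norm (X *v v) \<le> opnorm X * norm v"
  unfolding opnorm_def by (rule onorm) (rule matrix_vector_mul_bounded_linear)

lemma opnorm_nonneg: "0 \<le> opnorm X"
  unfolding opnorm_def by (rule onorm_pos_le) (rule matrix_vector_mul_bounded_linear)

lemma opnorm_least: "(\<And>v. norm (X *v v) \<le> c * norm v) \<Longrightarrow> opnorm X \<le> c"
  unfolding opnorm_def by (rule onorm_le)

lemma opnorm_mult: "opnorm (X ** Y) \<le> opnorm X * opnorm Y"
proof (rule opnorm_least)
  fix v
  have "norm ((X ** Y) *v v) = norm (X *v (Y *v v))"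
    by (simp add: matrix_vector_mul_assoc)
  also have "\<dots> \<le> opnorm X * norm (Y *v v)"
    by (rule norm_matrix_vector_le)
  also have "\<dots> \<le> opnorm X * (opnorm Y * norm v)"
    by (intro mult_left_mono norm_matrix_vector_le opnorm_nonneg)
  finally show "norm ((X ** Y) *v v) \<le> opnorm X * opnorm Y * norm v"
    by (simp add: mult.assoc)
qed

text \<open>A crude bound by the entries, made for the continuity and hence the measurability of the
  operator norm.\<close>

lemma opnorm_diff: "\<bar>opnorm X - opnorm Y\<bar> \<le> (\<Sum>i\<in>UNIV. \<Sum>j\<in>UNIV. \<bar>(X - Y)$i$j\<bar>)"
proof -
  have tri: "opnorm X \<le> opnorm Y + opnorm (X - Y)" for X Y
  proof (rule opnorm_least)
    fix v
    have "norm (X *v v) = norm (Y *v v + (X - Y) *v v)"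
      by (simp add: matrix_vector_mult_diff_rdistrib)
    also have "\<dots> \<le> opnorm Y * norm v + opnorm (X - Y) * norm v"
      by (rule order_trans[OF norm_triangle_ineq add_mono]) (rule norm_matrix_vector_le)+
    finally show "norm (X *v v) \<le> (opnorm Y + opnorm (X - Y)) * norm v"
      by (simp add: distrib_right)
  qed
  have sum: "opnorm Z \<le> (\<Sum>i\<in>UNIV. \<Sum>j\<in>UNIV. \<bar>Z$i$j\<bar>)" for Z
    unfolding opnorm_def by (rule onorm_le_matrix_component_sum)
  have "(\<Sum>i\<in>UNIV. \<Sum>j\<in>UNIV. \<bar>(Y - X)$i$j\<bar>) = (\<Sum>i\<in>UNIV. \<Sum>j\<in>UNIV. \<bar>(X - Y)$i$j\<bar>)"
    by (simp add: abs_minus_commute)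
  then show ?thesis
    using tri[of X Y] tri[of Y X] sum[of "X - Y"] sum[of "Y - X"] by linarith
qed

lemma continuous_on_opnorm: "continuous_on UNIV opnorm"
  unfolding continuous_on_eq_continuous_at[OF open_UNIV]
proof
  fix Y
  show "isCont opnorm Y"
    unfolding isCont_def
  proof (rule LIM_zero_cancel)
    have "((\<lambda>X. \<Sum>i\<in>UNIV. \<Sum>j\<in>UNIV. \<bar>(X - Y)$i$j\<bar>) \<longlongrightarrow> (\<Sum>i\<in>UNIV. \<Sum>j\<in>UNIV. \<bar>(Y - Y)$i$j\<bar>)) (at Y)"
      by (intro tendsto_intros)
    then have lim: "((\<lambda>X. \<Sum>i\<in>UNIV. \<Sum>j\<in>UNIV. \<bar>(X - Y)$i$j\<bar>) \<longlongrightarrow> 0) (at Y)"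
      by simp
    show "((\<lambda>X. opnorm X - opnorm Y) \<longlongrightarrow> 0) (at Y)"
      by (rule Lim_null_comparison[OF always_eventually lim]) (simp only: real_norm_def opnorm_diff simp_thms)
  qed
qed

lemma borel_measurable_opnorm [measurable]:
  "f \<in> borel_measurable M \<Longrightarrow> (\<lambda>x. opnorm (f x)) \<in> borel_measurable M"
  by (rule measurable_compose[OF _ borel_measurable_continuous_onI[OF continuous_on_opnorm]])

text \<open>The adjugate, which is the inverse when the determinant is 1. Being linear in the
  entries, it is measurable without a case distinction.\<close>

definition sl2_inverse :: "real^2^2 \<Rightarrow> real^2^2" where
  "sl2_inverse X = vector [vector [X$2$2, - X$1$2], vector [- X$2$1, X$1$1]]"

lemma sl2_inverse_nth [simp]:
  "sl2_inverse X $1$1 = X$2$2" "sl2_inverse X $1$2 = - X$1$2"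
  "sl2_inverse X $2$1 = - X$2$1" "sl2_inverse X $2$2 = X$1$1"
  by (simp_all add: sl2_inverse_def)

lemma matrix2_eq_iff: "(X::real^2^2) = Y \<longleftrightarrow>
    X$1$1 = Y$1$1 \<and> X$1$2 = Y$1$2 \<and> X$2$1 = Y$2$1 \<and> X$2$2 = Y$2$2"
  by (auto simp: vec_eq_iff forall_2)

lemma det_sl2_inverse [simp]: "det (sl2_inverse X) = det X"
  by (simp add: det_2 mult.commute)

lemma sl2_inverse_mult:
  assumes "det X = 1"
  shows "sl2_inverse X ** X = mat 1" "X ** sl2_inverse X = mat 1"
  using assms by (simp_all add: matrix2_eq_iff matrix_matrix_mult_def sum_2 mat_def det_2 algebra_simps)

lemma sl2_inverse_cancel [simp]:
  assumes "det X = 1"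
  shows "sl2_inverse X *v (X *v v) = v" "X *v (sl2_inverse X *v v) = v"
  by (simp_all only: matrix_vector_mul_assoc sl2_inverse_mult[OF assms] matrix_vector_mul_lid)

lemma sl2_nonzero_iff:
  fixes X :: "real^2^2"
  assumes "det X = 1"
  shows "X *v v = 0 \<longleftrightarrow> v = 0"
proof
  assume "X *v v = 0"
  then have "sl2_inverse X *v (X *v v) = sl2_inverse X *v 0"
    by (rule arg_cong)
  then show "v = 0"
    using assms by simp
qed simp

text \<open>For the rotation \<open>w'\<close> of \<open>w = X\<inverse> v\<close> by a right angle,
  \<open>|w|\<^sup>2 = det2 w w' = det2 v (X w')\<close>.\<close>

lemma norm_le_opnorm_mult:
  assumes "det X = 1"
  shows "norm w \<le> opnorm X * norm (X *v w)"
proof (cases "w = 0")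
  case False
  define w' :: "real^2" where "w' = vector [- w$2, w$1]"
  have "(norm w)\<^sup>2 = det2 w w'"
    unfolding norm_vec2_squared by (simp add: det2_def w'_def power2_eq_square)
  also have "\<dots> = det2 (X *v w) (X *v w')"
    using assms by (simp add: det2_matrix)
  also have "\<dots> \<le> norm (X *v w) * norm (X *v w')"
    using abs_det2_le[of "X *v w" "X *v w'"] by simp
  also have "\<dots> \<le> norm (X *v w) * (opnorm X * norm w')"
    by (intro mult_left_mono norm_matrix_vector_le) auto
  also have "norm w' = norm w"
    by (rule power2_eq_imp_eq) (simp_all add: norm_vec2_squared w'_def)
  finally have "norm w * norm w \<le> (opnorm X * norm (X *v w)) * norm w"
    by (simp add: power2_eq_square mult_ac)
  then show ?thesis
    using False by (simp add: mult_le_cancel_right)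
qed simp

lemma opnorm_sl2_inverse:
  assumes "det X = 1"
  shows "opnorm (sl2_inverse X) = opnorm X"
proof -
  have le: "opnorm (sl2_inverse X) \<le> opnorm X" if "det X = 1" for X
  proof (rule opnorm_least)
    fix v show "norm (sl2_inverse X *v v) \<le> opnorm X * norm v"
      using norm_le_opnorm_mult[OF that, of "sl2_inverse X *v v"] that by simp
  qed
  have "sl2_inverse (sl2_inverse X) = X"
    by (simp add: matrix2_eq_iff)
  then show ?thesis
    using le[OF assms] le[of "sl2_inverse X"] assms by simp
qed

lemma opnorm_ge_1:
  assumes "det X = 1"
  shows "1 \<le> opnorm X"
proof -
  define v :: "real^2" where "v = direction 0"
  have "1 \<le> opnorm X * norm (X *v v)"
    using norm_le_opnorm_mult[OF assms, of v] by (simp add: v_def)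
  also have "\<dots> \<le> opnorm X * opnorm X"
    using norm_matrix_vector_le[of X v] by (intro mult_left_mono opnorm_nonneg) (simp add: v_def)
  finally have "1\<^sup>2 \<le> (opnorm X)\<^sup>2"
    by (simp add: power2_eq_square)
  then show ?thesis
    by (rule power2_le_imp_le) (rule opnorm_nonneg)
qed

text \<open>The preimage under \<open>X\<close> of a vector that the inverse stretches by more than
  half its norm is contracted. The factor 2 takes the place of an attained maximum, as in a singular
  value decomposition.\<close>

lemma contracted_vector_exists:
  assumes "det X = 1"
  obtains w where "norm w = 1" "norm (X *v w) \<le> 2 / opnorm X"
proof -
  define s where "s = opnorm X"
  have s: "s \<ge> 1" using opnorm_ge_1[OF assms] by (simp add: s_def)
  have "\<exists>v. norm (sl2_inverse X *v v) > s / 2 * norm v"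
  proof (rule ccontr)
    assume "\<not> ?thesis"
    then have "opnorm (sl2_inverse X) \<le> s / 2"
      by (intro opnorm_least) (auto simp: not_less)
    then show False
      using s opnorm_sl2_inverse[OF assms] by (simp add: s_def)
  qed
  then obtain v where v: "norm (sl2_inverse X *v v) > s / 2 * norm v" by blast
  define u where "u = sl2_inverse X *v v"
  have "0 \<le> s / 2 * norm v"
    using s by simp
  then have "norm u > 0"
    using v by (simp only: u_def)
  moreover have "norm v < 2 / s * norm u"
    using v s by (simp add: u_def field_simps)
  moreover have "X *v u = v"
    using assms by (simp add: u_def)
  ultimately have u: "norm u > 0" "norm v < 2 / s * norm u" "X *v u = v"
    by auto
  show ?thesis
  proof (rule that[of "u /\<^sub>R norm u"])
    have "norm (X *v (u /\<^sub>R norm u)) = norm v / norm u"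
      using u by (simp add: matrix_vector_mult_scaleR divide_inverse mult.commute)
    also have "\<dots> \<le> 2 / opnorm X"
      using u s by (simp add: s_def[symmetric] field_simps)
    finally show "norm (X *v (u /\<^sub>R norm u)) \<le> 2 / opnorm X" .
  qed (use u in simp)
qed

text \<open>In the orthonormal frame of \<open>w\<close> and its rotation by a right angle, the
  second coordinate of \<open>v\<close> is \<open>det2 w v\<close>. Only this coordinate is charged
  with the full operator norm.\<close>

lemma norm_image_near_contracted:
  assumes "norm w = 1" "norm v = 1"
  shows "norm (X *v v) \<le> norm (X *v w) + opnorm X * \<bar>det2 w v\<bar>"
proof -
  define w' :: "real^2" where "w' = vector [- w$2, w$1]"
  define a where "a = w$1 * v$1 + w$2 * v$2"
  have w1: "(w$1)\<^sup>2 + (w$2)\<^sup>2 = 1"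
    using norm_vec2_squared[of w] assms by simp
  have v: "v = a *\<^sub>R w + det2 w v *\<^sub>R w'"
  proof -
    have "(a *\<^sub>R w + det2 w v *\<^sub>R w')$1 = v$1 * ((w$1)\<^sup>2 + (w$2)\<^sup>2)"
      "(a *\<^sub>R w + det2 w v *\<^sub>R w')$2 = v$2 * ((w$1)\<^sup>2 + (w$2)\<^sup>2)"
      by (simp_all add: w'_def det2_def a_def algebra_simps power2_eq_square)
    then show ?thesis
      unfolding w1 by (simp add: vec2_eq_iff)
  qed
  have "norm w' = norm w"
    by (rule power2_eq_imp_eq) (simp_all add: norm_vec2_squared w'_def)
  then have w': "norm w' = 1"
    using assms by simp
  have a: "\<bar>a\<bar> \<le> 1"
  proof -
    have "a = w \<bullet> v"
      by (simp add: a_def inner_vec_def sum_2)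
    then show ?thesis
      using Cauchy_Schwarz_ineq2[of w v] assms by simp
  qed
  have "X *v v = a *\<^sub>R (X *v w) + det2 w v *\<^sub>R (X *v w')"
    by (subst v) (simp add: matrix_vector_right_distrib matrix_vector_mult_scaleR)
  then have "norm (X *v v) \<le> \<bar>a\<bar> * norm (X *v w) + \<bar>det2 w v\<bar> * norm (X *v w')"
    using norm_triangle_ineq[of "a *\<^sub>R (X *v w)" "det2 w v *\<^sub>R (X *v w')"] by simp
  also have "\<dots> \<le> 1 * norm (X *v w) + \<bar>det2 w v\<bar> * (opnorm X * 1)"
    using a w' norm_matrix_vector_le[of X w'] by (intro add_mono mult_right_mono mult_left_mono) auto
  finally show ?thesis
    by (simp add: mult.commute)
qed

text \<open>A limit point of the vectors almost maximally contracted by \<open>B n\<close> is contracted by all \<open>B n\<close>: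
  consecutive contracted directions differ by an angle of order \<open>exp (- 2 * l * n)\<close>.\<close>

lemma contracted_direction_exists:
  fixes B :: "nat \<Rightarrow> real^2^2"
  assumes det: "\<And>n. det (B n) = 1"
    and step: "\<And>n v. norm (B (Suc n) *v v) \<le> K * norm (B n *v v)"
    and l: "0 < l"
    and low: "\<And>\<delta>. 0 < \<delta> \<Longrightarrow> \<exists>c>0. \<forall>n. c * exp ((l - \<delta>) * real n) \<le> opnorm (B n)"
    and high: "\<And>\<delta>. 0 < \<delta> \<Longrightarrow> \<exists>C>0. \<forall>n. opnorm (B n) \<le> C * exp ((l + \<delta>) * real n)"
  obtains v where "norm v = 1"
    "\<And>\<delta>. 0 < \<delta> \<Longrightarrow> \<exists>C>0. \<forall>n. norm (B n *v v) \<le> C * exp ((- l + \<delta>) * real n)"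
proof -
  define \<sigma> where "\<sigma> n = opnorm (B n)" for n
  have \<sigma>: "\<sigma> n \<ge> 1" for n
    using opnorm_ge_1[OF det] by (simp add: \<sigma>_def)
  have "\<exists>w. norm w = 1 \<and> norm (B n *v w) \<le> 2 / \<sigma> n" for n
    unfolding \<sigma>_def using contracted_vector_exists[OF det] by metis
  then obtain w where w: "\<And>n. norm (w n) = 1" "\<And>n. norm (B n *v w n) \<le> 2 / \<sigma> n"
    by metis
  have K: "K \<ge> 0"
  proof -
    have "0 \<le> K * norm (B 0 *v w 0)"
      using step[of 0 "w 0"] norm_ge_zero order_trans by blast
    moreover have "norm (B 0 *v w 0) > 0"
      using sl2_nonzero_iff[OF det[of 0], of "w 0"] w(1)[of 0] by auto
    ultimately show ?thesis
      by (simp add: zero_le_mult_iff)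
  qed
  define b where "b k = 4 * K / (\<sigma> k * \<sigma> (Suc k))" for k
  have consec: "\<bar>det2 (w k) (w (Suc k))\<bar> \<le> b k" for k
  proof -
    have "\<bar>det2 (w k) (w (Suc k))\<bar> = \<bar>det2 (B (Suc k) *v w k) (B (Suc k) *v w (Suc k))\<bar>"
      by (simp add: det2_matrix det)
    also have "\<dots> \<le> norm (B (Suc k) *v w k) * norm (B (Suc k) *v w (Suc k))"
      by (rule abs_det2_le)
    also have "\<dots> \<le> (K * (2 / \<sigma> k)) * (2 / \<sigma> (Suc k))"
      using K w(2)[of "Suc k"] \<sigma>[of k] order_trans[OF step mult_left_mono[OF w(2)[of k] K]]
      by (intro mult_mono) auto
    finally show ?thesis by (simp add: b_def field_simps)
  qed
  have chain: "\<bar>det2 (w n) (w (n + m))\<bar> \<le> (\<Sum>k<m. b (n + k))" for n m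
  proof (induction m)
    case (Suc m)
    have "\<bar>det2 (w n) (w (n + Suc m))\<bar> \<le> \<bar>det2 (w n) (w (n + m))\<bar> + \<bar>det2 (w (n + m)) (w (Suc (n + m)))\<bar>"
      using abs_det2_triangle w(1) by simp
    then show ?case
      using Suc consec[of "n + m"] by simp
  qed simp
  \<comment> \<open>Any limit point serves: the summed angle bounds are uniform in the later index
    and so pass to the limit.\<close>
  have "compact (sphere 0 1 :: (real^2) set)" "\<forall>n. w n \<in> sphere 0 1"
    using w(1) by auto
  then obtain v r where v: "v \<in> sphere 0 1" and r: "strict_mono r" "(w \<circ> r) \<longlonglongrightarrow> v"
    unfolding compact_def by metis
  show ?thesis
  proof (rule that[of v])
    show v1: "norm v = 1" using v by simp
    fix \<delta> :: real assume \<delta>: "\<delta> > 0"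
    \<comment> \<open>The angle error, of order \<open>exp (- 2 * (l - \<eta>) * n)\<close>, is
      stretched by at most \<open>exp ((l + \<eta>) * n)\<close>, which leaves the exponent
      \<open>- l + 3 * \<eta>\<close>; hence a third of \<delta>. The bound by \<open>l / 2\<close>
      makes the geometric rate \<open>q\<close> less than 1.\<close>
    define \<eta> where "\<eta> = min (\<delta> / 3) (l / 2)"
    have \<eta>: "0 < \<eta>" "3 * \<eta> \<le> \<delta>" "\<eta> < l"
      using \<delta> l by (auto simp: \<eta>_def)
    obtain c where c: "c > 0" "\<And>n. c * exp ((l - \<eta>) * real n) \<le> \<sigma> n"
      using low[OF \<eta>(1)] by (auto simp: \<sigma>_def)
    obtain C where C: "C > 0" "\<And>n. \<sigma> n \<le> C * exp ((l + \<eta>) * real n)"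
      using high[OF \<eta>(1)] by (auto simp: \<sigma>_def)
    define q where "q = exp (- 2 * (l - \<eta>))"
    have q: "0 < q" "q < 1" using \<eta> by (auto simp: q_def)
    have b_le: "b k \<le> 4 * K / c\<^sup>2 * q ^ k" for k
    proof -
      have "c * exp ((l - \<eta>) * real k) \<le> \<sigma> (Suc k)"
      proof -
        have "c * exp ((l - \<eta>) * real k) \<le> c * exp ((l - \<eta>) * real (Suc k))"
          using c \<eta> by (intro mult_left_mono) auto
        then show ?thesis using c(2)[of "Suc k"] by simp
      qed
      then have "(c * exp ((l - \<eta>) * real k)) * (c * exp ((l - \<eta>) * real k)) \<le> \<sigma> k * \<sigma> (Suc k)"
        using c \<sigma>[of k] by (intro mult_mono) auto
      then have "b k \<le> 4 * K / ((c * exp ((l - \<eta>) * real k)) * (c * exp ((l - \<eta>) * real k)))"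
        unfolding b_def using K c by (intro divide_left_mono) (auto intro!: mult_pos_pos less_le_trans[OF _ \<sigma>])
      also have "\<dots> = 4 * K / c\<^sup>2 * q ^ k"
      proof -
        have "q ^ k = inverse (exp ((l - \<eta>) * real k)) * inverse (exp ((l - \<eta>) * real k))"
          by (simp add: q_def exp_of_nat_mult[symmetric] exp_minus[symmetric] exp_add[symmetric] algebra_simps)
        then show ?thesis
          by (simp add: power2_eq_square divide_inverse mult_ac)
      qed
      finally show ?thesis .
    qed
    define D where "D = 4 * K / c\<^sup>2 / (1 - q)"
    have D: "D \<ge> 0" using K q by (simp add: D_def)
    have tail: "(\<Sum>k<m. b (n + k)) \<le> D * q ^ n" for n m
    proof -
      have "(\<Sum>k<m. b (n + k)) \<le> (\<Sum>k<m. 4 * K / c\<^sup>2 * q ^ n * q ^ k)"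
        using b_le by (intro sum_mono) (metis mult.assoc power_add)
      also have "\<dots> = 4 * K / c\<^sup>2 * q ^ n * (\<Sum>k<m. q ^ k)"
        by (simp add: sum_distrib_left)
      also have "\<dots> \<le> 4 * K / c\<^sup>2 * q ^ n * (1 / (1 - q))"
      proof (rule mult_left_mono)
        show "(\<Sum>k<m. q ^ k) \<le> 1 / (1 - q)"
          using q by (subst sum_gp_strict) (auto simp: divide_simps)
      qed (use K q in auto)
      finally show ?thesis by (simp add: D_def)
    qed
    have angle: "\<bar>det2 (w n) v\<bar> \<le> D * q ^ n" for n
    proof -
      have "(\<lambda>j. \<bar>det2 (w n) ((w \<circ> r) j)\<bar>) \<longlonglongrightarrow> \<bar>det2 (w n) v\<bar>"
        by (intro tendsto_intros r)
      then show ?thesis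
      proof (rule LIMSEQ_le_const2)
        show "\<exists>N. \<forall>j\<ge>N. \<bar>det2 (w n) ((w \<circ> r) j)\<bar> \<le> D * q ^ n"
        proof (intro exI[of _ n] allI impI)
          fix j assume "j \<ge> n"
          then have "r j \<ge> n"
            using seq_suble[OF r(1), of j] by simp
          then have "n + (r j - n) = r j" by simp
          then show "\<bar>det2 (w n) ((w \<circ> r) j)\<bar> \<le> D * q ^ n"
            using chain[of n "r j - n"] tail[of n "r j - n"] by simp
        qed
      qed
    qed
    have bound: "norm (B n *v v) \<le> (2 / c + C * D) * exp ((- l + \<delta>) * real n)" for n
    proof -
      have "norm (B n *v v) \<le> norm (B n *v w n) + \<sigma> n * \<bar>det2 (w n) v\<bar>"
        unfolding \<sigma>_def by (rule norm_image_near_contracted[OF w(1) v1])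
      also have "\<dots> \<le> 2 / (c * exp ((l - \<eta>) * real n)) + (C * exp ((l + \<eta>) * real n)) * (D * q ^ n)"
      proof (intro add_mono mult_mono)
        show "norm (B n *v w n) \<le> 2 / (c * exp ((l - \<eta>) * real n))"
          using w(2)[of n] c(2)[of n] c(1) \<sigma>[of n] by (elim order_trans) (intro divide_left_mono, auto)
      qed (use C angle[of n] in auto)
      also have "\<dots> = 2 / c * exp ((- l + \<eta>) * real n) + C * D * exp ((- l + 3 * \<eta>) * real n)"
      proof -
        have "q ^ n = exp (- 2 * (l - \<eta>) * real n)"
          by (simp add: q_def exp_of_nat_mult[symmetric] mult.commute)
        then have "exp ((l + \<eta>) * real n) * q ^ n = exp ((- l + 3 * \<eta>) * real n)"
          by (simp add: exp_add[symmetric] algebra_simps)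
        moreover have "inverse (exp ((l - \<eta>) * real n)) = exp ((- l + \<eta>) * real n)"
          by (simp add: exp_minus[symmetric] algebra_simps)
        ultimately show ?thesis
          by (simp add: divide_inverse mult_ac)
      qed
      also have "\<dots> \<le> 2 / c * exp ((- l + \<delta>) * real n) + C * D * exp ((- l + \<delta>) * real n)"
        using c C D \<eta> by (intro add_mono mult_left_mono) (auto intro!: mult_right_mono)
      finally show ?thesis
        by (simp add: distrib_right)
    qed
    have "2 / c + C * D > 0"
      using c C D by (intro add_pos_nonneg) auto
    then show "\<exists>C>0. \<forall>n. norm (B n *v v) \<le> C * exp ((- l + \<delta>) * real n)"
      using bound by blast
  qed
qed

section \<open>Cocycles in SL(2,R)\<close>

lemma borel_measurable_matrix_mult [measurable]:
  fixes f g :: "'a \<Rightarrow> real^2^2"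
  assumes [measurable]: "f \<in> borel_measurable M" "g \<in> borel_measurable M"
  shows "(\<lambda>x. f x ** g x) \<in> borel_measurable M"
  by (rule borel_measurable_continuous_Pair[OF assms])
    (simp add: matrix_matrix_mult_def, intro continuous_intros)

lemma borel_measurable_matrix_vector_mult [measurable]:
  fixes f :: "'a \<Rightarrow> real^2^2" and g :: "'a \<Rightarrow> real^2"
  assumes [measurable]: "f \<in> borel_measurable M" "g \<in> borel_measurable M"
  shows "(\<lambda>x. f x *v g x) \<in> borel_measurable M"
  by (rule borel_measurable_continuous_Pair[OF assms])
    (simp add: matrix_vector_mult_def, intro continuous_intros)

lemma borel_measurable_sl2_inverse [measurable]:
  assumes [measurable]: "f \<in> borel_measurable M"
  shows "(\<lambda>x. sl2_inverse (f x)) \<in> borel_measurable M"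
proof -
  have eq: "sl2_inverse X = (\<chi> i j. (if i = j then 1 else - 1) * X $ (if i = j then 3 - i else i) $ (if i = j then 3 - i else j))" for X
    by (simp add: matrix2_eq_iff)
  have "continuous_on UNIV sl2_inverse"
    unfolding eq[abs_def] by (intro continuous_intros)
  then show ?thesis
    by (rule measurable_compose[OF assms borel_measurable_continuous_onI])
qed

lemma borel_measurable_direction [measurable]:
  assumes [measurable]: "f \<in> borel_measurable M"
  shows "(\<lambda>x. direction (f x)) \<in> borel_measurable M"
proof -
  have "continuous_on UNIV direction"
    by (intro continuous_intros)
  then show ?thesis
    by (rule measurable_compose[OF assms borel_measurable_continuous_onI])
qed

lemma exponential_bounds:
  fixes \<sigma> :: "nat \<Rightarrow> real"
  assumes \<sigma>: "\<And>n. 1 \<le> \<sigma> n" and lim: "(\<lambda>n. ln (\<sigma> n) / real n) \<longlonglongrightarrow> l" and \<delta>: "0 < \<delta>"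
  shows "\<exists>C>0. \<forall>n. \<sigma> n \<le> C * exp ((l + \<delta>) * real n)"
    and "\<exists>c>0. \<forall>n. c * exp ((l - \<delta>) * real n) \<le> \<sigma> n"
proof -
  have "eventually (\<lambda>n. \<bar>ln (\<sigma> n) / real n - l\<bar> < \<delta>) sequentially"
    using tendstoD[OF lim \<delta>] by (simp add: dist_real_def)
  then obtain N0 where N0: "\<And>n. n \<ge> N0 \<Longrightarrow> \<bar>ln (\<sigma> n) / real n - l\<bar> < \<delta>"
    by (auto simp: eventually_sequentially)
  define N where "N = max N0 1"
  have ln_bounds: "(l - \<delta>) * real n \<le> ln (\<sigma> n)" "ln (\<sigma> n) \<le> (l + \<delta>) * real n" if "n \<ge> N" for n
  proof -
    have n: "n \<ge> N0" "n \<ge> 1" using that by (auto simp: N_def)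
    have "l - \<delta> < ln (\<sigma> n) / real n" "ln (\<sigma> n) / real n < l + \<delta>"
      using N0[OF n(1)] by (auto simp: abs_less_iff)
    then show "(l - \<delta>) * real n \<le> ln (\<sigma> n)" "ln (\<sigma> n) \<le> (l + \<delta>) * real n"
      using n(2) by (simp_all add: pos_less_divide_eq pos_divide_less_eq)
  qed
  have large: "exp ((l - \<delta>) * real n) \<le> \<sigma> n" "\<sigma> n \<le> exp ((l + \<delta>) * real n)" if "n \<ge> N" for n
  proof -
    have "exp (ln (\<sigma> n)) = \<sigma> n"
      using \<sigma>[of n] by simp
    then show "exp ((l - \<delta>) * real n) \<le> \<sigma> n" "\<sigma> n \<le> exp ((l + \<delta>) * real n)"
      using ln_bounds[OF that] by (metis exp_le_cancel_iff)+
  qed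
  \<comment> \<open>Collects the finitely many quotients below \<open>N\<close>, so that one
    constant makes both asymptotic bounds valid at all times.\<close>
  define D where "D = 1 + (\<Sum>k<N. \<sigma> k / exp ((l + \<delta>) * real k) + exp ((l - \<delta>) * real k) / \<sigma> k)"
  have term_nonneg: "0 \<le> \<sigma> k / exp ((l + \<delta>) * real k)" "0 \<le> exp ((l - \<delta>) * real k) / \<sigma> k" for k
    using \<sigma>[of k] by simp_all
  have D: "D \<ge> 1"
    unfolding D_def using term_nonneg by (simp add: sum_nonneg)
  have small: "\<sigma> n / exp ((l + \<delta>) * real n) \<le> D" "exp ((l - \<delta>) * real n) / \<sigma> n \<le> D" if "n < N" for n
  proof -
    have "\<sigma> n / exp ((l + \<delta>) * real n) + exp ((l - \<delta>) * real n) / \<sigma> n \<le> D - 1"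
      unfolding D_def using that term_nonneg
      by (simp, intro member_le_sum[where f = "\<lambda>k. \<sigma> k / exp ((l + \<delta>) * real k) + exp ((l - \<delta>) * real k) / \<sigma> k"])
        (auto intro!: add_nonneg_nonneg)
    then show "\<sigma> n / exp ((l + \<delta>) * real n) \<le> D" "exp ((l - \<delta>) * real n) / \<sigma> n \<le> D"
      using term_nonneg[of n] by linarith+
  qed
  have "\<sigma> n \<le> D * exp ((l + \<delta>) * real n)" for n
  proof (cases "n < N")
    case True
    then show ?thesis
      using small(1)[of n] by (simp add: divide_le_eq)
  next
    case False
    have "1 * exp ((l + \<delta>) * real n) \<le> D * exp ((l + \<delta>) * real n)"
      using D by (intro mult_right_mono) auto
    then show ?thesis
      using large(2)[OF leI[OF False]] by linarith
  qed
  then show "\<exists>C>0. \<forall>n. \<sigma> n \<le> C * exp ((l + \<delta>) * real n)"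
    using D by (intro exI[of _ D]) auto
  have "1 / D * exp ((l - \<delta>) * real n) \<le> \<sigma> n" for n
  proof (cases "n < N")
    case True
    then have "exp ((l - \<delta>) * real n) \<le> D * \<sigma> n"
      using small(2)[of n] \<sigma>[of n] by (simp add: divide_le_eq)
    then show ?thesis
      using D by (simp add: divide_le_eq mult.commute)
  next
    case False
    have "1 / D * exp ((l - \<delta>) * real n) \<le> 1 * exp ((l - \<delta>) * real n)"
      using D by (intro mult_right_mono) auto
    then show ?thesis
      using large(1)[OF leI[OF False]] by linarith
  qed
  then show "\<exists>c>0. \<forall>n. c * exp ((l - \<delta>) * real n) \<le> \<sigma> n"
    using D by (intro exI[of _ "1 / D"]) auto
qed

text \<open>An exponential rate of at most \<open>- l\<close>. The slack \<delta> is what a limit of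
  logarithms divided by \<open>n\<close> leaves undetermined.\<close>

definition decays :: "real \<Rightarrow> (nat \<Rightarrow> real^2^2) \<Rightarrow> real^2 \<Rightarrow> bool" where
  "decays l B u \<longleftrightarrow> u \<noteq> 0 \<and>
     (\<forall>\<delta>>0. \<exists>C>0. \<forall>n. norm (B n *v u) \<le> C * exp ((- l + \<delta>) * real n))"

lemma decays_nonzero: "decays l B u \<Longrightarrow> u \<noteq> 0"
  by (simp add: decays_def)

lemma decaysE:
  assumes "decays l B u" "0 < \<delta>"
  obtains C where "0 < C" "\<And>n. norm (B n *v u) \<le> C * exp ((- l + \<delta>) * real n)"
  using assms by (auto simp: decays_def)

lemma decays_scaleR:
  assumes "decays l B u" "c \<noteq> 0"
  shows "decays l B (c *\<^sub>R u)"
  unfolding decays_def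
proof (intro conjI allI impI)
  fix \<delta> :: real assume "\<delta> > 0"
  then obtain C where C: "0 < C" "\<And>n. norm (B n *v u) \<le> C * exp ((- l + \<delta>) * real n)"
    using decaysE[OF assms(1)] by blast
  have "norm (B n *v (c *\<^sub>R u)) \<le> \<bar>c\<bar> * C * exp ((- l + \<delta>) * real n)" for n
    using mult_left_mono[OF C(2)[of n], of "\<bar>c\<bar>"] by (simp add: matrix_vector_mult_scaleR)
  then show "\<exists>C>0. \<forall>n. norm (B n *v (c *\<^sub>R u)) \<le> C * exp ((- l + \<delta>) * real n)"
    using C(1) assms(2) by (intro exI[of _ "\<bar>c\<bar> * C"]) auto
qed (use assms decays_nonzero in auto)

lemma exp_times_nat_tendsto_0: "a < 0 \<Longrightarrow> (\<lambda>n. C * exp (a * real n)) \<longlonglongrightarrow> 0" for a C :: real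
proof -
  assume a: "a < 0"
  have "(\<lambda>n. C * exp a ^ n) \<longlonglongrightarrow> C * 0"
    using a by (intro tendsto_intros LIMSEQ_realpow_zero) auto
  then show ?thesis
    by (simp add: exp_of_nat_mult[symmetric] mult.commute)
qed

lemma decays_tendsto_0:
  assumes "decays l B u" "0 < l"
  shows "(\<lambda>n. norm (B n *v u)) \<longlonglongrightarrow> 0"
proof -
  obtain C where C: "0 < C" "\<And>n. norm (B n *v u) \<le> C * exp ((- l + l / 2) * real n)"
    using decaysE[OF assms(1), of "l / 2"] assms(2) by auto
  have lim: "(\<lambda>n. C * exp ((- l + l / 2) * real n)) \<longlonglongrightarrow> 0"
    using assms(2) by (intro exp_times_nat_tendsto_0) simp
  show ?thesis
    by (rule tendsto_sandwich[OF _ _ tendsto_const lim]) (use C in \<open>auto intro: always_eventually\<close>)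
qed

text \<open>The matrices preserve area, while the area spanned by two vectors tending to 0 tends to
  0. This uniqueness of the decaying line replaces explicit equivariance arguments later on.\<close>

lemma decays_parallel:
  assumes det: "\<And>n. det (B n) = 1" and "decays l B u" "decays l B v" "0 < l"
  shows "det2 u v = 0"
proof -
  have "(\<lambda>n. norm (B n *v u) * norm (B n *v v)) \<longlonglongrightarrow> 0 * 0"
    using assms by (intro tendsto_mult decays_tendsto_0)
  moreover have "\<bar>det2 u v\<bar> \<le> norm (B n *v u) * norm (B n *v v)" for n
    using abs_det2_le[of "B n *v u" "B n *v v"] by (simp add: det2_matrix det)
  ultimately have "\<bar>det2 u v\<bar> \<le> 0 * 0"
    by (intro LIMSEQ_le_const) auto
  then show ?thesis by simp
qed

text \<open>Area is preserved, so a vector transversal to one that tends to 0 must grow without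
  bound.\<close>

lemma decays_transversal_at_top:
  assumes det: "\<And>n. det (B n) = 1" and "decays l B u" "0 < l" "det2 u v \<noteq> 0"
  shows "filterlim (\<lambda>n. norm (B n *v v)) at_top sequentially"
proof -
  have pos: "norm (B n *v u) > 0" for n
    using sl2_nonzero_iff[OF det, of n u] decays_nonzero[OF assms(2)] by simp
  have inv: "filterlim (\<lambda>n. inverse (norm (B n *v u))) at_top sequentially"
    by (rule filterlim_inverse_at_top[OF decays_tendsto_0[OF assms(2,3)]])
      (use pos in \<open>auto intro: always_eventually\<close>)
  have "filterlim (\<lambda>n. \<bar>det2 u v\<bar> * inverse (norm (B n *v u))) at_top sequentially"
    by (rule filterlim_tendsto_pos_mult_at_top[OF tendsto_const _ inv]) (use assms in auto)
  then show ?thesis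
  proof (rule filterlim_at_top_mono)
    have "\<bar>det2 u v\<bar> \<le> norm (B n *v u) * norm (B n *v v)" for n
      using abs_det2_le[of "B n *v u" "B n *v v"] by (simp add: det2_matrix det)
    then show "eventually (\<lambda>n. \<bar>det2 u v\<bar> * inverse (norm (B n *v u)) \<le> norm (B n *v v)) sequentially"
      using pos by (auto simp: field_simps intro!: always_eventually)
  qed
qed

text \<open>On the arc \<open>{0..c}\<close> the vectors \<open>B n x *v direction q\<close> are uniformly long unless the arc
  contains the decaying direction.\<close>

lemma decaying_angle_measurable:
  fixes B :: "nat \<Rightarrow> 'a \<Rightarrow> real^2^2"
  assumes B [measurable]: "\<And>n. B n \<in> borel_measurable M" and S: "S \<in> sets M" and l: "0 < l"
    and det: "\<And>n x. x \<in> S \<Longrightarrow> det (B n x) = 1"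
    and \<alpha>: "\<And>x. x \<in> S \<Longrightarrow> \<alpha> x \<in> {0..<1/2}"
    and decays: "\<And>x. x \<in> S \<Longrightarrow> decays l (\<lambda>n. B n x) (direction (\<alpha> x))"
  shows "\<alpha> \<in> borel_measurable (restrict_space M S)"
  unfolding borel_measurable_iff_le
proof
  fix c :: real
  have space: "space (restrict_space M S) = S"
    using sets.sets_into_space[OF S] by (auto simp: space_restrict_space)
  consider "c < 0" | "c \<ge> 1/2" | "0 \<le> c" "c < 1/2" by linarith
  then show "{x \<in> space (restrict_space M S). \<alpha> x \<le> c} \<in> sets (restrict_space M S)"
  proof cases
    case 1
    then have "{x \<in> space (restrict_space M S). \<alpha> x \<le> c} = {}"
      using \<alpha> unfolding space by fastforce
    then show ?thesis by (simp only: sets.empty_sets)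
  next
    case 2
    then have "{x \<in> space (restrict_space M S). \<alpha> x \<le> c} = space (restrict_space M S)"
      using \<alpha> unfolding space by fastforce
    then show ?thesis by (simp only: sets.top)
  next
    case 3
    obtain D where D: "countable D" "D \<subseteq> {0..c}" "{0..c} \<subseteq> closure D"
      using separable[of "{0..c}"] by blast
    \<comment> \<open>If the decaying angle lies in the arc, continuity makes nearby angles of
      \<open>D\<close> short at infinitely many times. If it does not, its area with the directions
      of the arc is bounded below, which forbids short vectors at large times. Countability of
      \<open>D\<close> makes the condition measurable.\<close>
    define E where "E = {x \<in> space M. \<forall>N. \<exists>n\<ge>N. \<exists>q\<in>D. norm (B n x *v direction q) < 1}"
    have E: "E \<in> sets M"
      unfolding E_def using D(1) by measurable
    have iff: "\<alpha> x \<le> c \<longleftrightarrow> x \<in> E" if x: "x \<in> S" for x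
    proof
      assume le: "\<alpha> x \<le> c"
      have "\<exists>n\<ge>N. \<exists>q\<in>D. norm (B n x *v direction q) < 1" for N
      proof -
        have "eventually (\<lambda>n. norm (B n x *v direction (\<alpha> x)) < 1) sequentially"
          by (rule order_tendstoD(2)[OF decays_tendsto_0[OF decays[OF x] l]]) simp
        then obtain n where n: "n \<ge> N" "norm (B n x *v direction (\<alpha> x)) < 1"
          unfolding eventually_sequentially by (metis nle_le)
        have cont: "continuous_on UNIV (\<lambda>q. norm (B n x *v direction q))"
          by (intro continuous_intros continuous_on_compose2[OF matrix_vector_mult_linear_continuous_on[of UNIV]]) auto
        have "open {q. norm (B n x *v direction q) < 1}"
          using open_Collect_less[OF cont continuous_on_const] .
        moreover have "\<alpha> x \<in> closure D" "\<alpha> x \<in> {q. norm (B n x *v direction q) < 1}"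
          using D(3) le \<alpha>[OF x] n by auto
        ultimately have "D \<inter> {q. norm (B n x *v direction q) < 1} \<noteq> {}"
          using open_Int_closure_eq_empty by blast
        then show ?thesis using n(1) by blast
      qed
      then show "x \<in> E"
        using x sets.sets_into_space[OF S] by (auto simp: E_def)
    next
      assume "x \<in> E"
      show "\<alpha> x \<le> c"
      proof (rule ccontr)
        assume gt: "\<not> \<alpha> x \<le> c"
        define f where "f q = \<bar>det2 (direction q) (direction (\<alpha> x))\<bar>" for q
        have "continuous_on {0..c} f"
          unfolding f_def by (intro continuous_intros)
        then obtain z where z: "z \<in> {0..c}" "\<And>q. q \<in> {0..c} \<Longrightarrow> f z \<le> f q"
          using continuous_attains_inf[of "{0..c}" f] 3 by auto
        have "f z > 0"
          using det2_direction_eq_0_iff[of z "\<alpha> x"] z(1) 3 gt \<alpha>[OF x] by (auto simp: f_def)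
        then have "eventually (\<lambda>n. norm (B n x *v direction (\<alpha> x)) < f z) sequentially"
          by (rule order_tendstoD(2)[OF decays_tendsto_0[OF decays[OF x] l]])
        then obtain N where N: "\<And>n. n \<ge> N \<Longrightarrow> norm (B n x *v direction (\<alpha> x)) < f z"
          by (auto simp: eventually_sequentially)
        obtain n q where nq: "n \<ge> N" "q \<in> D" "norm (B n x *v direction q) < 1"
          using \<open>x \<in> E\<close> unfolding E_def by blast
        have "f z \<le> f q"
          using z(2) nq(2) D(2) by auto
        also have "\<dots> \<le> norm (B n x *v direction q) * norm (B n x *v direction (\<alpha> x))"
          using abs_det2_le[of "B n x *v direction q" "B n x *v direction (\<alpha> x)"]
          by (simp add: f_def det2_matrix det[OF x])
        also have "\<dots> \<le> 1 * norm (B n x *v direction (\<alpha> x))"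
          using nq(3) by (intro mult_right_mono) auto
        also have "\<dots> < f z"
          using N[OF nq(1)] by simp
        finally show False by simp
      qed
    qed
    have "{x \<in> space (restrict_space M S). \<alpha> x \<le> c} = S \<inter> E"
      unfolding space using iff by auto
    then show ?thesis
      using E S by (simp add: sets_restrict_space_iff)
  qed
qed

section \<open>Growth of SL(2,R) cocycles over an ergodic system\<close>

lemma cocycle_add: "cocycle T A (n + m) x = cocycle T A m ((T ^^ n) x) ** cocycle T A n x"
  by (induction m) (simp_all add: matrix_mul_assoc add.commute[of n] funpow_add)

lemma cocycle_Suc_shift: "cocycle T A (Suc n) x = cocycle T A n (T x) ** A x"
  using cocycle_add[of T A 1 n x] by simp

locale sl2_cocycle = ergodic_system M T for M :: "'a measure" and T +
  fixes A :: "'a \<Rightarrow> real^2^2" and K :: real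
  assumes A_measurable [measurable]: "A \<in> borel_measurable M"
    and det_A: "x \<in> space M \<Longrightarrow> det (A x) = 1"
    and opnorm_A: "x \<in> space M \<Longrightarrow> opnorm (A x) \<le> K"
begin

lemma K_ge_1: "1 \<le> K"
proof -
  obtain x where "x \<in> space M"
    using not_empty by auto
  then show ?thesis
    using opnorm_ge_1[OF det_A] opnorm_A by force
qed

lemma cocycle_measurable [measurable]: "cocycle T A n \<in> borel_measurable M"
proof (induction n)
  case (Suc n)
  note [measurable] = Suc
  show ?case
    by (simp add: fun_eq_iff[of "cocycle T A (Suc n)"] cong: measurable_cong) measurable
qed (simp add: cocycle.simps(1)[abs_def])

lemma det_cocycle: "x \<in> space M \<Longrightarrow> det (cocycle T A n x) = 1"
  by (induction n) (simp_all add: det_mul det_A iterate_in_space)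

lemma norm_cocycle_Suc_le:
  assumes "x \<in> space M"
  shows "norm (cocycle T A (Suc n) x *v v) \<le> K * norm (cocycle T A n x *v v)"
proof -
  have "norm (cocycle T A (Suc n) x *v v) = norm (A ((T ^^ n) x) *v (cocycle T A n x *v v))"
    by (simp add: matrix_vector_mul_assoc)
  also have "\<dots> \<le> opnorm (A ((T ^^ n) x)) * norm (cocycle T A n x *v v)"
    by (rule norm_matrix_vector_le)
  also have "\<dots> \<le> K * norm (cocycle T A n x *v v)"
    by (intro mult_right_mono opnorm_A iterate_in_space assms) auto
  finally show ?thesis .
qed

lemma opnorm_cocycle_le: "x \<in> space M \<Longrightarrow> opnorm (cocycle T A n x) \<le> K ^ n"
proof (induction n)
  case 0
  then show ?case by (auto intro!: opnorm_least)
next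
  case (Suc n)
  have "opnorm (cocycle T A (Suc n) x) \<le> opnorm (A ((T ^^ n) x)) * opnorm (cocycle T A n x)"
    by (simp add: opnorm_mult)
  also have "\<dots> \<le> K * K ^ n"
    using Suc opnorm_A[OF iterate_in_space[of x n]] K_ge_1 by (intro mult_mono opnorm_nonneg) auto
  finally show ?case by simp
qed

definition log_opnorm :: "nat \<Rightarrow> 'a \<Rightarrow> real" where
  "log_opnorm n x = ln (opnorm (cocycle T A n x))"

lemma opnorm_cocycle_ge_1: "x \<in> space M \<Longrightarrow> 1 \<le> opnorm (cocycle T A n x)"
  by (intro opnorm_ge_1 det_cocycle)

sublocale log_opnorm: subadditive_process M T log_opnorm "ln K"
proof
  show "log_opnorm n \<in> borel_measurable M" for n
    unfolding log_opnorm_def[abs_def] by measurable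
next
  fix x n assume x: "x \<in> space M"
  have "ln (opnorm (cocycle T A n x)) \<le> ln (K ^ n)"
    using opnorm_cocycle_ge_1[OF x, of n] opnorm_cocycle_le[OF x, of n] by simp
  then show "\<bar>log_opnorm n x\<bar> \<le> real n * ln K"
    using opnorm_cocycle_ge_1[OF x, of n] K_ge_1 by (simp add: log_opnorm_def ln_realpow)
next
  fix x n m assume x: "x \<in> space M"
  have "log_opnorm (n + m) x \<le> ln (opnorm (cocycle T A m ((T ^^ n) x)) * opnorm (cocycle T A n x))"
    using opnorm_cocycle_ge_1[OF x, of "n + m"] opnorm_mult[of "cocycle T A m ((T ^^ n) x)" "cocycle T A n x"]
    unfolding log_opnorm_def cocycle_add by simp
  also have "\<dots> = log_opnorm n x + log_opnorm m ((T ^^ n) x)"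
    using opnorm_cocycle_ge_1[OF x, of n] opnorm_cocycle_ge_1[OF iterate_in_space[OF x], of m n]
    by (simp add: ln_mult log_opnorm_def)
  finally show "log_opnorm (n + m) x \<le> log_opnorm n x + log_opnorm m ((T ^^ n) x)" .
qed

lemma lyapunov_eq:
  "lyapunov M T A = (INF n\<in>{1..}. (\<integral>x. log_opnorm n x \<partial>M) / real n)"
  unfolding lyapunov_def using limI[OF log_opnorm.kingman(2)] by (simp only: log_opnorm_def)

lemma lyapunov_tendsto:
  "(\<lambda>n. 1 / real n * (\<integral>x. ln (opnorm (cocycle T A n x)) \<partial>M)) \<longlonglongrightarrow> lyapunov M T A"
  using log_opnorm.kingman(2) by (simp only: lyapunov_eq log_opnorm_def)

lemma AE_lyapunov:
  "AE x in M. (\<lambda>n. ln (opnorm (cocycle T A n x)) / real n) \<longlonglongrightarrow> lyapunov M T A"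
  using log_opnorm.kingman(1) by (simp only: lyapunov_eq log_opnorm_def)

lemma lyapunov_nonneg: "0 \<le> lyapunov M T A"
proof (rule LIMSEQ_le_const[OF lyapunov_tendsto])
  have "0 \<le> (\<integral>x. ln (opnorm (cocycle T A n x)) \<partial>M)" for n
    by (rule integral_nonneg_AE) (use opnorm_cocycle_ge_1 in auto)
  then show "\<exists>N. \<forall>n\<ge>N. 0 \<le> 1 / real n * (\<integral>x. ln (opnorm (cocycle T A n x)) \<partial>M)"
    by simp
qed

lemma decaying_direction_exists:
  assumes x: "x \<in> space M" and l: "0 < l"
    and lim: "(\<lambda>n. ln (opnorm (cocycle T A n x)) / real n) \<longlonglongrightarrow> l"
  obtains \<alpha> where "\<alpha> \<in> {0..<1/2}" "decays l (\<lambda>n. cocycle T A n x) (direction \<alpha>)"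
proof -
  obtain v where v: "norm v = 1"
    "\<And>\<delta>. 0 < \<delta> \<Longrightarrow> \<exists>C>0. \<forall>n. norm (cocycle T A n x *v v) \<le> C * exp ((- l + \<delta>) * real n)"
  proof (rule contracted_direction_exists[of "\<lambda>n. cocycle T A n x" K l])
    show "\<exists>c>0. \<forall>n. c * exp ((l - \<delta>) * real n) \<le> opnorm (cocycle T A n x)"
      "\<exists>C>0. \<forall>n. opnorm (cocycle T A n x) \<le> C * exp ((l + \<delta>) * real n)" if "0 < \<delta>" for \<delta>
      using exponential_bounds[OF opnorm_cocycle_ge_1[OF x] lim that] by auto
  qed (use det_cocycle[OF x] norm_cocycle_Suc_le[OF x] l in auto)
  then have "decays l (\<lambda>n. cocycle T A n x) v"
    by (auto simp: decays_def)
  moreover obtain \<alpha> c where \<alpha>: "\<alpha> \<in> {0..<1/2}" "c \<noteq> 0" "v = c *\<^sub>R direction \<alpha>"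
    using parallel_direction_exists[of v] v(1) by (metis norm_zero zero_neq_one)
  ultimately have "decays l (\<lambda>n. cocycle T A n x) (direction \<alpha>)"
    using decays_scaleR[of l _ v "inverse c"] by simp
  then show ?thesis
    using \<alpha>(1) that by blast
qed

lemma decays_forward:
  assumes "decays l (\<lambda>n. cocycle T A n x) u" "x \<in> space M"
  shows "decays l (\<lambda>n. cocycle T A n (T x)) (A x *v u)"
  unfolding decays_def
proof (intro conjI allI impI)
  show "A x *v u \<noteq> 0"
    using sl2_nonzero_iff[OF det_A[OF assms(2)], of u] decays_nonzero[OF assms(1)] by simp
  fix \<delta> :: real assume "\<delta> > 0"
  then obtain C where C: "0 < C" "\<And>n. norm (cocycle T A n x *v u) \<le> C * exp ((- l + \<delta>) * real n)"
    using decaysE[OF assms(1)] by blast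
  have "norm (cocycle T A n (T x) *v (A x *v u)) \<le> (C * exp (- l + \<delta>)) * exp ((- l + \<delta>) * real n)" for n
  proof -
    have "cocycle T A n (T x) *v (A x *v u) = cocycle T A (Suc n) x *v u"
      by (simp only: matrix_vector_mul_assoc cocycle_Suc_shift)
    also have "norm \<dots> \<le> C * exp ((- l + \<delta>) * real (Suc n))"
      by (rule C)
    also have "(- l + \<delta>) * real (Suc n) = (- l + \<delta>) + (- l + \<delta>) * real n"
      by (simp add: algebra_simps)
    also have "C * exp ((- l + \<delta>) + (- l + \<delta>) * real n) = (C * exp (- l + \<delta>)) * exp ((- l + \<delta>) * real n)"
      by (simp only: exp_add mult.assoc)
    finally show ?thesis .
  qed
  then show "\<exists>C>0. \<forall>n. norm (cocycle T A n (T x) *v (A x *v u)) \<le> C * exp ((- l + \<delta>) * real n)"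
    using C(1) by (intro exI[of _ "C * exp (- l + \<delta>)"]) auto
qed

end

section \<open>Stable and unstable directions\<close>

lemma borel_measurable_extend_by_0:
  fixes f :: "'a \<Rightarrow> real"
  assumes "f \<in> borel_measurable (restrict_space M S)" "S \<in> sets M"
  shows "(\<lambda>x. if x \<in> S then f x else 0) \<in> borel_measurable M"
proof -
  have "{x \<in> space M. x \<in> S} = S"
    using sets.sets_into_space[OF assms(2)] by auto
  then show ?thesis
    using assms by (subst measurable_If_restrict_space_iff) auto
qed

lemma sl2_inverse_matrix_mult: "sl2_inverse (X ** Y) = sl2_inverse Y ** sl2_inverse X"
  by (simp add: matrix2_eq_iff matrix_matrix_mult_def sum_2 algebra_simps)

text \<open>Decay passes to a product with one more factor at the beginning. It moves backward decay
  along the forward orbit and forward decay along the backward orbit.\<close>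

lemma decays_prepend:
  assumes "decays l B u" "u' \<noteq> 0" "\<And>n. B' (Suc n) *v u' = B n *v u"
  shows "decays l B' u'"
  unfolding decays_def
proof (intro conjI allI impI)
  fix \<delta> :: real assume "\<delta> > 0"
  then obtain C where C: "0 < C" "\<And>n. norm (B n *v u) \<le> C * exp ((- l + \<delta>) * real n)"
    using decaysE[OF assms(1)] by blast
  \<comment> \<open>The last summand covers index 0, which the relation between the two sequences
    does not reach.\<close>
  define D where "D = C / exp (- l + \<delta>) + norm (B' 0 *v u')"
  have D: "0 < D" "C / exp (- l + \<delta>) \<le> D" "norm (B' 0 *v u') \<le> D"
    using C(1) by (auto simp: D_def intro!: add_pos_nonneg)
  have "norm (B' n *v u') \<le> D * exp ((- l + \<delta>) * real n)" for n
  proof (cases n)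
    case 0
    then show ?thesis using D by simp
  next
    case (Suc m)
    have "norm (B' n *v u') \<le> C * exp ((- l + \<delta>) * real m)"
      using C(2)[of m] assms(3)[of m] by (simp add: Suc)
    also have "\<dots> = C / exp (- l + \<delta>) * exp ((- l + \<delta>) + (- l + \<delta>) * real m)"
      by (simp only: exp_add) simp
    also have "(- l + \<delta>) + (- l + \<delta>) * real m = (- l + \<delta>) * real n"
      by (simp add: Suc algebra_simps)
    also have "C / exp (- l + \<delta>) * exp ((- l + \<delta>) * real n) \<le> D * exp ((- l + \<delta>) * real n)"
      using D by (intro mult_right_mono) auto
    finally show ?thesis .
  qed
  then show "\<exists>C>0. \<forall>n. norm (B' n *v u') \<le> C * exp ((- l + \<delta>) * real n)"
    using D(1) by blast
qed (fact assms(2))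

section \<open>The inverse cocycle and the interplay of forward and backward decay\<close>

locale invertible_sl2_cocycle = sl2_cocycle +
  assumes T_bij: "bij_betw T (space M) (space M)"
    and inv_measurable: "inv_into (space M) T \<in> M \<rightarrow>\<^sub>M M"
begin

definition T_inv :: "'a \<Rightarrow> 'a" where "T_inv = inv_into (space M) T"

definition A_inv :: "'a \<Rightarrow> real^2^2" where "A_inv x = sl2_inverse (A (T_inv x))"

lemma T_inv_measurable [measurable]: "T_inv \<in> M \<rightarrow>\<^sub>M M"
  using inv_measurable by (simp add: T_inv_def)

lemma T_inv_in_space: "x \<in> space M \<Longrightarrow> T_inv x \<in> space M"
  by (rule measurable_space[OF T_inv_measurable])

lemma T_T_inv [simp]: "x \<in> space M \<Longrightarrow> T (T_inv x) = x"
  using T_bij by (simp add: T_inv_def bij_betw_inv_into_right)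

lemma T_inv_T [simp]: "x \<in> space M \<Longrightarrow> T_inv (T x) = x"
  using T_bij by (simp add: T_inv_def bij_betw_inv_into_left)

lemma T_in_space: "x \<in> space M \<Longrightarrow> T x \<in> space M"
  by (rule measurable_space[OF T_measurable])

lemma emeasure_vimage_T_inv:
  assumes B: "B \<in> sets M"
  shows "emeasure M (T_inv -` B \<inter> space M) = emeasure M B"
proof -
  have "T -` (T_inv -` B \<inter> space M) \<inter> space M = B"
    using sets.sets_into_space[OF B] T_in_space by auto
  then show ?thesis
    using emeasure_vimage_T[of "T_inv -` B \<inter> space M"] measurable_sets[OF T_inv_measurable B] by simp
qed

sublocale inverse: sl2_cocycle M T_inv A_inv K
proof
  show "emeasure M (T_inv -` B \<inter> space M) = emeasure M B" if "B \<in> sets M" for B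
    by (rule emeasure_vimage_T_inv[OF that])
  show "emeasure M B = 0 \<or> emeasure M (space M - B) = 0"
    if B: "B \<in> sets M" and inv: "T_inv -` B \<inter> space M = B" for B
  proof (rule ergodic[OF B])
    have "T x \<in> B \<longleftrightarrow> x \<in> B" if "x \<in> space M" for x
    proof -
      have "T x \<in> B \<longleftrightarrow> T x \<in> T_inv -` B \<inter> space M"
        by (simp only: inv)
      also have "\<dots> \<longleftrightarrow> x \<in> B"
        using that T_in_space by simp
      finally show ?thesis .
    qed
    then show "T -` B \<inter> space M = B"
      using sets.sets_into_space[OF B] by auto
  qed
  show "A_inv \<in> borel_measurable M"
    unfolding A_inv_def[abs_def] by measurable
  show "det (A_inv x) = 1" if "x \<in> space M" for x
    using that by (simp add: A_inv_def det_A T_inv_in_space)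
  show "opnorm (A_inv x) \<le> K" if "x \<in> space M" for x
    using that by (simp add: A_inv_def opnorm_sl2_inverse det_A opnorm_A T_inv_in_space)
qed (rule T_inv_measurable)

abbreviation fwd :: "nat \<Rightarrow> 'a \<Rightarrow> real^2^2" where "fwd \<equiv> cocycle T A"
abbreviation bwd :: "nat \<Rightarrow> 'a \<Rightarrow> real^2^2" where "bwd \<equiv> cocycle T_inv A_inv"

lemma T_iterate_T_inv [simp]: "x \<in> space M \<Longrightarrow> (T ^^ n) ((T_inv ^^ n) x) = x"
proof (induction n arbitrary: x)
  case (Suc n)
  have "(T ^^ Suc n) ((T_inv ^^ Suc n) x) = T ((T ^^ n) ((T_inv ^^ n) (T_inv x)))"
    by (simp only: funpow.simps(2) funpow_Suc_right comp_def)
       (simp add: funpow_swap1)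
  then show ?case
    using Suc.IH[of "T_inv x"] T_inv_in_space Suc.prems by simp
qed simp

lemma T_inv_iterate_T [simp]: "x \<in> space M \<Longrightarrow> (T_inv ^^ n) ((T ^^ n) x) = x"
proof (induction n arbitrary: x)
  case (Suc n)
  have "(T_inv ^^ Suc n) ((T ^^ Suc n) x) = T_inv ((T_inv ^^ n) ((T ^^ n) (T x)))"
    by (simp only: funpow.simps(2) funpow_Suc_right comp_def)
       (simp add: funpow_swap1)
  then show ?case
    using Suc.IH[of "T x"] T_in_space Suc.prems by simp
qed simp

lemma bwd_eq: "x \<in> space M \<Longrightarrow> bwd n x = sl2_inverse (fwd n ((T_inv ^^ n) x))"
proof (induction n arbitrary: x)
  case 0
  then show ?case by (simp add: matrix2_eq_iff mat_def)
next
  case (Suc n)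
  have x: "(T_inv ^^ n) x \<in> space M"
    using Suc.prems by (rule inverse.iterate_in_space)
  have "fwd (Suc n) ((T_inv ^^ Suc n) x) = fwd n ((T_inv ^^ n) x) ** A (T_inv ((T_inv ^^ n) x))"
    using x by (simp only: cocycle_Suc_shift) simp
  then show ?case
    using Suc by (simp add: sl2_inverse_matrix_mult A_inv_def)
qed

text \<open>Inversion in SL(2,R) preserves the operator norm, and invariance of the measure absorbs
  the shift of the base point.\<close>

lemma lyapunov_inverse: "lyapunov M T_inv A_inv = lyapunov M T A"
proof -
  have "(\<integral>x. ln (opnorm (bwd n x)) \<partial>M) = (\<integral>x. ln (opnorm (fwd n x)) \<partial>M)" for n
  proof -
    have "(\<integral>x. ln (opnorm (bwd n x)) \<partial>M) = (\<integral>x. ln (opnorm (fwd n ((T_inv ^^ n) x))) \<partial>M)"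
      by (rule Bochner_Integration.integral_cong)
        (simp_all add: bwd_eq opnorm_sl2_inverse det_cocycle inverse.iterate_in_space)
    also have "\<dots> = (\<integral>x. ln (opnorm (fwd n x)) \<partial>M)"
      by (rule inverse.integral_iterate) measurable
    finally show ?thesis .
  qed
  then show ?thesis
    by (simp add: lyapunov_def)
qed

lemma fwd_bwd_cancel: "x \<in> space M \<Longrightarrow> fwd n ((T_inv ^^ n) x) *v (bwd n x *v u) = u"
  by (simp add: bwd_eq det_cocycle inverse.iterate_in_space)

lemma bwd_Suc_T: "x \<in> space M \<Longrightarrow> bwd (Suc n) (T x) *v (A x *v u) = bwd n x *v u"
  by (simp only: cocycle_Suc_shift matrix_vector_mul_assoc[symmetric])
    (simp add: A_inv_def det_A)

lemma fwd_Suc_T_inv: "x \<in> space M \<Longrightarrow> fwd (Suc n) (T_inv x) *v (A_inv x *v u) = fwd n x *v u"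
  by (simp only: cocycle_Suc_shift matrix_vector_mul_assoc[symmetric])
    (simp add: A_inv_def det_A T_inv_in_space)

lemma decays_bwd_fwd_step:
  assumes "decays l (\<lambda>n. bwd n x) u" "x \<in> space M"
  shows "decays l (\<lambda>n. bwd n (T x)) (A x *v u)"
  by (rule decays_prepend[OF assms(1)])
    (use assms decays_nonzero[OF assms(1)] in \<open>auto simp: bwd_Suc_T sl2_nonzero_iff det_A simp del: cocycle.simps\<close>)

lemma decays_bwd_fwd:
  assumes "decays l (\<lambda>n. bwd n x) u" "x \<in> space M"
  shows "decays l (\<lambda>n. bwd n ((T ^^ m) x)) (fwd m x *v u)"
proof (induction m)
  case (Suc m)
  then show ?case
    using decays_bwd_fwd_step[OF Suc iterate_in_space[OF assms(2)]] by (simp add: matrix_vector_mul_assoc)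
qed (use assms in simp)

lemma decays_fwd_bwd:
  assumes "decays l (\<lambda>n. fwd n x) u" "x \<in> space M"
  shows "decays l (\<lambda>n. fwd n ((T_inv ^^ m) x)) (bwd m x *v u)"
proof (induction m)
  case (Suc m)
  define y where "y = (T_inv ^^ m) x"
  have y: "y \<in> space M"
    using assms(2) by (simp add: y_def inverse.iterate_in_space)
  have "decays l (\<lambda>n. fwd n (T_inv y)) (A_inv y *v (bwd m x *v u))"
    by (rule decays_prepend[OF Suc[folded y_def]])
      (use y decays_nonzero[OF Suc] in \<open>auto simp: fwd_Suc_T_inv sl2_nonzero_iff inverse.det_A simp del: cocycle.simps\<close>)
  then show ?case
    by (simp add: matrix_vector_mul_assoc y_def)
qed (use assms in simp)

lemma decays_bwd_bwd:
  assumes "decays l (\<lambda>n. bwd n x) u" "x \<in> space M"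
  shows "decays l (\<lambda>n. bwd n ((T_inv ^^ m) x)) (bwd m x *v u)"
proof (induction m)
  case (Suc m)
  then show ?case
    using inverse.decays_forward[OF Suc inverse.iterate_in_space[OF assms(2)]]
    by (simp add: matrix_vector_mul_assoc)
qed (use assms in simp)

text \<open>Discarding the points whose full two-sided orbit meets the exceptional null set leaves
  an invariant set. All almost-everywhere statements become pointwise ones inside the prescribed set
  in this way.\<close>

lemma invariant_full_set_exists:
  assumes S: "invariant_full_set M T S" and P: "AE x in M. P x"
  obtains S' where "S' \<subseteq> S" "invariant_full_set M T S'" "\<And>x. x \<in> S' \<Longrightarrow> P x"
proof -
  obtain N where N: "{x \<in> space M. \<not> P x} \<subseteq> N" "N \<in> null_sets M"
    using AE_E[OF P] by (metis (no_types, lifting) null_setsI)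
  have [measurable]: "N \<in> sets M" "S \<in> sets M"
    using N S by (auto simp: invariant_full_set_def)
  have TS: "T ` S = S" and S_full: "emeasure M S = emeasure M (space M)"
    using S by (auto simp: invariant_full_set_def)
  have S_space: "S \<subseteq> space M"
    by (rule sets.sets_into_space) measurable
  define S' where "S' = {x \<in> space M. x \<in> S \<and> (\<forall>n. (T ^^ n) x \<notin> N) \<and> (\<forall>n. (T_inv ^^ n) x \<notin> N)}"
  have S'_sets: "S' \<in> sets M"
    unfolding S'_def by measurable
  have AE_S: "AE x in M. x \<in> S"
    using S_full by (intro AE_prob_1) (simp add: measure_def prob_space emeasure_space_1)
  have AE_N: "AE x in M. x \<notin> N"
    using N(2) by (rule AE_not_in)
  have "AE x in M. \<forall>n. (T ^^ n) x \<notin> N" "AE x in M. \<forall>n. (T_inv ^^ n) x \<notin> N"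
    unfolding AE_all_countable using AE_iterate[OF AE_N] inverse.AE_iterate[OF AE_N] by auto
  with AE_S AE_space have "AE x in M. x \<in> S'"
    by eventually_elim (auto simp: S'_def)
  then have full: "emeasure M S' = emeasure M (space M)"
    using S'_sets by (intro emeasure_eq_AE) auto
  have T_S': "T x \<in> S'" if "x \<in> S'" for x
  proof -
    have x: "x \<in> space M" "x \<in> S" "\<And>n. (T ^^ n) x \<notin> N" "\<And>n. (T_inv ^^ n) x \<notin> N"
      using that by (auto simp: S'_def)
    have "(T ^^ n) (T x) \<notin> N" for n
      using x(3)[of "Suc n"] by (simp add: funpow_swap1)
    moreover have "(T_inv ^^ n) (T x) \<notin> N" for n
    proof (cases n)
      case 0
      then show ?thesis using x(3)[of 1] by simp
    next
      case (Suc k)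
      then show ?thesis
        using x(1) x(4)[of k] by (simp only: funpow_Suc_right comp_def T_inv_T) simp
    qed
    ultimately show ?thesis
      using x(1,2) TS T_in_space by (auto simp: S'_def)
  qed
  have T_inv_S': "T_inv x \<in> S'" if "x \<in> S'" for x
  proof -
    have x: "x \<in> space M" "x \<in> S" "\<And>n. (T ^^ n) x \<notin> N" "\<And>n. (T_inv ^^ n) x \<notin> N"
      using that by (auto simp: S'_def)
    have "(T_inv ^^ n) (T_inv x) \<notin> N" for n
      using x(4)[of "Suc n"] by (simp add: funpow_swap1)
    moreover have "(T ^^ n) (T_inv x) \<notin> N" for n
    proof (cases n)
      case 0
      then show ?thesis using x(4)[of 1] by simp
    next
      case (Suc k)
      then show ?thesis
        using x(1) x(3)[of k] by (simp only: funpow_Suc_right comp_def T_T_inv) simp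
    qed
    moreover have "T_inv x \<in> S"
    proof -
      have "x \<in> T ` S"
        using x(2) by (simp only: TS)
      then obtain y where "y \<in> S" "x = T y" by blast
      then show ?thesis
        using S_space by auto
    qed
    ultimately show ?thesis
      using x(1) T_inv_in_space by (auto simp: S'_def)
  qed
  have "T ` S' = S'"
  proof
    show "T ` S' \<subseteq> S'"
      using T_S' by blast
    show "S' \<subseteq> T ` S'"
    proof
      fix x assume x: "x \<in> S'"
      then have "x = T (T_inv x)"
        by (simp add: S'_def)
      then show "x \<in> T ` S'"
        using T_inv_S'[OF x] by blast
    qed
  qed
  then have "invariant_full_set M T S'"
    using S'_sets full by (simp add: invariant_full_set_def)
  moreover have "P x" if "x \<in> S'" for x
  proof -
    have "(T ^^ 0) x \<notin> N"
      using that unfolding S'_def by blast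
    then show ?thesis
      using that N(1) by (auto simp: S'_def)
  qed
  ultimately show ?thesis
    using that[of S'] by (auto simp: S'_def)
qed

lemma invariant_full_set_iterate:
  assumes "invariant_full_set M T S" "x \<in> S"
  shows "x \<in> space M" "(T ^^ n) x \<in> S" "(T_inv ^^ n) x \<in> S"
proof -
  have S: "S \<in> sets M" "T ` S = S"
    using assms by (auto simp: invariant_full_set_def)
  have sub: "S \<subseteq> space M"
    by (rule sets.sets_into_space[OF S(1)])
  then show "x \<in> space M" using assms by auto
  show "(T ^^ n) x \<in> S"
  proof (induction n)
    case (Suc n)
    then have "T ((T ^^ n) x) \<in> T ` S" by blast
    then show ?case by (simp add: S(2))
  qed (use assms(2) in simp)
  have "T_inv y \<in> S" if "y \<in> S" for y
  proof -
    have "y \<in> T ` S"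
      using that by (simp only: S(2))
    then obtain z where "z \<in> S" "y = T z" by blast
    then show ?thesis using sub by auto
  qed
  then show "(T_inv ^^ n) x \<in> S"
    using assms(2) by (induction n) auto
qed

text \<open>On the coincidence set the forward norms over \<open>n\<close> steps tend to 0 when
  started at \<open>x\<close>. Started at \<open>(T_inv ^^ n) x\<close> they are reciprocals of
  decaying backward norms and tend to infinity. The measure does not see the shift of the starting
  point, so the set is null.\<close>

lemma stable_ne_unstable:
  assumes l: "0 < l" and S: "invariant_full_set M T S"
    and [measurable]: "\<alpha>\<^sub>s \<in> borel_measurable M" "\<alpha>\<^sub>u \<in> borel_measurable M"
    and range: "\<And>x. x \<in> S \<Longrightarrow> \<alpha>\<^sub>s x \<in> {0..<1/2}" "\<And>x. x \<in> S \<Longrightarrow> \<alpha>\<^sub>u x \<in> {0..<1/2}"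
    and stable: "\<And>x. x \<in> S \<Longrightarrow> decays l (\<lambda>n. fwd n x) (direction (\<alpha>\<^sub>s x))"
    and unstable: "\<And>x. x \<in> S \<Longrightarrow> decays l (\<lambda>n. bwd n x) (direction (\<alpha>\<^sub>u x))"
  shows "AE x in M. \<alpha>\<^sub>s x \<noteq> \<alpha>\<^sub>u x"
proof -
  have [measurable]: "S \<in> sets M"
    using S by (simp add: invariant_full_set_def)
  define B where "B = {x \<in> space M. x \<in> S \<and> \<alpha>\<^sub>s x = \<alpha>\<^sub>u x}"
  have [measurable]: "B \<in> sets M"
    unfolding B_def by measurable
  \<comment> \<open>The truncation at 1 makes dominated convergence available and still records
    unbounded growth as the value 1.\<close>
  define X where "X n x = indicator B x * min 1 (norm (fwd n x *v direction (\<alpha>\<^sub>s x)))" for n x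
  have X [measurable]: "X n \<in> borel_measurable M" for n
    unfolding X_def by measurable
  have X01: "0 \<le> X n x" "X n x \<le> 1" for n x
    by (auto simp: X_def indicator_def)
  have X_le: "X n x \<le> norm (fwd n x *v direction (\<alpha>\<^sub>s x))" for n x
    by (auto simp: X_def indicator_def)
  have X_lim: "(\<lambda>n. X n x) \<longlonglongrightarrow> 0" for x
  proof (cases "x \<in> B")
    case True
    then have "x \<in> S"
      by (simp add: B_def)
    show ?thesis
      by (rule tendsto_sandwich[OF _ _ tendsto_const decays_tendsto_0[OF stable[OF \<open>x \<in> S\<close>] l]])
        (use X01 X_le in \<open>auto intro!: always_eventually\<close>)
  qed (simp add: X_def)
  have intX: "(\<lambda>n. \<integral>x. X n x \<partial>M) \<longlonglongrightarrow> (\<integral>x. 0 \<partial>M)"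
    by (rule integral_dominated_convergence[where w = "\<lambda>_. 1"]) (use X_lim X01 in auto)
  \<comment> \<open>The same quantity started \<open>n\<close> steps earlier. Its integral is at
    most that of \<open>X n\<close>, yet on \<open>B\<close> it tends to 1.\<close>
  define Z where "Z n x = indicator B x * X n ((T_inv ^^ n) x)" for n x
  have Z [measurable]: "Z n \<in> borel_measurable M" for n
    unfolding Z_def by measurable
  have Z_lim: "(\<lambda>n. Z n x) \<longlonglongrightarrow> indicator B x" for x
  proof (cases "x \<in> B")
    case True
    define u where "u = direction (\<alpha>\<^sub>s x)"
    have x: "x \<in> S" "x \<in> space M" and eq: "\<alpha>\<^sub>s x = \<alpha>\<^sub>u x"
      using True by (auto simp: B_def)
    have Z_eq: "Z n x = min 1 (inverse (norm (bwd n x *v u)))" for n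
    proof -
      define y where "y = (T_inv ^^ n) x"
      have y: "y \<in> S" "y \<in> space M"
        using invariant_full_set_iterate[OF S x(1)] inverse.iterate_in_space[OF x(2)] by (auto simp: y_def)
      define w where "w = bwd n x *v u"
      have fw: "decays l (\<lambda>n. fwd n y) w"
        using decays_fwd_bwd[OF stable[OF x(1)] x(2)] by (simp add: y_def w_def u_def)
      have bw: "decays l (\<lambda>n. bwd n y) w"
        using decays_bwd_bwd[OF unstable[OF x(1)] x(2)] eq by (simp add: y_def w_def u_def)
      have w0: "w \<noteq> 0"
        by (rule decays_nonzero[OF fw])
      obtain c where c: "direction (\<alpha>\<^sub>s y) = c *\<^sub>R w"
        using det2_eq_0_imp_parallel[OF decays_parallel[OF det_cocycle[OF y(2)] fw stable[OF y(1)] l] w0] .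
      obtain c' where c': "direction (\<alpha>\<^sub>u y) = c' *\<^sub>R w"
        using det2_eq_0_imp_parallel[OF decays_parallel[OF inverse.det_cocycle[OF y(2)] bw unstable[OF y(1)] l] w0] .
      have "det2 (direction (\<alpha>\<^sub>s y)) (direction (\<alpha>\<^sub>u y)) = 0"
        by (simp add: c c')
      then have "\<alpha>\<^sub>s y = \<alpha>\<^sub>u y"
        using det2_direction_eq_0_iff range y(1) by simp
      then have yB: "y \<in> B"
        using y by (simp add: B_def)
      have "\<bar>c\<bar> * norm w = 1"
        using c norm_direction[of "\<alpha>\<^sub>s y"] by simp
      then have "\<bar>c\<bar> = inverse (norm w)"
        using w0 by (simp add: field_simps)
      moreover have "fwd n y *v direction (\<alpha>\<^sub>s y) = c *\<^sub>R u"
        unfolding c using fwd_bwd_cancel[OF x(2), of n u] by (simp add: w_def y_def matrix_vector_mult_scaleR)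
      then have "norm (fwd n y *v direction (\<alpha>\<^sub>s y)) = \<bar>c\<bar>"
        by (simp add: u_def)
      ultimately show ?thesis
        using True yB by (simp add: Z_def X_def y_def w_def)
    qed
    have "filterlim (\<lambda>n. inverse (norm (bwd n x *v u))) at_top sequentially"
    proof (rule filterlim_inverse_at_top)
      show "(\<lambda>n. norm (bwd n x *v u)) \<longlonglongrightarrow> 0"
        using decays_tendsto_0[OF unstable[OF x(1)] l] eq by (simp add: u_def)
      show "eventually (\<lambda>n. 0 < norm (bwd n x *v u)) sequentially"
        using sl2_nonzero_iff[OF inverse.det_cocycle[OF x(2)]] by (simp add: u_def)
    qed
    then have "eventually (\<lambda>n. 1 \<le> inverse (norm (bwd n x *v u))) sequentially"
      by (simp add: filterlim_at_top)
    then have "eventually (\<lambda>n. Z n x = 1) sequentially"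
      by eventually_elim (simp add: Z_eq)
    then show ?thesis
      using True by (simp add: tendsto_eventually)
  qed (simp add: Z_def)
  have "(\<lambda>n. \<integral>x. Z n x \<partial>M) \<longlonglongrightarrow> (\<integral>x. indicator B x \<partial>M)"
    by (rule integral_dominated_convergence[where w = "\<lambda>_. 1"])
      (use Z_lim X01 in \<open>auto simp: Z_def indicator_def\<close>)
  moreover have "(\<integral>x. Z n x \<partial>M) \<le> (\<integral>x. X n x \<partial>M)" for n
  proof -
    have "(\<integral>x. Z n x \<partial>M) \<le> (\<integral>x. X n ((T_inv ^^ n) x) \<partial>M)"
      by (intro integral_mono integrable_const_bound[of _ 1])
        (use X01 in \<open>auto simp: Z_def indicator_def\<close>)
    also have "\<dots> = (\<integral>x. X n x \<partial>M)"
      by (rule inverse.integral_iterate) measurable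
    finally show ?thesis .
  qed
  ultimately have "(\<integral>x. indicator B x \<partial>M) \<le> (\<integral>x. (0::real) \<partial>M)"
    using intX by (intro LIMSEQ_le[OF _ intX]) auto
  then have "measure M B = 0"
    by (simp add: measure_le_0_iff)
  then have "AE x in M. x \<notin> B"
    by (intro AE_not_in) (auto simp: null_sets_def emeasure_eq_measure)
  moreover have "AE x in M. x \<in> S"
    using S by (intro AE_prob_1) (simp add: measure_def invariant_full_set_def emeasure_space_1)
  ultimately show ?thesis
    using AE_space by eventually_elim (auto simp: B_def)
qed

theorem hyperbolic_splitting:
  assumes l: "l = lyapunov M T A" "0 < l" and S: "invariant_full_set M T S"
  obtains S' \<alpha>\<^sub>s \<alpha>\<^sub>u where "S' \<subseteq> S" "invariant_full_set M T S'"
    "\<alpha>\<^sub>s \<in> borel_measurable M" "\<alpha>\<^sub>u \<in> borel_measurable M"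
    "\<And>x. \<alpha>\<^sub>s x \<in> {0..<1/2}" "\<And>x. \<alpha>\<^sub>u x \<in> {0..<1/2}"
    "\<And>x. x \<in> S' \<Longrightarrow> decays l (\<lambda>n. fwd n x) (direction (\<alpha>\<^sub>s x))"
    "\<And>x. x \<in> S' \<Longrightarrow> decays l (\<lambda>n. bwd n x) (direction (\<alpha>\<^sub>u x))"
    "\<And>x. x \<in> S' \<Longrightarrow> \<alpha>\<^sub>s x \<noteq> \<alpha>\<^sub>u x"
proof -
  have "AE x in M. (\<lambda>n. ln (opnorm (fwd n x)) / real n) \<longlonglongrightarrow> l \<and> (\<lambda>n. ln (opnorm (bwd n x)) / real n) \<longlonglongrightarrow> l"
    using AE_lyapunov inverse.AE_lyapunov unfolding lyapunov_inverse l(1)[symmetric] by eventually_elim auto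
  then obtain S1 where S1: "S1 \<subseteq> S" "invariant_full_set M T S1"
    and lim: "\<And>x. x \<in> S1 \<Longrightarrow> (\<lambda>n. ln (opnorm (fwd n x)) / real n) \<longlonglongrightarrow> l \<and> (\<lambda>n. ln (opnorm (bwd n x)) / real n) \<longlonglongrightarrow> l"
    using invariant_full_set_exists[OF S] by blast
  have S1_sets: "S1 \<in> sets M" and S1_space: "\<And>x. x \<in> S1 \<Longrightarrow> x \<in> space M"
    using S1(2) invariant_full_set_iterate(1)[OF S1(2)] by (auto simp: invariant_full_set_def)
  have "\<forall>x\<in>S1. \<exists>\<alpha>. \<alpha> \<in> {0..<1/2} \<and> decays l (\<lambda>n. fwd n x) (direction \<alpha>)"
    using decaying_direction_exists[OF S1_space l(2)] lim by metis
  then obtain as where as: "\<And>x. x \<in> S1 \<Longrightarrow> as x \<in> {0..<1/2}"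
    "\<And>x. x \<in> S1 \<Longrightarrow> decays l (\<lambda>n. fwd n x) (direction (as x))"
    by metis
  have "\<forall>x\<in>S1. \<exists>\<alpha>. \<alpha> \<in> {0..<1/2} \<and> decays l (\<lambda>n. bwd n x) (direction \<alpha>)"
    using inverse.decaying_direction_exists[OF S1_space l(2)] lim by metis
  then obtain au where au: "\<And>x. x \<in> S1 \<Longrightarrow> au x \<in> {0..<1/2}"
    "\<And>x. x \<in> S1 \<Longrightarrow> decays l (\<lambda>n. bwd n x) (direction (au x))"
    by metis
  \<comment> \<open>Outside \<open>S1\<close> the value 0 still lies in the half-open range, so the
    angles are measurable and correctly bounded everywhere.\<close>
  define \<alpha>\<^sub>s where "\<alpha>\<^sub>s x = (if x \<in> S1 then as x else 0)" for x
  define \<alpha>\<^sub>u where "\<alpha>\<^sub>u x = (if x \<in> S1 then au x else 0)" for x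
  have "as \<in> borel_measurable (restrict_space M S1)"
    by (rule decaying_angle_measurable[OF cocycle_measurable S1_sets l(2) det_cocycle[OF S1_space] as])
  moreover have "au \<in> borel_measurable (restrict_space M S1)"
    by (rule decaying_angle_measurable[OF inverse.cocycle_measurable S1_sets l(2)
        inverse.det_cocycle[OF S1_space] au])
  ultimately have meas: "\<alpha>\<^sub>s \<in> borel_measurable M" "\<alpha>\<^sub>u \<in> borel_measurable M"
    unfolding \<alpha>\<^sub>s_def[abs_def] \<alpha>\<^sub>u_def[abs_def] by (auto intro: borel_measurable_extend_by_0 S1_sets)
  have "AE x in M. \<alpha>\<^sub>s x \<noteq> \<alpha>\<^sub>u x"
    by (rule stable_ne_unstable[OF l(2) S1(2) meas]) (use as au in \<open>auto simp: \<alpha>\<^sub>s_def \<alpha>\<^sub>u_def\<close>)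
  then obtain S' where S': "S' \<subseteq> S1" "invariant_full_set M T S'" "\<And>x. x \<in> S' \<Longrightarrow> \<alpha>\<^sub>s x \<noteq> \<alpha>\<^sub>u x"
    using invariant_full_set_exists[OF S1(2)] by blast
  show ?thesis
  proof (rule that[of S' \<alpha>\<^sub>s \<alpha>\<^sub>u])
    show "\<alpha>\<^sub>s x \<in> {0..<1/2}" "\<alpha>\<^sub>u x \<in> {0..<1/2}" for x
      using as(1)[of x] au(1)[of x] by (auto simp: \<alpha>\<^sub>s_def \<alpha>\<^sub>u_def)
    show "decays l (\<lambda>n. fwd n x) (direction (\<alpha>\<^sub>s x))" "decays l (\<lambda>n. bwd n x) (direction (\<alpha>\<^sub>u x))" if "x \<in> S'" for x
      using as(2)[of x] au(2)[of x] that S'(1) by (auto simp: \<alpha>\<^sub>s_def \<alpha>\<^sub>u_def)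
  qed (use S' S1(1) meas in auto)
qed

end

section \<open>The radius of the attractor\<close>

lemma fibre_map_polar:
  assumes "0 < \<rho>" "w \<noteq> 0"
  shows "fibre_map h A \<beta> x (\<rho> *\<^sub>R (w /\<^sub>R norm w)) = (h (\<beta> * \<rho>) / norm w) *\<^sub>R (A x *v w)"
proof -
  define v where "v = \<rho> *\<^sub>R (w /\<^sub>R norm w)"
  have v: "norm v = \<rho>" "v \<noteq> 0"
    using assms by (simp_all add: v_def)
  moreover have "v /\<^sub>R norm v = w /\<^sub>R norm w"
    unfolding v(1) using assms by (simp add: v_def)
  ultimately show ?thesis
    unfolding v_def[symmetric]
    by (simp add: fibre_map_def matrix_vector_mult_scaleR divide_inverse)
qed

lemma fibre_iter_0: "fibre_iter T h A \<beta> n x 0 = 0"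
  by (induction n) (simp_all add: fibre_map_def)

locale concave_skew_product = invertible_sl2_cocycle M T A K + concave_response h
  for M :: "'a measure" and T :: "'a \<Rightarrow> 'a" and A :: "'a \<Rightarrow> real^2^2" and K :: real
    and h :: "real \<Rightarrow> real" +
  assumes h_mult_K: "0 \<le> u \<Longrightarrow> h u * K \<le> 1"
begin

definition radius :: "real \<Rightarrow> 'a \<Rightarrow> real^2 \<Rightarrow> real" where
  "radius \<beta> x u = limit_radius \<beta> (\<lambda>k. norm (bwd k x *v u))"

lemma fwd_pos: "x \<in> space M \<Longrightarrow> v \<noteq> 0 \<Longrightarrow> 0 < norm (fwd n x *v v)"
  by (simp add: sl2_nonzero_iff det_cocycle)

lemma bwd_pos: "x \<in> space M \<Longrightarrow> v \<noteq> 0 \<Longrightarrow> 0 < norm (bwd n x *v v)"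
  by (simp add: sl2_nonzero_iff inverse.det_cocycle)

lemma response_ratio_le:
  assumes "0 \<le> u" "0 < b" "a \<le> K * b"
  shows "h u * (a / b) \<le> 1"
proof -
  have "h u * (a / b) \<le> h u * K"
    using assms by (intro mult_left_mono h_nonneg) (auto simp: divide_le_eq)
  then show ?thesis
    using h_mult_K[OF assms(1)] by simp
qed

lemma response_fwd_le:
  assumes "x \<in> space M" "v \<noteq> 0" "0 \<le> u"
  shows "h u * (norm (fwd (Suc n) x *v v) / norm (fwd n x *v v)) \<le> 1"
  by (rule response_ratio_le[OF assms(3) fwd_pos norm_cocycle_Suc_le]) (use assms in auto)

lemma admissible_bwd:
  assumes x: "x \<in> space M" and u: "u \<noteq> 0"
  shows "admissible (\<lambda>k. norm (bwd k x *v u))"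
  unfolding admissible_def
proof (intro conjI allI impI)
  fix n and s :: real assume s: "0 \<le> s"
  define y where "y = (T_inv ^^ n) x"
  define w where "w = bwd n x *v u"
  have y: "y \<in> space M" "T_inv y \<in> space M"
    using inverse.iterate_in_space[OF x] T_inv_in_space by (auto simp: y_def)
  have eq: "bwd (Suc n) x *v u = A_inv y *v w"
    by (simp add: y_def w_def matrix_vector_mul_assoc)
  have "norm w = norm (A (T_inv y) *v (A_inv y *v w))"
    using y by (simp add: A_inv_def det_A)
  also have "\<dots> \<le> opnorm (A (T_inv y)) * norm (A_inv y *v w)"
    by (rule norm_matrix_vector_le)
  also have "\<dots> \<le> K * norm (A_inv y *v w)"
    using opnorm_A[OF y(2)] by (intro mult_right_mono) auto
  finally have "norm (bwd n x *v u) \<le> K * norm (bwd (Suc n) x *v u)"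
    unfolding eq w_def .
  then show "h s * (norm (bwd n x *v u) / norm (bwd (Suc n) x *v u)) \<le> 1"
    by (rule response_ratio_le[OF s bwd_pos[OF x u]])
qed (rule bwd_pos[OF x u])

lemma fibre_iter_polar:
  assumes x: "x \<in> space M" and v: "v \<noteq> 0" and \<beta>: "0 < \<beta>"
  shows "0 < norm (fibre_iter T h A \<beta> n x v)"
    and "fibre_iter T h A \<beta> n x v =
      norm (fibre_iter T h A \<beta> n x v) *\<^sub>R ((fwd n x *v v) /\<^sub>R norm (fwd n x *v v))"
    and "fibre_iter T h A \<beta> (Suc n) x v =
      (h (\<beta> * norm (fibre_iter T h A \<beta> n x v)) / norm (fwd n x *v v)) *\<^sub>R (fwd (Suc n) x *v v)"
proof -
  have step: "fibre_iter T h A \<beta> (Suc n) x v =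
      (h (\<beta> * norm (fibre_iter T h A \<beta> n x v)) / norm (fwd n x *v v)) *\<^sub>R (fwd (Suc n) x *v v)"
    if pos: "0 < norm (fibre_iter T h A \<beta> n x v)"
      and polar: "fibre_iter T h A \<beta> n x v =
      norm (fibre_iter T h A \<beta> n x v) *\<^sub>R ((fwd n x *v v) /\<^sub>R norm (fwd n x *v v))" for n
  proof -
    have "fibre_iter T h A \<beta> (Suc n) x v = fibre_map h A \<beta> ((T ^^ n) x)
        (norm (fibre_iter T h A \<beta> n x v) *\<^sub>R ((fwd n x *v v) /\<^sub>R norm (fwd n x *v v)))"
      by (rule arg_cong[OF polar, of "fibre_map h A \<beta> ((T ^^ n) x)", folded fibre_iter.simps(2)])
    also have "\<dots> = (h (\<beta> * norm (fibre_iter T h A \<beta> n x v)) / norm (fwd n x *v v)) *\<^sub>R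
        (A ((T ^^ n) x) *v (fwd n x *v v))"
      using pos fwd_pos[OF x v, of n] by (intro fibre_map_polar) auto
    finally show ?thesis
      by (simp only: cocycle.simps matrix_vector_mul_assoc)
  qed
  have both: "0 < norm (fibre_iter T h A \<beta> n x v) \<and> fibre_iter T h A \<beta> n x v =
      norm (fibre_iter T h A \<beta> n x v) *\<^sub>R ((fwd n x *v v) /\<^sub>R norm (fwd n x *v v))" for n
  proof (induction n)
    case 0
    then show ?case using v by simp
  next
    case (Suc n)
    define a where "a = h (\<beta> * norm (fibre_iter T h A \<beta> n x v)) / norm (fwd n x *v v)"
    have a: "0 < a"
      using conjunct1[OF Suc] \<beta> fwd_pos[OF x v, of n] by (simp add: a_def h_pos)
    have eq: "fibre_iter T h A \<beta> (Suc n) x v = a *\<^sub>R (fwd (Suc n) x *v v)"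
      unfolding a_def by (rule step[OF conjunct1[OF Suc] conjunct2[OF Suc]])
    show ?case
      unfolding eq norm_scaleR using a fwd_pos[OF x v, of "Suc n"] by (simp del: cocycle.simps)
  qed
  then show "0 < norm (fibre_iter T h A \<beta> n x v)"
    and "fibre_iter T h A \<beta> n x v =
      norm (fibre_iter T h A \<beta> n x v) *\<^sub>R ((fwd n x *v v) /\<^sub>R norm (fwd n x *v v))"
    by blast+
  show "fibre_iter T h A \<beta> (Suc n) x v =
      (h (\<beta> * norm (fibre_iter T h A \<beta> n x v)) / norm (fwd n x *v v)) *\<^sub>R (fwd (Suc n) x *v v)"
    by (rule step) (use both in blast)+
qed

lemma fibre_iter_orbit:
  assumes x: "x \<in> space M" and v: "v \<noteq> 0" and \<beta>: "0 < \<beta>"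
  shows "response_orbit \<beta> (\<lambda>n. norm (fwd n x *v v)) (\<lambda>n. norm (fibre_iter T h A \<beta> n x v))"
  unfolding response_orbit_def
proof (intro conjI allI)
  show "norm (fibre_iter T h A \<beta> (Suc n) x v) = h (\<beta> * norm (fibre_iter T h A \<beta> n x v)) *
      (norm (fwd (Suc n) x *v v) / norm (fwd n x *v v))" for n
    unfolding fibre_iter_polar(3)[OF assms]
    using fibre_iter_polar(1)[OF assms, of n] \<beta> by (simp add: h_nonneg)
qed (use fwd_pos[OF x v] v in auto)

lemma norm_fibre_iter_le_1:
  assumes x: "x \<in> space M" and \<beta>: "0 < \<beta>"
  shows "norm (fibre_iter T h A \<beta> (Suc n) x v) \<le> 1"
proof (cases "v = 0")
  case True
  then show ?thesis by (simp only: fibre_iter_0) simp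
next
  case False
  show ?thesis
    unfolding response_orbitD(2)[OF fibre_iter_orbit[OF x False \<beta>]]
    by (rule response_fwd_le[OF x False]) (use \<beta> in auto)
qed

text \<open>The induction peels off the last fibre map, for which the preimage of \<open>y\<close>
  lies on the ray of \<open>A_inv x *v y\<close>. On one ray everything is scalar: monotonicity of
  \<open>h\<close> gives necessity, and the intermediate value theorem gives sufficiency.\<close>

lemma fibre_iter_ball_iff:
  assumes \<beta>: "0 < \<beta>"
  shows "x \<in> space M \<Longrightarrow> y \<noteq> 0 \<Longrightarrow>
    (\<exists>w\<in>cball 0 1. fibre_iter T h A \<beta> n ((T_inv ^^ n) x) w = y) \<longleftrightarrow>
    norm y \<le> pullback_radius \<beta> n (\<lambda>k. norm (bwd k x *v y))"
proof (induction n arbitrary: x y)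
  case 0
  then show ?case by (auto simp: dist_norm)
next
  case (Suc n)
  note x = Suc.prems(1) and y = Suc.prems(2)
  define x' where "x' = T_inv x"
  have x': "x' \<in> space M"
    using x T_inv_in_space by (simp add: x'_def)
  define z where "z = A_inv x *v y"
  have z: "z \<noteq> 0"
    using y x by (simp add: z_def sl2_nonzero_iff inverse.det_A)
  have Az: "A x' *v z = y"
    using x x' by (simp add: z_def A_inv_def x'_def det_A)
  define R where "R = pullback_radius \<beta> n (\<lambda>k. norm (bwd k x' *v z))"
  have R: "0 < R"
    unfolding R_def by (rule pullback_radius_pos[OF admissible_bwd[OF x' z] \<beta>])
  have "bwd (Suc k) x *v y = bwd k x' *v z" for k
    by (simp only: cocycle_Suc_shift matrix_vector_mul_assoc x'_def z_def)
  then have pull: "pullback_radius \<beta> (Suc n) (\<lambda>k. norm (bwd k x *v y)) = h (\<beta> * R) * (norm y / norm z)"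
    by (simp add: R_def del: cocycle.simps(2))
  have iter: "fibre_iter T h A \<beta> (Suc n) ((T_inv ^^ Suc n) x) w =
      fibre_map h A \<beta> x' (fibre_iter T h A \<beta> n ((T_inv ^^ n) x') w)" for w
    using x' by (simp only: funpow_Suc_right comp_def x'_def[symmetric] fibre_iter.simps T_iterate_T_inv)
  have R_scale: "pullback_radius \<beta> n (\<lambda>k. norm (bwd k x' *v (c *\<^sub>R z))) = R" if "c \<noteq> 0" for c
    using pullback_radius_scale[of "\<bar>c\<bar>" \<beta> n "\<lambda>k. norm (bwd k x' *v z)"] that
    by (simp add: R_def matrix_vector_mult_scaleR)
  show ?case
    unfolding iter pull
  proof
    assume "\<exists>w\<in>cball 0 1. fibre_map h A \<beta> x' (fibre_iter T h A \<beta> n ((T_inv ^^ n) x') w) = y"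
    then obtain w where w: "w \<in> cball 0 1"
      "fibre_map h A \<beta> x' (fibre_iter T h A \<beta> n ((T_inv ^^ n) x') w) = y" by blast
    define y' where "y' = fibre_iter T h A \<beta> n ((T_inv ^^ n) x') w"
    have y'0: "y' \<noteq> 0"
      using w(2) y by (auto simp: y'_def fibre_map_def)
    have y_eq: "y = (h (\<beta> * norm y') / norm y') *\<^sub>R (A x' *v y')"
      using w(2) y'0 unfolding y'_def[symmetric]
      by (simp add: fibre_map_def matrix_vector_mult_scaleR divide_inverse)
    define c where "c = norm y' / h (\<beta> * norm y')"
    have hpos: "0 < h (\<beta> * norm y')"
      using \<beta> y'0 by (intro h_pos) auto
    have c: "c > 0"
      using hpos y'0 by (simp add: c_def)
    have z_eq: "z = (h (\<beta> * norm y') / norm y') *\<^sub>R y'"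
      unfolding z_def by (subst y_eq) (use x' in \<open>simp add: matrix_vector_mult_scaleR A_inv_def x'_def[symmetric] det_A\<close>)
    then have y'_eq: "y' = c *\<^sub>R z"
      unfolding z_eq using hpos y'0 by (simp add: c_def)
    have "norm y' \<le> pullback_radius \<beta> n (\<lambda>k. norm (bwd k x' *v y'))"
      using Suc.IH[OF x' y'0] w(1) y'_def by blast
    also have "\<dots> = R"
      unfolding y'_eq by (rule R_scale) (use c in simp)
    finally have le: "h (\<beta> * norm y') \<le> h (\<beta> * R)"
      using \<beta> by (intro h_mono) auto
    have "norm z = h (\<beta> * norm y')"
      unfolding z_eq using hpos y'0 by simp
    then have "norm z * (norm y / norm z) \<le> h (\<beta> * R) * (norm y / norm z)"
      using le by (intro mult_right_mono divide_nonneg_nonneg norm_ge_zero) simp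
    then show "norm y \<le> h (\<beta> * R) * (norm y / norm z)"
      using z by simp
  next
    assume "norm y \<le> h (\<beta> * R) * (norm y / norm z)"
    then have nz: "norm z \<le> h (\<beta> * R)"
      using y z by (simp add: field_simps)
    \<comment> \<open>Along the ray the radii up to \<open>R\<close> are mapped onto all lengths up
      to \<open>h (\<beta> * R)\<close>; \<open>s\<close> is the radius whose image has the required
      length.\<close>
    have "continuous_on {0..R} (\<lambda>s. h (\<beta> * s))"
      using \<beta> by (intro continuous_on_compose2[OF h_continuous] continuous_intros) auto
    then obtain s where s: "0 \<le> s" "s \<le> R" "h (\<beta> * s) = norm z"
      using IVT'[of "\<lambda>s. h (\<beta> * s)" 0 "norm z" R] nz R by (auto simp: h_0)
    have s0: "0 < s"
      using s z by (cases "s = 0") (auto simp: h_0)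
    define y' where "y' = s *\<^sub>R (z /\<^sub>R norm z)"
    have ny': "norm y' = s"
      using s0 z by (simp add: y'_def)
    have "y' = (s / norm z) *\<^sub>R z"
      by (simp add: y'_def divide_inverse)
    then have "pullback_radius \<beta> n (\<lambda>k. norm (bwd k x' *v y')) = R"
      using R_scale[of "s / norm z"] s0 z by simp
    then obtain w where w: "w \<in> cball 0 1" "fibre_iter T h A \<beta> n ((T_inv ^^ n) x') w = y'"
      using Suc.IH[OF x', of y'] ny' s s0 by force
    have "fibre_map h A \<beta> x' y' = y"
      unfolding y'_def using fibre_map_polar[OF s0 z, of h A \<beta> x'] z s(3) Az by simp
    then show "\<exists>w\<in>cball 0 1. fibre_map h A \<beta> x' (fibre_iter T h A \<beta> n ((T_inv ^^ n) x') w) = y"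
      using w by (intro bexI[of _ w]) auto
  qed
qed

text \<open>A point survives all pullbacks if its norm is below all pullback radii, that is, below
  their infimum. The origin is listed separately because its backward norms vanish and do not form
  an admissible sequence.\<close>

lemma attractor_fibre_eq:
  assumes x: "x \<in> space M" and \<beta>: "0 < \<beta>"
  shows "attractor_fibre M T h A \<beta> x = {y. y = 0 \<or> norm y \<le> radius \<beta> x y}"
proof -
  have image: "(x, y) \<in> (skew_map T h A \<beta> ^^ n) ` (space M \<times> cball 0 1) \<longleftrightarrow>
      (\<exists>w\<in>cball 0 1. fibre_iter T h A \<beta> n ((T_inv ^^ n) x) w = y)" for n y
  proof
    assume "(x, y) \<in> (skew_map T h A \<beta> ^^ n) ` (space M \<times> cball 0 1)"
    then obtain z w where zw: "z \<in> space M" "w \<in> cball 0 1" "(x, y) = (skew_map T h A \<beta> ^^ n) (z, w)"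
      by auto
    then show "\<exists>w\<in>cball 0 1. fibre_iter T h A \<beta> n ((T_inv ^^ n) x) w = y"
      unfolding skew_map_iterate by auto
  next
    assume "\<exists>w\<in>cball 0 1. fibre_iter T h A \<beta> n ((T_inv ^^ n) x) w = y"
    then obtain w where w: "w \<in> cball 0 1" "fibre_iter T h A \<beta> n ((T_inv ^^ n) x) w = y" by blast
    then have "(x, y) = (skew_map T h A \<beta> ^^ n) ((T_inv ^^ n) x, w)"
      unfolding skew_map_iterate using x by simp
    then show "(x, y) \<in> (skew_map T h A \<beta> ^^ n) ` (space M \<times> cball 0 1)"
      using w(1) inverse.iterate_in_space[OF x] by blast
  qed
  have mem: "y \<in> attractor_fibre M T h A \<beta> x \<longleftrightarrow>
      (\<forall>n. \<exists>w\<in>cball 0 1. fibre_iter T h A \<beta> n ((T_inv ^^ n) x) w = y)" for y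
    unfolding attractor_fibre_def attractor_def using image by auto
  have "y \<in> attractor_fibre M T h A \<beta> x \<longleftrightarrow> y = 0 \<or> norm y \<le> radius \<beta> x y" for y
  proof (cases "y = 0")
    case True
    then show ?thesis
      unfolding mem using fibre_iter_0[of T h A \<beta>] by (auto intro!: bexI[of _ 0])
  next
    case False
    note adm = admissible_bwd[OF x False]
    have "y \<in> attractor_fibre M T h A \<beta> x \<longleftrightarrow> (\<forall>n. norm y \<le> pullback_radius \<beta> n (\<lambda>k. norm (bwd k x *v y)))"
      unfolding mem using fibre_iter_ball_iff[OF \<beta> x False] by simp
    also have "\<dots> \<longleftrightarrow> norm y \<le> radius \<beta> x y"
      unfolding radius_def using limit_radius_ge[OF adm \<beta>, of "norm y"] limit_radius_le[OF adm \<beta>]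
      by (blast intro: order_trans)
    finally show ?thesis using False by simp
  qed
  then show ?thesis by blast
qed

section \<open>The radius as a function of the line and the parameter, and its invariance
  equation\<close>

lemma radius_nonneg: "x \<in> space M \<Longrightarrow> u \<noteq> 0 \<Longrightarrow> 0 < \<beta> \<Longrightarrow> 0 \<le> radius \<beta> x u"
  unfolding radius_def by (intro limit_radius_nonneg admissible_bwd)

lemma radius_le_1: "x \<in> space M \<Longrightarrow> u \<noteq> 0 \<Longrightarrow> 0 < \<beta> \<Longrightarrow> radius \<beta> x u \<le> 1"
  unfolding radius_def by (intro limit_radius_le_1 admissible_bwd)

lemma radius_scaleR: "c \<noteq> 0 \<Longrightarrow> radius \<beta> x (c *\<^sub>R u) = radius \<beta> x u"
  using limit_radius_scale[of "\<bar>c\<bar>"] by (simp add: radius_def matrix_vector_mult_scaleR)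

lemma radius_parallel:
  assumes "u \<noteq> 0" "v \<noteq> 0" "det2 u v = 0"
  shows "radius \<beta> x u = radius \<beta> x v"
proof -
  obtain c where "v = c *\<^sub>R u"
    using det2_eq_0_imp_parallel[OF assms(3,1)] .
  then show ?thesis
    using radius_scaleR[of c] assms(2) by (cases "c = 0") auto
qed

lemma radius_mono:
  "x \<in> space M \<Longrightarrow> u \<noteq> 0 \<Longrightarrow> 0 < \<beta> \<Longrightarrow> \<beta> \<le> \<beta>' \<Longrightarrow> radius \<beta> x u \<le> radius \<beta>' x u"
  unfolding radius_def by (intro limit_radius_mono admissible_bwd)

lemma radius_zero_mono:
  "x \<in> space M \<Longrightarrow> u \<noteq> 0 \<Longrightarrow> 0 < \<beta> \<Longrightarrow> \<beta> \<le> \<beta>' \<Longrightarrow> radius \<beta>' x u = 0 \<Longrightarrow> radius \<beta> x u = 0"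
  using radius_mono[of x u \<beta> \<beta>'] radius_nonneg[of x u \<beta>] by simp

lemma radius_forward:
  assumes x: "x \<in> space M" and u: "u \<noteq> 0" and \<beta>: "0 < \<beta>"
  shows "radius \<beta> (T x) (A x *v u) = h (\<beta> * radius \<beta> x u) * (norm (A x *v u) / norm u)"
proof -
  have Tx: "T x \<in> space M"
    by (rule T_in_space[OF x])
  have Au: "A x *v u \<noteq> 0"
    using u x by (simp add: sl2_nonzero_iff det_A)
  show ?thesis
    unfolding radius_def limit_radius_Suc[OF admissible_bwd[OF Tx Au] \<beta>]
    using bwd_Suc_T[OF x] bwd_Suc_T[OF x, of 0 u] by (simp del: cocycle.simps(2))
qed

lemma radius_orbit:
  assumes x: "x \<in> space M" and u: "u \<noteq> 0" and \<beta>: "0 < \<beta>" and pos: "0 < radius \<beta> x u"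
  shows "response_orbit \<beta> (\<lambda>n. norm (fwd n x *v u)) (\<lambda>n. radius \<beta> ((T ^^ n) x) (fwd n x *v u))"
  unfolding response_orbit_def
proof (intro conjI allI)
  show "radius \<beta> ((T ^^ Suc n) x) (fwd (Suc n) x *v u) = h (\<beta> * radius \<beta> ((T ^^ n) x) (fwd n x *v u)) *
      (norm (fwd (Suc n) x *v u) / norm (fwd n x *v u))" for n
    using radius_forward[OF iterate_in_space[OF x] _ \<beta>, of "fwd n x *v u" n] fwd_pos[OF x u, of n]
    by (simp add: matrix_vector_mul_assoc)
qed (use fwd_pos[OF x u] pos in auto)

lemma attractor_radius_eq:
  assumes x: "x \<in> space M" and \<beta>: "0 < \<beta>"
  shows "attractor_radius M T h A \<beta> x \<alpha> = radius \<beta> x (direction \<alpha>)"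
proof -
  have iff: "0 \<le> r \<and> r *\<^sub>R direction \<alpha> \<in> attractor_fibre M T h A \<beta> x \<longleftrightarrow>
      0 \<le> r \<and> r \<le> radius \<beta> x (direction \<alpha>)" for r
    using radius_scaleR[of r \<beta> x "direction \<alpha>"] radius_nonneg[OF x direction_nonzero \<beta>]
    by (cases "r = 0") (auto simp: attractor_fibre_eq[OF x \<beta>])
  show ?thesis
    unfolding attractor_radius_def iff
    by (rule Greatest_equality) (use radius_nonneg[OF x direction_nonzero \<beta>] in auto)
qed

end

section \<open>Vanishing and positivity of the radius\<close>

text \<open>The exceptional set consists of the times at which the sequence exceeds the square root of a
  decreasing majorant of its averages.\<close>

lemma tendsto_0_off_density_zero:
  fixes x :: "nat \<Rightarrow> real"
  assumes nonneg: "\<And>n. 0 \<le> x n" and lim: "(\<lambda>n. 1 / real n * (\<Sum>i<n. x i)) \<longlonglongrightarrow> 0"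
  obtains J where "density_zero J" "(x \<longlongrightarrow> 0) (inf sequentially (principal (- J)))"
proof -
  define c where "c n = 1 / real n * (\<Sum>i<n. x i)" for n
  have c_nonneg: "0 \<le> c n" for n
    by (simp add: c_def nonneg sum_nonneg)
  have "Bseq c"
    using lim convergent_imp_Bseq unfolding c_def convergent_def by blast
  then have bdd: "bdd_above (c ` S)" for S
    by (meson Bseq_bdd_above bdd_above_mono image_mono subset_UNIV)
  \<comment> \<open>The supremum over tails makes the majorant decreasing, and the added term makes
    it positive, so that its square root can be cancelled below.\<close>
  define e where "e n = (SUP m\<in>{n..}. c m) + 1 / real (Suc n)" for n
  have c_le_e: "c m \<le> e n" if "n \<le> m" for m n
    using cSUP_upper[OF _ bdd, of m "{n..}"] that by (simp add: e_def add_increasing2)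
  have e_pos: "0 < e n" for n
  proof -
    have "0 \<le> (SUP m\<in>{n..}. c m)"
      using cSUP_upper[OF _ bdd, of n "{n..}"] c_nonneg[of n] by simp
    then show ?thesis by (simp add: e_def add_nonneg_pos)
  qed
  have e_dec: "e n \<le> e m" if "m \<le> n" for m n
    unfolding e_def using that
    by (intro add_mono cSUP_subset_mono bdd) (auto simp: frac_le)
  have "(\<lambda>n. (SUP m\<in>{n..}. c m)) \<longlonglongrightarrow> 0"
  proof (rule LIMSEQ_I)
    fix \<epsilon> :: real assume "\<epsilon> > 0"
    then obtain N where N: "\<And>m. m \<ge> N \<Longrightarrow> c m < \<epsilon> / 2"
      using LIMSEQ_D[OF lim, of "\<epsilon> / 2"] c_nonneg unfolding c_def[symmetric] by auto
    show "\<exists>no. \<forall>n\<ge>no. norm ((SUP m\<in>{n..}. c m) - 0) < \<epsilon>"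
    proof (intro exI[of _ N] allI impI)
      fix n assume "n \<ge> N"
      then have "(SUP m\<in>{n..}. c m) \<le> \<epsilon> / 2"
        using N by (intro cSUP_least) (auto intro: less_imp_le)
      moreover have "0 \<le> (SUP m\<in>{n..}. c m)"
        using cSUP_upper[OF _ bdd, of n "{n..}"] c_nonneg[of n] by simp
      ultimately show "norm ((SUP m\<in>{n..}. c m) - 0) < \<epsilon>"
        using \<open>\<epsilon> > 0\<close> by simp
    qed
  qed
  then have "e \<longlonglongrightarrow> 0 + 0"
    unfolding e_def using LIMSEQ_inverse_real_of_nat
    by (intro tendsto_add) (simp_all add: inverse_eq_divide)
  then have sqrt_e: "(\<lambda>n. sqrt (e n)) \<longlonglongrightarrow> 0"
    using tendsto_real_sqrt by fastforce
  define J where "J = {n. sqrt (e n) < x n}"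
  \<comment> \<open>Summation up to \<open>n\<close> inclusive means an average over
    \<open>Suc n\<close> terms; the factor 2 bounds \<open>Suc n\<close> by
    \<open>2 * n\<close>.\<close>
  have card_le: "1 / real n * real (card (J \<inter> {1..n})) \<le> 2 * sqrt (e n)" if n: "n \<ge> 1" for n
  proof -
    have "real (card (J \<inter> {1..n})) * sqrt (e n) = (\<Sum>i\<in>J \<inter> {1..n}. sqrt (e n))"
      by simp
    also have "\<dots> \<le> (\<Sum>i\<in>J \<inter> {1..n}. x i)"
    proof (rule sum_mono)
      fix i assume i: "i \<in> J \<inter> {1..n}"
      then have "sqrt (e n) \<le> sqrt (e i)" "sqrt (e i) \<le> x i"
        using e_dec[of i n] by (auto simp: J_def)
      then show "sqrt (e n) \<le> x i"
        by (rule order_trans)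
    qed
    also have "\<dots> \<le> (\<Sum>i<Suc n. x i)"
      by (intro sum_mono2) (auto simp: nonneg)
    also have "\<dots> = real (Suc n) * c (Suc n)"
      by (simp add: c_def)
    also have "\<dots> \<le> (2 * real n) * e n"
      using n c_le_e[of n "Suc n"] c_nonneg[of "Suc n"] by (intro mult_mono) auto
    also have "\<dots> = (2 * real n * sqrt (e n)) * sqrt (e n)"
      using e_pos[of n] by simp
    finally have "real (card (J \<inter> {1..n})) \<le> 2 * real n * sqrt (e n)"
      using e_pos[of n] by (simp only: mult_le_cancel_right_pos real_sqrt_gt_0_iff)
    then show ?thesis
      using n by (simp add: field_simps)
  qed
  have "(\<lambda>n. 2 * sqrt (e n)) \<longlonglongrightarrow> 2 * 0"
    by (intro tendsto_mult tendsto_const sqrt_e)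
  then have lim2: "(\<lambda>n. 2 * sqrt (e n)) \<longlonglongrightarrow> 0" by simp
  have "density_zero J"
    unfolding density_zero_def
  proof (rule tendsto_sandwich[OF _ _ tendsto_const lim2])
    show "eventually (\<lambda>n. 1 / real n * real (card (J \<inter> {1..n})) \<le> 2 * sqrt (e n)) sequentially"
      using eventually_ge_at_top[of 1] by eventually_elim (rule card_le)
  qed simp
  moreover have "(x \<longlongrightarrow> 0) (inf sequentially (principal (- J)))"
  proof (rule tendsto_sandwich[OF _ _ tendsto_const tendsto_mono[OF inf_le1 sqrt_e]])
    show "eventually (\<lambda>n. 0 \<le> x n) (inf sequentially (principal (- J)))"
      by (simp add: nonneg)
    show "eventually (\<lambda>n. x n \<le> sqrt (e n)) (inf sequentially (principal (- J)))"
      by (simp add: eventually_inf_principal J_def not_less)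
  qed
  ultimately show ?thesis by (rule that)
qed

text \<open>Restricted to the open disk, such a homeomorphism would be a continuous injection of an
  open plane set into a subspace of dimension at most 1, against invariance of dimension.\<close>

lemma subset_line_not_homeomorphic_disk:
  fixes X :: "(real^2) set"
  assumes "X \<subseteq> span {u}"
  shows "\<not> X homeomorphic (cball 0 1 :: (real^2) set)"
proof
  assume "X homeomorphic (cball 0 1 :: (real^2) set)"
  then have "(cball 0 1 :: (real^2) set) homeomorphic X"
    by (rule homeomorphic_sym[THEN iffD1])
  then obtain f g where fg: "homeomorphism (cball 0 1 :: (real^2) set) X f g"
    by (auto simp: homeomorphic_def)
  have sub: "ball 0 1 \<subseteq> (cball 0 1 :: (real^2) set)" by auto
  have "inj_on f (cball 0 1)"
    using homeomorphism_apply1[OF fg] by (rule inj_on_inverseI)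
  then have inj: "inj_on f (ball 0 1)"
    using sub by (rule inj_on_subset)
  have image: "f ` ball 0 1 \<subseteq> span {u}"
    using homeomorphism_image1[OF fg] sub assms by blast
  have "dim (UNIV :: (real^2) set) \<le> dim (span {u})"
    by (rule invariance_of_dimension_subspaces[OF _ _ _ continuous_on_subset[OF homeomorphism_cont1[OF fg] sub] image inj])
      auto
  moreover have "dim (span {u}) \<le> 1"
    using dim_le_card[of "{u}" "{u}"] by (simp add: span_superset)
  ultimately show False by simp
qed

lemma normalized_diff_le:
  fixes p q :: "'b::real_normed_vector"
  assumes "p \<noteq> 0" "q \<noteq> 0"
  shows "norm (p /\<^sub>R norm p - q /\<^sub>R norm q) \<le> 2 * norm (p - q) / norm q"
proof -
  have eq: "p /\<^sub>R norm p - q /\<^sub>R norm q = (p - q) /\<^sub>R norm q + (inverse (norm p) - inverse (norm q)) *\<^sub>R p"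
    by (simp add: algebra_simps)
  have "norm ((inverse (norm p) - inverse (norm q)) *\<^sub>R p) = \<bar>norm q - norm p\<bar> / norm q"
    using assms by (simp add: abs_mult abs_divide field_simps)
  also have "\<dots> \<le> norm (p - q) / norm q"
    using norm_triangle_ineq3[of q p] by (intro divide_right_mono) (auto simp: norm_minus_commute)
  finally have "norm ((inverse (norm p) - inverse (norm q)) *\<^sub>R p) \<le> norm (p - q) / norm q" .
  moreover have "norm ((p - q) /\<^sub>R norm q) = norm (p - q) / norm q"
    by (simp add: divide_inverse mult.commute)
  ultimately show ?thesis
    unfolding eq using norm_triangle_ineq[of "(p - q) /\<^sub>R norm q" "(inverse (norm p) - inverse (norm q)) *\<^sub>R p"]
    by simp
qed

context concave_response
begin

lemma borel_measurable_pullback_radius: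
  assumes "\<And>k. d k \<in> borel_measurable M" "\<And>x. x \<in> space M \<Longrightarrow> admissible (\<lambda>k. d k x)" "0 < \<beta>"
  shows "(\<lambda>x. pullback_radius \<beta> n (\<lambda>k. d k x)) \<in> borel_measurable M"
  using assms(1,2)
proof (induction n arbitrary: d)
  case (Suc n)
  have d [measurable]: "d k \<in> borel_measurable M" for k
    by (rule Suc.prems)
  have adm: "admissible (\<lambda>k. d (Suc k) x)" if "x \<in> space M" for x
    using Suc.prems(2)[OF that] admissible_Suc by blast
  have P [measurable]: "(\<lambda>x. pullback_radius \<beta> n (\<lambda>k. d (Suc k) x)) \<in> borel_measurable M"
    by (rule Suc.IH) (use adm in auto)
  \<comment> \<open>The function \<open>h\<close> is controlled on the half-line only. Precomposing
    with the maximum extends it continuously, and pullback radii are positive, so nothing changes on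
    them.\<close>
  have "continuous_on UNIV (\<lambda>u. h (max 0 u))"
    by (intro continuous_on_compose2[OF h_continuous] continuous_intros) auto
  then have [measurable]: "(\<lambda>u. h (max 0 u)) \<in> borel_measurable borel"
    by (rule borel_measurable_continuous_onI)
  have "(\<lambda>x. h (max 0 (\<beta> * pullback_radius \<beta> n (\<lambda>k. d (Suc k) x))) * (d 0 x / d 1 x)) \<in> borel_measurable M"
    by measurable
  also have "?this \<longleftrightarrow> (\<lambda>x. pullback_radius \<beta> (Suc n) (\<lambda>k. d k x)) \<in> borel_measurable M"
  proof (rule measurable_cong)
    fix x assume "x \<in> space M"
    from pullback_radius_pos[OF adm[OF this] assms(3), of n]
    show "h (max 0 (\<beta> * pullback_radius \<beta> n (\<lambda>k. d (Suc k) x))) * (d 0 x / d 1 x) =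
        pullback_radius \<beta> (Suc n) (\<lambda>k. d k x)"
      using assms(3) by (simp add: max_def)
  qed
  finally show ?case .
qed simp

lemma borel_measurable_limit_radius:
  assumes "\<And>k. d k \<in> borel_measurable M" "\<And>x. x \<in> space M \<Longrightarrow> admissible (\<lambda>k. d k x)" "0 < \<beta>"
  shows "(\<lambda>x. limit_radius \<beta> (\<lambda>k. d k x)) \<in> borel_measurable M"
proof (rule borel_measurable_LIMSEQ_metric[where f = "\<lambda>n x. pullback_radius \<beta> n (\<lambda>k. d k x)"])
  show "(\<lambda>x. pullback_radius \<beta> n (\<lambda>k. d k x)) \<in> borel_measurable M" for n
    by (rule borel_measurable_pullback_radius[OF assms])
qed (use assms pullback_radius_tendsto in auto)

lemma response_orbit_upper:
  assumes x: "response_orbit \<beta> d x" and \<beta>: "0 < \<beta>"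
  shows "x n \<le> x 0 / d 0 * (\<beta> ^ n * d n)"
proof (induction n)
  case 0
  then show ?case using response_orbitD(1)[OF x, of 0] by simp
next
  case (Suc n)
  note d = response_orbitD(1)[OF x]
  have "x (Suc n) \<le> (\<beta> * x n) * (d (Suc n) / d n)"
    unfolding response_orbitD(2)[OF x] using \<beta> response_orbit_pos[OF x \<beta>, of n] d[of n] d[of "Suc n"]
    by (intro mult_right_mono h_le_self) auto
  also have "\<dots> \<le> (\<beta> * (x 0 / d 0 * (\<beta> ^ n * d n))) * (d (Suc n) / d n)"
    using Suc \<beta> d[of n] d[of "Suc n"] by (intro mult_right_mono mult_left_mono) auto
  also have "\<dots> = x 0 / d 0 * (\<beta> ^ Suc n * d (Suc n))"
    using d[of n] by simp
  finally show ?case .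
qed

end

context concave_skew_product
begin

text \<open>A positive radius on \<open>v\<close> bounds the backward norms of \<open>v\<close>.
  Preservation of area then bounds those of \<open>u\<close> from below, which is the hypothesis of
  \<open>limit_radius_eq_0\<close>.\<close>

lemma radius_two_directions:
  assumes x: "x \<in> space M" and \<beta>: "0 < \<beta>" "\<beta> \<le> 1" and uv: "det2 u v \<noteq> 0"
  shows "radius \<beta> x u = 0 \<or> radius \<beta> x v = 0"
proof (rule ccontr)
  assume not0: "\<not> ?thesis"
  have u0: "u \<noteq> 0" and v0: "v \<noteq> 0"
    using uv by (auto simp: det2_def)
  have v: "0 < radius \<beta> x v"
    using not0 radius_nonneg[OF x v0 \<beta>(1)] by simp
  define b where "b = norm v / radius \<beta> x v"
  have b: "b > 0" using v v0 by (simp add: b_def)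
  have bound: "norm (bwd n x *v v) \<le> b" for n
  proof -
    have "radius \<beta> x v \<le> \<beta> ^ n * (norm (bwd 0 x *v v) / norm (bwd n x *v v)) *
        limit_radius \<beta> (\<lambda>k. norm (bwd (n + k) x *v v))"
      unfolding radius_def by (rule limit_radius_shift_le[OF admissible_bwd[OF x v0] \<beta>(1)])
    also have "\<dots> \<le> 1 * (norm v / norm (bwd n x *v v)) * 1"
      using \<beta> limit_radius_le_1[OF admissible_shift[OF admissible_bwd[OF x v0]] \<beta>(1)]
        limit_radius_nonneg[OF admissible_shift[OF admissible_bwd[OF x v0]] \<beta>(1)]
      by (intro mult_mono) (auto simp: power_le_one)
    finally show ?thesis
      using v bwd_pos[OF x v0, of n] by (simp add: b_def field_simps)
  qed
  have "radius \<beta> x u = 0"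
    unfolding radius_def
  proof (rule limit_radius_eq_0[OF admissible_bwd[OF x u0] \<beta>])
    show "0 < \<bar>det2 u v\<bar> / b"
      using uv b by simp
    show "\<bar>det2 u v\<bar> / b \<le> norm (bwd n x *v u)" for n
    proof -
      have "\<bar>det2 u v\<bar> \<le> norm (bwd n x *v u) * norm (bwd n x *v v)"
        using abs_det2_le[of "bwd n x *v u" "bwd n x *v v"] by (simp add: det2_matrix inverse.det_cocycle[OF x])
      also have "\<dots> \<le> norm (bwd n x *v u) * b"
        using bound by (intro mult_left_mono) auto
      finally show ?thesis
        using b by (simp add: divide_le_eq)
    qed
  qed
  then show False using not0 by simp
qed

lemma subexponential_fwd:
  assumes x: "x \<in> space M" and lim: "(\<lambda>n. ln (opnorm (fwd n x)) / real n) \<longlonglongrightarrow> l"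
    and \<beta>: "0 < \<beta>" "\<beta> \<le> exp (- l)" and \<delta>: "0 < \<delta>"
  shows "\<exists>C>0. \<forall>n. \<beta> ^ n * norm (fwd n x *v v) \<le> C * exp (\<delta> * real n)"
proof -
  obtain C where C: "C > 0" "\<And>n. opnorm (fwd n x) \<le> C * exp ((l + \<delta>) * real n)"
    using exponential_bounds(1)[OF opnorm_cocycle_ge_1[OF x] lim \<delta>] by blast
  \<comment> \<open>Adding 1 to \<open>norm v\<close> keeps the constant positive when
    \<open>v\<close> is 0.\<close>
  have "\<beta> ^ n * norm (fwd n x *v v) \<le> (C * (norm v + 1)) * exp (\<delta> * real n)" for n
  proof -
    have "norm (fwd n x *v v) \<le> (C * exp ((l + \<delta>) * real n)) * (norm v + 1)"
      by (rule order_trans[OF norm_matrix_vector_le mult_mono[OF C(2)]]) (use C(1) in auto)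
    moreover have "\<beta> ^ n \<le> exp (- l * real n)"
      using power_mono[OF \<beta>(2), of n] \<beta>(1) by (simp add: exp_of_nat_mult[symmetric] mult.commute)
    ultimately have "\<beta> ^ n * norm (fwd n x *v v) \<le>
        exp (- l * real n) * ((C * exp ((l + \<delta>) * real n)) * (norm v + 1))"
      using \<beta>(1) by (intro mult_mono) auto
    also have "\<dots> = (C * (norm v + 1)) * (exp (- l * real n) * exp ((l + \<delta>) * real n))"
      by simp
    also have "exp (- l * real n) * exp ((l + \<delta>) * real n) = exp (\<delta> * real n)"
      by (simp add: exp_add[symmetric] algebra_simps)
    finally show ?thesis .
  qed
  moreover have "C * (norm v + 1) > 0"
    using C(1) by (intro mult_pos_pos add_nonneg_pos) auto
  ultimately show ?thesis by blast
qed

lemma fibre_cesaro: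
  assumes x: "x \<in> space M" and lim: "(\<lambda>n. ln (opnorm (fwd n x)) / real n) \<longlonglongrightarrow> l"
    and \<beta>: "0 < \<beta>" "\<beta> \<le> exp (- l)"
  shows "(\<lambda>n. 1 / real n * (\<Sum>i<n. norm (fibre_iter T h A \<beta> i x v))) \<longlonglongrightarrow> 0"
proof (cases "v = 0")
  case True
  then show ?thesis by (simp add: fibre_iter_0)
next
  case False
  show ?thesis
  proof (rule response_cesaro[OF fibre_iter_orbit[OF x False \<beta>(1)] \<beta>(1)])
    show "norm (fibre_iter T h A \<beta> n x v) \<le> max 1 (norm v)" for n
      using norm_fibre_iter_le_1[OF x \<beta>(1)] by (cases n) (auto simp del: fibre_iter.simps(2) intro: le_max_iff_disj[THEN iffD2])
  qed (rule subexponential_fwd[OF x lim \<beta>])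
qed

lemma decays_fwd_fwd:
  assumes "decays l (\<lambda>n. fwd n x) u" "x \<in> space M"
  shows "decays l (\<lambda>n. fwd n ((T ^^ m) x)) (fwd m x *v u)"
proof (induction m)
  case (Suc m)
  then show ?case
    using decays_forward[OF Suc iterate_in_space[OF assms(2)]]
    by (simp add: matrix_vector_mul_assoc)
qed (use assms in simp)

text \<open>Along an invariant line field with vanishing exponent the averages of the radius tend to \<open>0\<close>,
  while their integral does not depend on \<open>n\<close>.\<close>

lemma radius_critical_AE_0:
  assumes S: "invariant_full_set M T S" and [measurable]: "\<alpha> \<in> borel_measurable M" and \<beta>: "0 < \<beta>"
    and subexp: "\<And>x \<delta>. x \<in> S \<Longrightarrow> 0 < \<delta> \<Longrightarrow>
      \<exists>C>0. \<forall>n. \<beta> ^ n * norm (fwd n x *v direction (\<alpha> x)) \<le> C * exp (\<delta> * real n)"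
    and invariant: "\<And>x n. x \<in> S \<Longrightarrow> det2 (fwd n x *v direction (\<alpha> x)) (direction (\<alpha> ((T ^^ n) x))) = 0"
  shows "AE x in M. radius \<beta> x (direction (\<alpha> x)) = 0"
proof -
  have S_sets [measurable]: "S \<in> sets M"
    using S by (simp add: invariant_full_set_def)
  note S_space = invariant_full_set_iterate(1)[OF S]
  define F where "F x = indicator S x * radius \<beta> x (direction (\<alpha> x))" for x
  have "(\<lambda>x. radius \<beta> x (direction (\<alpha> x))) \<in> borel_measurable M"
    unfolding radius_def by (rule borel_measurable_limit_radius) (use \<beta> admissible_bwd in auto)
  then have F [measurable]: "F \<in> borel_measurable M"
    unfolding F_def by measurable
  have F01: "0 \<le> F x" "F x \<le> 1" if "x \<in> space M" for x
    using radius_nonneg[OF that direction_nonzero \<beta>] radius_le_1[OF that direction_nonzero \<beta>]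
    by (auto simp: F_def indicator_def)
  define G where "G n x = 1 / real n * (\<Sum>i<n. F ((T ^^ i) x))" for n x
  have G_meas [measurable]: "G n \<in> borel_measurable M" for n
    unfolding G_def by measurable
  have G_lim: "(\<lambda>n. G n x) \<longlonglongrightarrow> 0" if x: "x \<in> S" for x
  proof -
    define u where "u = direction (\<alpha> x)"
    have u: "u \<noteq> 0" by (simp add: u_def)
    \<comment> \<open>Invariance of the line field identifies the radius along the orbit with the
      radius of the transported vector, to which the scalar recursion applies.\<close>
    have F_eq: "F ((T ^^ i) x) = radius \<beta> ((T ^^ i) x) (fwd i x *v u)" for i
      using radius_parallel[OF _ direction_nonzero invariant[OF x, of i], of \<beta> "(T ^^ i) x"]
        fwd_pos[OF S_space[OF x] u, of i] invariant_full_set_iterate(2)[OF S x, of i]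
      by (simp add: F_def u_def)
    show ?thesis
    proof (cases "radius \<beta> x u = 0")
      case True
      \<comment> \<open>A \<open>response_orbit\<close> must start at a positive value, so a
        vanishing initial radius is treated apart: it remains zero because
        \<open>h 0 = 0\<close>.\<close>
      have "radius \<beta> ((T ^^ i) x) (fwd i x *v u) = 0" for i
      proof (induction i)
        case (Suc i)
        have "radius \<beta> (T ((T ^^ i) x)) (A ((T ^^ i) x) *v (fwd i x *v u)) = 0"
          using radius_forward[OF iterate_in_space[OF S_space[OF x]] _ \<beta>, of "fwd i x *v u" i]
            fwd_pos[OF S_space[OF x] u, of i] Suc by (simp add: h_0)
        then show ?case
          by (simp add: matrix_vector_mul_assoc)
      qed (simp add: True)
      then show ?thesis
        by (simp add: G_def F_eq)
    next
      case False
      then have pos: "0 < radius \<beta> x u"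
        using radius_nonneg[OF S_space[OF x] u \<beta>] by simp
      show ?thesis
        unfolding G_def F_eq
      proof (rule response_cesaro[OF radius_orbit[OF S_space[OF x] u \<beta> pos] \<beta>])
        show "radius \<beta> ((T ^^ n) x) (fwd n x *v u) \<le> 1" for n
          using fwd_pos[OF S_space[OF x] u, of n]
          by (intro radius_le_1 iterate_in_space S_space x \<beta>) auto
      qed (use subexp[OF x] in \<open>auto simp: u_def\<close>)
    qed
  qed
  have AE_S: "AE x in M. x \<in> S"
    using S by (intro AE_prob_1) (simp add: measure_def invariant_full_set_def emeasure_space_1)
  have G01: "0 \<le> G n x" "G n x \<le> 1" if x: "x \<in> space M" for n x
  proof -
    show "0 \<le> G n x"
      unfolding G_def using F01(1)[OF iterate_in_space[OF x]] by (simp add: sum_nonneg)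
    have "(\<Sum>i<n. F ((T ^^ i) x)) \<le> (\<Sum>i<n. 1)"
      by (intro sum_mono F01(2) iterate_in_space x)
    then show "G n x \<le> 1"
      by (cases "n = 0") (auto simp: G_def field_simps)
  qed
  have "(\<lambda>n. \<integral>x. G n x \<partial>M) \<longlonglongrightarrow> (\<integral>x. 0 \<partial>M)"
  proof (rule integral_dominated_convergence[where w = "\<lambda>_. 1"])
    show "AE x in M. (\<lambda>n. G n x) \<longlonglongrightarrow> 0"
      using AE_S by eventually_elim (rule G_lim)
  qed (use G01 in auto)
  moreover have F_int: "integrable M F" "\<And>i. integrable M (\<lambda>x. F ((T ^^ i) x))"
    by (rule integrable_const_bound[of _ 1]; use F01 iterate_in_space in auto)+
  moreover have "(\<integral>x. G n x \<partial>M) = (\<integral>x. F x \<partial>M)" if "n \<ge> 1" for n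
    unfolding G_def using that F_int
    by (simp add: Bochner_Integration.integral_sum integral_iterate)
  then have "(\<lambda>n. \<integral>x. G n x \<partial>M) \<longlonglongrightarrow> (\<integral>x. F x \<partial>M)"
    by (intro tendsto_eventually) (auto simp: eventually_sequentially)
  ultimately have "(\<integral>x. F x \<partial>M) = 0"
    using LIMSEQ_unique by fastforce
  then have "AE x in M. F x = 0"
    using integral_nonneg_eq_0_iff_AE[OF F_int(1)] F01 by auto
  with AE_S show ?thesis
    by eventually_elim (simp add: F_def)
qed

lemma radius_unstable_pos:
  assumes x: "x \<in> space M" and u: "decays l (\<lambda>n. bwd n x) u" and \<beta>: "exp (- l) < \<beta>"
  shows "0 < radius \<beta> x u"
proof -
  have \<beta>0: "0 < \<beta>"
    using \<beta> exp_gt_zero less_trans by blast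
  \<comment> \<open>Half of the margin between \<open>ln \<beta>\<close> and \<open>- l\<close>.
    With \<kappa> as below, \<open>\<kappa> * \<beta>\<close> equals
    \<open>exp (- l + \<delta>)\<close>, the rate provided by the decay of \<open>u\<close>.\<close>
  define \<delta> where "\<delta> = (ln \<beta> + l) / 2"
  have "ln (exp (- l)) < ln \<beta>"
    using \<beta> \<beta>0 by (subst ln_less_cancel_iff) auto
  then have "- l < ln \<beta>" by simp
  then have \<delta>: "0 < \<delta>" by (simp add: \<delta>_def)
  define \<kappa> where "\<kappa> = exp (- \<delta>)"
  obtain C where C: "0 < C" "\<And>n. norm (bwd n x *v u) \<le> C * exp ((- l + \<delta>) * real n)"
    using decaysE[OF u \<delta>] by blast
  have "\<kappa> * \<beta> = exp (- \<delta> + ln \<beta>)"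
    by (simp only: \<kappa>_def exp_add exp_ln[OF \<beta>0])
  also have "- \<delta> + ln \<beta> = - l + \<delta>"
    by (simp add: \<delta>_def field_simps)
  finally have "(\<kappa> * \<beta>) ^ n = exp ((- l + \<delta>) * real n)" for n
    by (simp add: exp_of_nat_mult[symmetric] mult.commute)
  then show ?thesis
    unfolding radius_def using C \<delta>
    by (intro limit_radius_pos[OF admissible_bwd[OF x decays_nonzero[OF u]] \<beta>0, of \<kappa> "1 / C"])
      (auto simp: \<kappa>_def divide_le_eq mult.commute)
qed

text \<open>Write \<open>es\<close> in the basis \<open>u\<close>, \<open>eu\<close>. Backwards the
  \<open>eu\<close> part stays bounded while \<open>u\<close>, by area, stays away from 0, so the
  backward norm of \<open>es\<close> is at most a constant times that of \<open>u\<close>, and the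
  zero is carried over by comparison.\<close>

lemma radius_zero_off_unstable:
  assumes x: "x \<in> space M" and \<beta>: "0 < \<beta>" and l: "0 < l"
    and es: "radius \<beta> x es = 0" and eu: "decays l (\<lambda>n. bwd n x) eu"
    and es_eu: "det2 es eu \<noteq> 0" and u_eu: "det2 u eu \<noteq> 0"
  shows "radius \<beta> x u = 0"
proof -
  have nz: "es \<noteq> 0" "u \<noteq> 0"
    using es_eu u_eu by (auto simp: det2_def)
  define a where "a = det2 es eu / det2 u eu"
  define b where "b = det2 u es / det2 u eu"
  have es_eq: "es = a *\<^sub>R u + b *\<^sub>R eu"
    unfolding a_def b_def by (rule det2_ne_0_decompose[OF u_eu])
  have a: "a \<noteq> 0"
    using es_eu u_eu by (simp add: a_def)
  have "Bseq (\<lambda>n. norm (bwd n x *v eu))"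
    using decays_tendsto_0[OF eu l] by (intro convergent_imp_Bseq convergentI)
  then obtain C where C: "C > 0" "\<And>n. norm (bwd n x *v eu) \<le> C"
    by (auto simp: Bseq_def)
  define D where "D = \<bar>det2 u eu\<bar>"
  have D: "D > 0" using u_eu by (simp add: D_def)
  \<comment> \<open>Area gives \<open>D <= norm (bwd n x *v u) * C\<close>; multiplying by
    \<open>C / D\<close> bounds \<open>C\<close>, and hence the norm of the \<open>eu\<close> part,
    by a multiple of the norm of the \<open>u\<close> part.\<close>
  have ratio: "norm (bwd n x *v eu) \<le> C\<^sup>2 / D * norm (bwd n x *v u)" for n
  proof -
    have "D \<le> norm (bwd n x *v u) * norm (bwd n x *v eu)"
      using abs_det2_le[of "bwd n x *v u" "bwd n x *v eu"]
      by (simp add: det2_matrix inverse.det_cocycle[OF x] D_def)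
    also have "\<dots> \<le> norm (bwd n x *v u) * C"
      by (intro mult_left_mono C) auto
    finally have "C * D \<le> C * (norm (bwd n x *v u) * C)"
      using C by (intro mult_left_mono) auto
    then have "C \<le> C\<^sup>2 / D * norm (bwd n x *v u)"
      using D by (simp add: field_simps power2_eq_square)
    then show ?thesis
      using C(2)[of n] by simp
  qed
  define c where "c = 1 / (\<bar>a\<bar> + \<bar>b\<bar> * (C\<^sup>2 / D))"
  have den: "0 < \<bar>a\<bar> + \<bar>b\<bar> * (C\<^sup>2 / D)"
    using a D by (intro add_pos_nonneg) auto
  show ?thesis
    unfolding radius_def
  proof (rule limit_radius_zero_comparison[OF admissible_bwd[OF x nz(2)] admissible_bwd[OF x nz(1)] \<beta>])
    show "0 < c" using den by (simp add: c_def)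
    show "c * norm (bwd n x *v es) \<le> norm (bwd n x *v u)" for n
    proof -
      have "norm (bwd n x *v es) = norm (a *\<^sub>R (bwd n x *v u) + b *\<^sub>R (bwd n x *v eu))"
        by (subst es_eq) (simp add: matrix_vector_right_distrib matrix_vector_mult_scaleR)
      also have "\<dots> \<le> \<bar>a\<bar> * norm (bwd n x *v u) + \<bar>b\<bar> * norm (bwd n x *v eu)"
        using norm_triangle_ineq[of "a *\<^sub>R (bwd n x *v u)" "b *\<^sub>R (bwd n x *v eu)"] by simp
      also have "\<dots> \<le> \<bar>a\<bar> * norm (bwd n x *v u) + \<bar>b\<bar> * (C\<^sup>2 / D * norm (bwd n x *v u))"
        by (intro add_left_mono mult_left_mono ratio) auto
      also have "\<dots> = (\<bar>a\<bar> + \<bar>b\<bar> * (C\<^sup>2 / D)) * norm (bwd n x *v u)"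
        by (simp add: distrib_right mult.assoc)
      finally show ?thesis
        using den by (simp add: c_def divide_le_eq mult.commute)
    qed
    show "limit_radius \<beta> (\<lambda>k. norm (bwd k x *v es)) = 0"
      using es by (simp add: radius_def)
  qed
qed

end

section \<open>Convergence of orbits\<close>

lemma scaled_segment_eq:
  fixes d :: "'b::real_vector"
  assumes "0 \<le> R"
  shows "{r *\<^sub>R d | r. \<bar>r\<bar> \<le> R} = closed_segment ((- R) *\<^sub>R d) (R *\<^sub>R d)"
proof -
  have "closed_segment ((- R) *\<^sub>R d) (R *\<^sub>R d) = (\<lambda>r. r *\<^sub>R d) ` closed_segment (- R) R"
    by (rule closed_segment_linear_image) (rule linear_scaleR_left)
  also have "closed_segment (- R) R = {r. \<bar>r\<bar> \<le> R}"
    using assms by (auto simp: closed_segment_eq_real_ivl abs_le_iff)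
  finally show ?thesis by auto
qed

context concave_skew_product
begin

context
  fixes x es eu v :: _ and l :: real
  assumes x: "x \<in> space M" and l: "0 < l" and es: "decays l (\<lambda>n. fwd n x) es"
    and es_eu: "det2 es eu \<noteq> 0" and es_v: "det2 es v \<noteq> 0"
begin

lemma transversal_nonzero: "es \<noteq> 0" "eu \<noteq> 0" "v \<noteq> 0"
  using es_eu es_v by (auto simp: det2_def)

text \<open>The quotient is the \<open>eu\<close> coordinate of \<open>v\<close> in the basis
  \<open>eu\<close>, \<open>es\<close>; the limits below are expressed through it.\<close>

lemma unstable_component_nonzero: "det2 v es / det2 eu es \<noteq> 0"
  using es_eu es_v det2_swap[of v es] det2_swap[of eu es] by auto

lemma fwd_diff_tendsto:
  "(\<lambda>n. norm (fwd n x *v v - (det2 v es / det2 eu es) *\<^sub>R (fwd n x *v eu))) \<longlonglongrightarrow> 0"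
proof -
  define a where "a = det2 v es / det2 eu es"
  define b where "b = det2 eu v / det2 eu es"
  have "det2 eu es \<noteq> 0"
    using es_eu det2_swap[of es eu] by simp
  from det2_ne_0_decompose[OF this, of v] have v_eq: "v = a *\<^sub>R eu + b *\<^sub>R es"
    by (simp add: a_def b_def)
  have "fwd n x *v v - a *\<^sub>R (fwd n x *v eu) = b *\<^sub>R (fwd n x *v es)" for n
    by (subst v_eq) (simp add: matrix_vector_right_distrib matrix_vector_mult_scaleR)
  moreover have "(\<lambda>n. \<bar>b\<bar> * norm (fwd n x *v es)) \<longlonglongrightarrow> \<bar>b\<bar> * 0"
    by (intro tendsto_mult tendsto_const decays_tendsto_0[OF es l])
  ultimately show ?thesis
    by (simp add: a_def)
qed

lemma fwd_eu_at_top: "filterlim (\<lambda>n. norm (fwd n x *v eu)) at_top sequentially"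
  by (rule decays_transversal_at_top[OF det_cocycle[OF x] es l es_eu])

lemma fwd_diff_quotient_tendsto:
  "(\<lambda>n. norm (fwd n x *v v - (det2 v es / det2 eu es) *\<^sub>R (fwd n x *v eu)) / norm (fwd n x *v eu)) \<longlonglongrightarrow> 0"
  by (rule tendsto_divide_0[OF fwd_diff_tendsto filterlim_at_top_imp_at_infinity[OF fwd_eu_at_top]])

lemma fwd_ratio_tendsto:
  "(\<lambda>n. norm (fwd n x *v v) / norm (fwd n x *v eu)) \<longlonglongrightarrow> \<bar>det2 v es / det2 eu es\<bar>"
proof (rule LIM_zero_cancel, rule Lim_null_comparison[OF always_eventually fwd_diff_quotient_tendsto], rule allI)
  fix n
  define a where "a = det2 v es / det2 eu es"
  have pos: "0 < norm (fwd n x *v eu)"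
    by (rule fwd_pos[OF x transversal_nonzero(2)])
  have "norm (norm (fwd n x *v v) / norm (fwd n x *v eu) - \<bar>a\<bar>) =
      \<bar>norm (fwd n x *v v) - norm (a *\<^sub>R (fwd n x *v eu))\<bar> / norm (fwd n x *v eu)"
    using pos by (simp add: field_simps abs_divide)
  also have "\<dots> \<le> norm (fwd n x *v v - a *\<^sub>R (fwd n x *v eu)) / norm (fwd n x *v eu)"
    by (intro divide_right_mono norm_triangle_ineq3) auto
  finally show "norm (norm (fwd n x *v v) / norm (fwd n x *v eu) - \<bar>det2 v es / det2 eu es\<bar>) \<le>
      norm (fwd n x *v v - (det2 v es / det2 eu es) *\<^sub>R (fwd n x *v eu)) / norm (fwd n x *v eu)"
    by (simp only: a_def)
qed

text \<open>The quotient of the two linear norms converges to a nonzero limit, so it is bounded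
  above and away from 0. Thus one reference orbit dominates every transversal orbit, which makes the
  exceptional set in \<open>critical_density\<close> independent of \<open>v\<close>.\<close>

lemma fibre_iter_comparison:
  assumes \<beta>: "0 < \<beta>"
  shows "\<exists>C. \<forall>n. norm (fibre_iter T h A \<beta> n x v) \<le> C * norm (fibre_iter T h A \<beta> n x eu)"
proof -
  note nz = transversal_nonzero
  define r where "r n = norm (fwd n x *v v) / norm (fwd n x *v eu)" for n
  have r: "0 < r n" for n
    using fwd_pos[OF x nz(2), of n] fwd_pos[OF x nz(3), of n] by (simp add: r_def)
  have lim: "r \<longlonglongrightarrow> \<bar>det2 v es / det2 eu es\<bar>"
    unfolding r_def by (rule fwd_ratio_tendsto)
  then have "Bseq r"
    by (intro convergent_imp_Bseq convergentI)
  then obtain c2 where c2: "c2 > 0" "\<And>n. \<bar>r n\<bar> \<le> c2"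
    by (auto simp: Bseq_def)
  have "(\<lambda>n. inverse (r n)) \<longlonglongrightarrow> inverse \<bar>det2 v es / det2 eu es\<bar>"
    using unstable_component_nonzero by (intro tendsto_inverse lim) auto
  then have "Bseq (\<lambda>n. inverse (r n))"
    by (intro convergent_imp_Bseq convergentI)
  then obtain c3 where c3: "c3 > 0" "\<And>n. \<bar>inverse (r n)\<bar> \<le> c3"
    by (auto simp: Bseq_def)
  define c where "c = 1 / c3"
  have c: "0 < c" using c3 by (simp add: c_def)
  have c_le: "c \<le> r n" for n
    using c3(2)[of n] c3(1) r[of n] by (simp add: c_def field_simps)
  \<comment> \<open>At time 0 each radius equals the norm of its vector, so the initial condition of
    the comparison reduces to \<open>c <= Q\<close>.\<close>
  define Q where "Q = max 1 c"
  have "norm (fibre_iter T h A \<beta> n x v) \<le> Q * (c2 / c) * norm (fibre_iter T h A \<beta> n x eu)" for n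
  proof -
    have "norm (fibre_iter T h A \<beta> n x v) \<le>
        Q * (norm (fwd n x *v v) / (c * norm (fwd n x *v eu))) * norm (fibre_iter T h A \<beta> n x eu)"
    proof (rule response_comparison[OF fibre_iter_orbit[OF x nz(3) \<beta>] fibre_iter_orbit[OF x nz(2) \<beta>] \<beta> c])
      show "c * norm (fwd n x *v eu) \<le> norm (fwd n x *v v)" for n
        using c_le[of n] fwd_pos[OF x nz(2), of n] by (simp add: r_def pos_le_divide_eq)
      have "norm v * c \<le> Q * norm v"
        using mult_right_mono[of c Q "norm v"] by (simp add: Q_def mult.commute)
      then show "norm (fibre_iter T h A \<beta> 0 x v) \<le> Q * (norm (fwd 0 x *v v) / (c * norm (fwd 0 x *v eu))) *
          norm (fibre_iter T h A \<beta> 0 x eu)"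
        using c nz by (simp add: field_simps)
    qed (simp add: Q_def)
    also have "norm (fwd n x *v v) / (c * norm (fwd n x *v eu)) = r n / c"
      by (simp add: r_def)
    also have "Q * (r n / c) * norm (fibre_iter T h A \<beta> n x eu) \<le> Q * (c2 / c) * norm (fibre_iter T h A \<beta> n x eu)"
      using c2(2)[of n] c by (intro mult_right_mono mult_left_mono divide_right_mono) (auto simp: Q_def)
    finally show ?thesis .
  qed
  then show ?thesis by blast
qed

text \<open>Radii and directions are treated separately: the radii by
  \<open>response_orbits_asymptotic\<close>, with the boundary radius along \<open>eu\<close> as
  second orbit, the directions because the stable component becomes negligible relative to the
  growing \<open>eu\<close> component.\<close>

lemma fibre_iter_asymptotic:
  assumes \<beta>: "0 < \<beta>" and pos: "0 < radius \<beta> x eu"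
  defines "t \<equiv> \<lambda>n. radius \<beta> ((T ^^ n) x) (fwd n x *v eu) *\<^sub>R ((fwd n x *v eu) /\<^sub>R norm (fwd n x *v eu))"
  shows "(\<lambda>n. infdist (fibre_iter T h A \<beta> n x v) {t n, - t n}) \<longlonglongrightarrow> 0"
proof -
  note nz = transversal_nonzero
  define a where "a = det2 v es / det2 eu es"
  have a: "a \<noteq> 0"
    using unstable_component_nonzero by (simp add: a_def)
  define \<rho> where "\<rho> n = norm (fibre_iter T h A \<beta> n x v)" for n
  define r where "r n = radius \<beta> ((T ^^ n) x) (fwd n x *v eu)" for n
  define p where "p n = fwd n x *v v" for n
  define q where "q n = fwd n x *v eu" for n
  have p: "p n \<noteq> 0" and q: "q n \<noteq> 0" for n
    using fwd_pos[OF x nz(3), of n] fwd_pos[OF x nz(2), of n] by (auto simp: p_def q_def)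
  have r01: "0 \<le> r n" "r n \<le> 1" for n
    using radius_nonneg[OF iterate_in_space[OF x] q \<beta>] radius_le_1[OF iterate_in_space[OF x] q \<beta>]
    by (auto simp: r_def q_def)
  have lim1: "(\<lambda>n. \<rho> n - r n) \<longlonglongrightarrow> 0"
    unfolding \<rho>_def r_def
  proof (rule response_orbits_asymptotic[OF fibre_iter_orbit[OF x nz(3) \<beta>] radius_orbit[OF x nz(2) \<beta> pos] \<beta>])
    show "norm (fibre_iter T h A \<beta> n x v) \<le> 1" if "n \<ge> 1" for n
      using norm_fibre_iter_le_1[OF x \<beta>, of "n - 1"] that by simp
    show "radius \<beta> ((T ^^ n) x) (fwd n x *v eu) \<le> 1" for n
      using r01 by (simp add: r_def)
    show "h u * (norm (fwd (Suc n) x *v eu) / norm (fwd n x *v eu)) \<le> 1" if "0 \<le> u" for u n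
      by (rule response_fwd_le[OF x nz(2) that])
  qed (use fwd_ratio_tendsto unstable_component_nonzero in auto)
  \<comment> \<open>The sign of the unstable coordinate decides which of the two endpoints the orbit
    approaches.\<close>
  define s where "s = sgn a"
  have bound: "infdist (fibre_iter T h A \<beta> n x v) {t n, - t n} \<le>
      \<bar>\<rho> n - r n\<bar> + 2 * (norm (p n - a *\<^sub>R q n) / norm (q n)) / \<bar>a\<bar>" for n
  proof -
    have fibre: "fibre_iter T h A \<beta> n x v = \<rho> n *\<^sub>R (p n /\<^sub>R norm (p n))"
      unfolding \<rho>_def p_def by (rule fibre_iter_polar(2)[OF x nz(3) \<beta>])
    have aq: "(a *\<^sub>R q n) /\<^sub>R norm (a *\<^sub>R q n) = s *\<^sub>R (q n /\<^sub>R norm (q n))"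
      using a by (simp add: s_def sgn_real_def divide_inverse abs_if)
    have s_t: "s *\<^sub>R t n = r n *\<^sub>R (s *\<^sub>R (q n /\<^sub>R norm (q n)))"
      by (simp add: t_def r_def q_def mult_ac)
    have "s *\<^sub>R t n \<in> {t n, - t n}"
      using a by (auto simp: s_def sgn_real_def)
    then have "infdist (fibre_iter T h A \<beta> n x v) {t n, - t n} \<le> dist (fibre_iter T h A \<beta> n x v) (s *\<^sub>R t n)"
      by (rule infdist_le)
    also have "\<dots> = norm ((\<rho> n - r n) *\<^sub>R (p n /\<^sub>R norm (p n)) +
        r n *\<^sub>R (p n /\<^sub>R norm (p n) - (a *\<^sub>R q n) /\<^sub>R norm (a *\<^sub>R q n)))"
      unfolding dist_norm fibre s_t aq
      by (intro arg_cong[where f = norm]) (simp add: algebra_simps)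
    also have "\<dots> \<le> norm ((\<rho> n - r n) *\<^sub>R (p n /\<^sub>R norm (p n))) +
        norm (r n *\<^sub>R (p n /\<^sub>R norm (p n) - (a *\<^sub>R q n) /\<^sub>R norm (a *\<^sub>R q n)))"
      by (rule norm_triangle_ineq)
    also have "norm ((\<rho> n - r n) *\<^sub>R (p n /\<^sub>R norm (p n))) = \<bar>\<rho> n - r n\<bar>"
    proof -
      have "norm (p n /\<^sub>R norm (p n)) = 1"
        using p[of n] by simp
      then show ?thesis
        by (simp only: norm_scaleR[of "\<rho> n - r n"] mult_1_right)
    qed
    also have "norm (r n *\<^sub>R (p n /\<^sub>R norm (p n) - (a *\<^sub>R q n) /\<^sub>R norm (a *\<^sub>R q n))) \<le>
        1 * (2 * norm (p n - a *\<^sub>R q n) / norm (a *\<^sub>R q n))"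
      unfolding norm_scaleR[of "r n"]
      by (rule mult_mono[OF _ normalized_diff_le[OF p]]) (use r01[of n] a q[of n] in auto)
    finally show ?thesis
      by (simp add: mult.commute)
  qed
  have "(\<lambda>n. 2 * (norm (p n - a *\<^sub>R q n) / norm (q n)) / \<bar>a\<bar>) \<longlonglongrightarrow> 2 * 0 / \<bar>a\<bar>"
    unfolding p_def q_def a_def
    by (intro tendsto_divide tendsto_mult tendsto_const fwd_diff_quotient_tendsto)
      (use unstable_component_nonzero in simp)
  then have "(\<lambda>n. \<bar>\<rho> n - r n\<bar> + 2 * (norm (p n - a *\<^sub>R q n) / norm (q n)) / \<bar>a\<bar>) \<longlonglongrightarrow> 0 + 2 * 0 / \<bar>a\<bar>"
    by (intro tendsto_add tendsto_rabs_zero lim1)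
  then have lim2: "(\<lambda>n. \<bar>\<rho> n - r n\<bar> + 2 * (norm (p n - a *\<^sub>R q n) / norm (q n)) / \<bar>a\<bar>) \<longlonglongrightarrow> 0"
    by simp
  show ?thesis
    by (rule tendsto_sandwich[OF _ _ tendsto_const lim2])
      (use bound infdist_nonneg in \<open>auto intro!: always_eventually\<close>)
qed

end

section \<open>Attractor fibres under a splitting with vanishing critical radii\<close>

context
  fixes l :: real and S :: "'a set" and \<alpha>\<^sub>s \<alpha>\<^sub>u :: "'a \<Rightarrow> real"
  assumes l: "0 < l" and S: "invariant_full_set M T S"
    and \<alpha>\<^sub>s: "\<And>x. \<alpha>\<^sub>s x \<in> {0..<1/2}" and \<alpha>\<^sub>u: "\<And>x. \<alpha>\<^sub>u x \<in> {0..<1/2}"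
    and stable: "\<And>x. x \<in> S \<Longrightarrow> decays l (\<lambda>n. fwd n x) (direction (\<alpha>\<^sub>s x))"
    and unstable: "\<And>x. x \<in> S \<Longrightarrow> decays l (\<lambda>n. bwd n x) (direction (\<alpha>\<^sub>u x))"
    and distinct: "\<And>x. x \<in> S \<Longrightarrow> \<alpha>\<^sub>s x \<noteq> \<alpha>\<^sub>u x"
    and critical_s: "\<And>x. x \<in> S \<Longrightarrow> radius (exp l) x (direction (\<alpha>\<^sub>s x)) = 0"
    and critical_u: "\<And>x. x \<in> S \<Longrightarrow> radius (exp (- l)) x (direction (\<alpha>\<^sub>u x)) = 0"
begin

lemma det2_stable_unstable:
  assumes "x \<in> S"
  shows "det2 (direction (\<alpha>\<^sub>s x)) (direction (\<alpha>\<^sub>u x)) \<noteq> 0"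
  using det2_direction_eq_0_iff[OF \<alpha>\<^sub>s \<alpha>\<^sub>u] distinct[OF assms] by simp

text \<open>The zero at \<open>exp l\<close> on the stable line descends to smaller parameters by
  monotonicity, and then spreads to all lines except the unstable one.\<close>

lemma radius_off_unstable:
  assumes x: "x \<in> S" and \<beta>: "0 < \<beta>" "\<beta> \<le> exp l" and u: "det2 u (direction (\<alpha>\<^sub>u x)) \<noteq> 0"
  shows "radius \<beta> x u = 0"
proof -
  note sp = invariant_full_set_iterate(1)[OF S x]
  have "radius \<beta> x (direction (\<alpha>\<^sub>s x)) = 0"
    by (rule radius_zero_mono[OF sp direction_nonzero \<beta> critical_s[OF x]])
  then show ?thesis
    by (rule radius_zero_off_unstable[OF sp \<beta>(1) l _ unstable[OF x] det2_stable_unstable[OF x] u])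
qed

lemma radius_pos_iff:
  assumes x: "x \<in> S" and \<beta>: "exp (- l) < \<beta>" "\<beta> \<le> exp l" and \<alpha>: "\<alpha> \<in> {0..<1/2}"
  shows "0 < radius \<beta> x (direction \<alpha>) \<longleftrightarrow> \<alpha> = \<alpha>\<^sub>u x"
proof -
  have \<beta>0: "0 < \<beta>"
    using \<beta>(1) exp_gt_zero less_trans by blast
  show ?thesis
    using radius_off_unstable[OF x \<beta>0 \<beta>(2), of "direction \<alpha>"] det2_direction_eq_0_iff[OF \<alpha> \<alpha>\<^sub>u]
      radius_unstable_pos[OF invariant_full_set_iterate(1)[OF S x] unstable[OF x] \<beta>(1)] by force
qed

lemma attractor_fibre_unstable:
  assumes x: "x \<in> S" and \<beta>: "0 < \<beta>" "\<beta> \<le> exp l"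
  shows "attractor_fibre M T h A \<beta> x =
    {r *\<^sub>R direction (\<alpha>\<^sub>u x) | r. \<bar>r\<bar> \<le> radius \<beta> x (direction (\<alpha>\<^sub>u x))}"
proof -
  note sp = invariant_full_set_iterate(1)[OF S x]
  define R where "R = radius \<beta> x (direction (\<alpha>\<^sub>u x))"
  have R: "0 \<le> R"
    unfolding R_def by (rule radius_nonneg[OF sp direction_nonzero \<beta>(1)])
  have "y = 0 \<or> norm y \<le> radius \<beta> x y \<longleftrightarrow> (\<exists>r. y = r *\<^sub>R direction (\<alpha>\<^sub>u x) \<and> \<bar>r\<bar> \<le> R)" for y
  proof (cases "y = 0")
    case True
    then show ?thesis
      using R by (auto intro!: exI[of _ 0])
  next
    case y: False
    show ?thesis
    proof (cases "det2 y (direction (\<alpha>\<^sub>u x)) = 0")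
      case True
      then have "det2 (direction (\<alpha>\<^sub>u x)) y = 0"
        using det2_swap[of "direction (\<alpha>\<^sub>u x)" y] by simp
      then obtain c where c: "y = c *\<^sub>R direction (\<alpha>\<^sub>u x)"
        using det2_eq_0_imp_parallel[OF _ direction_nonzero] by blast
      have "radius \<beta> x y = R"
        unfolding R_def by (rule radius_parallel[OF y direction_nonzero True])
      then show ?thesis
        using y c by (auto simp: scaleR_cancel_right)
    next
      case False
      then have "radius \<beta> x y = 0"
        by (rule radius_off_unstable[OF x \<beta>])
      moreover have "y \<noteq> r *\<^sub>R direction (\<alpha>\<^sub>u x)" for r
        using False by auto
      ultimately show ?thesis
        using y by auto
    qed
  qed
  then show ?thesis
    unfolding attractor_fibre_eq[OF sp \<beta>(1)] R_def by auto
qed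

lemma attractor_fibre_critical:
  assumes x: "x \<in> S"
  shows "attractor_fibre M T h A (exp (- l)) x = {0}"
proof -
  have "exp (- l) \<le> exp l" using l by simp
  then show ?thesis
    using attractor_fibre_unstable[OF x _ \<open>exp (- l) \<le> exp l\<close>] critical_u[OF x] by auto
qed

text \<open>The transported vector decays backwards at the new base point, and the backward decaying
  line is unique there. The remaining sign only exchanges the two endpoints.\<close>

lemma endpoint_pair_eq:
  assumes x: "x \<in> S" and \<beta>: "0 < \<beta>"
  defines "q \<equiv> \<lambda>n. fwd n x *v direction (\<alpha>\<^sub>u x)"
  defines "t \<equiv> \<lambda>n. radius \<beta> ((T ^^ n) x) (q n) *\<^sub>R (q n /\<^sub>R norm (q n))"
  shows "endpoint_pair M T h A \<alpha>\<^sub>u \<beta> ((T ^^ n) x) = {t n, - t n}"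
proof -
  note sp = invariant_full_set_iterate(1)[OF S x]
  define y where "y = (T ^^ n) x"
  have y: "y \<in> S" "y \<in> space M"
    using invariant_full_set_iterate(2)[OF S x] iterate_in_space[OF sp] by (auto simp: y_def)
  define d where "d = direction (\<alpha>\<^sub>u y)"
  have q: "q n \<noteq> 0"
    using fwd_pos[OF sp direction_nonzero, of n] by (auto simp: q_def)
  have "decays l (\<lambda>k. bwd k y) (q n)"
    using decays_bwd_fwd[OF unstable[OF x] sp] by (simp add: y_def q_def)
  from decays_parallel[OF inverse.det_cocycle[OF y(2)] unstable[OF y(1)] this l]
  have det: "det2 d (q n) = 0"
    by (simp add: d_def)
  then obtain c where c: "q n = c *\<^sub>R d"
    using det2_eq_0_imp_parallel[of d] by (auto simp: d_def)
  have c0: "c \<noteq> 0" using c q by auto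
  have rad: "radius \<beta> y d = radius \<beta> y (q n)"
    by (rule radius_parallel[OF _ q det]) (simp add: d_def)
  have unit: "q n /\<^sub>R norm (q n) = sgn c *\<^sub>R d"
    using c0 by (simp add: c d_def sgn_real_def abs_if)
  have "endpoint_pair M T h A \<alpha>\<^sub>u \<beta> y = {radius \<beta> y d *\<^sub>R d, - (radius \<beta> y d *\<^sub>R d)}"
    by (simp add: endpoint_pair_def Let_def attractor_radius_eq[OF y(2) \<beta>] d_def)
  also have "\<dots> = {t n, - t n}"
    unfolding t_def y_def[symmetric] rad unit using c0 by (auto simp: sgn_real_def)
  finally show ?thesis
    by (simp add: y_def)
qed

lemma fibre_iter_to_endpoint_pair:
  assumes x: "x \<in> S" and \<beta>: "exp (- l) < \<beta>"
    and v: "v \<notin> range (\<lambda>c. c *\<^sub>R direction (\<alpha>\<^sub>s x))"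
  shows "(\<lambda>n. infdist (fibre_iter T h A \<beta> n x v) (endpoint_pair M T h A \<alpha>\<^sub>u \<beta> ((T ^^ n) x))) \<longlonglongrightarrow> 0"
proof -
  note sp = invariant_full_set_iterate(1)[OF S x]
  have \<beta>0: "0 < \<beta>"
    using \<beta> exp_gt_zero less_trans by blast
  have "det2 (direction (\<alpha>\<^sub>s x)) v \<noteq> 0"
    using det2_eq_0_imp_parallel[OF _ direction_nonzero] v by blast
  then show ?thesis
    unfolding endpoint_pair_eq[OF x \<beta>0]
    by (rule fibre_iter_asymptotic[OF sp l stable[OF x] det2_stable_unstable[OF x] _ \<beta>0
        radius_unstable_pos[OF sp unstable[OF x] \<beta>]])
qed

text \<open>The set \<open>J\<close> is chosen for the orbit of the unstable direction alone. Orbits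
  off the stable line are dominated by it, and those on the stable line tend to 0 at all times, so
  the same \<open>J\<close> works for every \<open>v\<close>.\<close>

lemma critical_density:
  assumes x: "x \<in> S" and lim: "(\<lambda>n. ln (opnorm (fwd n x)) / real n) \<longlonglongrightarrow> l"
  shows "\<exists>J. density_zero J \<and> (\<forall>v. ((\<lambda>n. norm (fibre_iter T h A (exp (- l)) n x v)) \<longlongrightarrow> 0)
    (inf sequentially (principal (- J))))"
proof -
  note sp = invariant_full_set_iterate(1)[OF S x]
  define \<beta> where "\<beta> = exp (- l)"
  have \<beta>: "0 < \<beta>" "\<beta> \<le> exp (- l)" "\<beta> < 1"
    using l by (auto simp: \<beta>_def)
  define eu where "eu = direction (\<alpha>\<^sub>u x)"
  define es where "es = direction (\<alpha>\<^sub>s x)"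
  obtain J where J: "density_zero J"
    "((\<lambda>n. norm (fibre_iter T h A \<beta> n x eu)) \<longlongrightarrow> 0) (inf sequentially (principal (- J)))"
    using tendsto_0_off_density_zero[OF norm_ge_zero fibre_cesaro[OF sp lim \<beta>(1,2), of eu]] by blast
  have "((\<lambda>n. norm (fibre_iter T h A \<beta> n x v)) \<longlongrightarrow> 0) (inf sequentially (principal (- J)))" for v
  proof (cases "det2 es v = 0")
    case True
    then obtain c where v: "v = c *\<^sub>R es"
      using det2_eq_0_imp_parallel[of es v] by (auto simp: es_def)
    have "(\<lambda>n. norm (fibre_iter T h A \<beta> n x v)) \<longlonglongrightarrow> 0"
    proof (cases "c = 0")
      case True
      then show ?thesis by (simp add: v fibre_iter_0)
    next
      case False
      then have v0: "v \<noteq> 0" by (simp add: v es_def)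
      have dec: "decays l (\<lambda>n. fwd n x) v"
        unfolding v es_def by (rule decays_scaleR[OF stable[OF x] False])
      have "(\<lambda>n. norm v / norm v * (1 * norm (fwd n x *v v))) \<longlonglongrightarrow> norm v / norm v * (1 * 0)"
        by (intro tendsto_mult tendsto_const decays_tendsto_0[OF dec l])
      then have lim0: "(\<lambda>n. norm v / norm v * (1 * norm (fwd n x *v v))) \<longlonglongrightarrow> 0" by simp
      have "norm (fibre_iter T h A \<beta> n x v) \<le> norm v / norm v * (1 * norm (fwd n x *v v))" for n
      proof -
        have "norm (fibre_iter T h A \<beta> n x v) \<le> norm (fibre_iter T h A \<beta> 0 x v) / norm (fwd 0 x *v v) *
            (\<beta> ^ n * norm (fwd n x *v v))"
          by (rule response_orbit_upper[OF fibre_iter_orbit[OF sp v0 \<beta>(1)] \<beta>(1)])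
        also have "\<dots> \<le> norm (fibre_iter T h A \<beta> 0 x v) / norm (fwd 0 x *v v) * (1 * norm (fwd n x *v v))"
          using \<beta> by (intro mult_left_mono mult_right_mono power_le_one) auto
        finally show ?thesis by simp
      qed
      then show ?thesis
        by (intro tendsto_sandwich[OF _ _ tendsto_const lim0]) (auto intro!: always_eventually)
    qed
    then show ?thesis
      by (rule tendsto_mono[OF inf_le1])
  next
    case False
    obtain C where C: "\<And>n. norm (fibre_iter T h A \<beta> n x v) \<le> C * norm (fibre_iter T h A \<beta> n x eu)"
      using fibre_iter_comparison[OF sp l stable[OF x] det2_stable_unstable[OF x] False[unfolded es_def] \<beta>(1)]
      by (auto simp: eu_def)
    have "((\<lambda>n. C * norm (fibre_iter T h A \<beta> n x eu)) \<longlongrightarrow> C * 0) (inf sequentially (principal (- J)))"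
      by (intro tendsto_mult tendsto_const J)
    then have lim0: "((\<lambda>n. C * norm (fibre_iter T h A \<beta> n x eu)) \<longlongrightarrow> 0) (inf sequentially (principal (- J)))"
      by simp
    show ?thesis
      by (rule tendsto_sandwich[OF _ _ tendsto_const lim0]) (use C in \<open>auto intro!: always_eventually\<close>)
  qed
  then show ?thesis
    using J(1) unfolding \<beta>_def by blast
qed

end

text \<open>Both line fields are invariant because decaying lines are unique. At
  \<open>exp l\<close> the parameter cancels the decay of the stable line, and at
  \<open>exp (- l)\<close> it cancels the largest possible growth, so
  \<open>radius_critical_AE_0\<close> applies twice.\<close>

lemma hyperbolic_splitting_critical:
  assumes l: "l = lyapunov M T A" "0 < l" and S: "invariant_full_set M T S"
  obtains S' \<alpha>\<^sub>s \<alpha>\<^sub>u where "S' \<subseteq> S" "invariant_full_set M T S'"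
    "\<alpha>\<^sub>s \<in> borel_measurable M" "\<alpha>\<^sub>u \<in> borel_measurable M"
    "\<And>x. \<alpha>\<^sub>s x \<in> {0..<1/2}" "\<And>x. \<alpha>\<^sub>u x \<in> {0..<1/2}"
    "\<And>x. x \<in> S' \<Longrightarrow> decays l (\<lambda>n. fwd n x) (direction (\<alpha>\<^sub>s x))"
    "\<And>x. x \<in> S' \<Longrightarrow> decays l (\<lambda>n. bwd n x) (direction (\<alpha>\<^sub>u x))"
    "\<And>x. x \<in> S' \<Longrightarrow> \<alpha>\<^sub>s x \<noteq> \<alpha>\<^sub>u x"
    "\<And>x. x \<in> S' \<Longrightarrow> radius (exp l) x (direction (\<alpha>\<^sub>s x)) = 0"
    "\<And>x. x \<in> S' \<Longrightarrow> radius (exp (- l)) x (direction (\<alpha>\<^sub>u x)) = 0"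
    "\<And>x. x \<in> S' \<Longrightarrow> (\<lambda>n. ln (opnorm (fwd n x)) / real n) \<longlonglongrightarrow> l"
proof -
  obtain S0 where S0: "S0 \<subseteq> S" "invariant_full_set M T S0"
    and lim: "\<And>x. x \<in> S0 \<Longrightarrow> (\<lambda>n. ln (opnorm (fwd n x)) / real n) \<longlonglongrightarrow> l"
    using invariant_full_set_exists[OF S AE_lyapunov[folded l(1)]] by blast
  obtain S1 \<alpha>\<^sub>s \<alpha>\<^sub>u where S1: "S1 \<subseteq> S0" "invariant_full_set M T S1"
    and meas: "\<alpha>\<^sub>s \<in> borel_measurable M" "\<alpha>\<^sub>u \<in> borel_measurable M"
    and range: "\<And>x. \<alpha>\<^sub>s x \<in> {0..<1/2}" "\<And>x. \<alpha>\<^sub>u x \<in> {0..<1/2}"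
    and stable: "\<And>x. x \<in> S1 \<Longrightarrow> decays l (\<lambda>n. fwd n x) (direction (\<alpha>\<^sub>s x))"
    and unstable: "\<And>x. x \<in> S1 \<Longrightarrow> decays l (\<lambda>n. bwd n x) (direction (\<alpha>\<^sub>u x))"
    and distinct: "\<And>x. x \<in> S1 \<Longrightarrow> \<alpha>\<^sub>s x \<noteq> \<alpha>\<^sub>u x"
    using hyperbolic_splitting[OF l S0(2)] by blast
  note sp = invariant_full_set_iterate(1)[OF S1(2)] and inv = invariant_full_set_iterate(2)[OF S1(2)]
  have crit_s: "AE x in M. radius (exp l) x (direction (\<alpha>\<^sub>s x)) = 0"
  proof (rule radius_critical_AE_0[OF S1(2) meas(1)])
    fix x n assume x: "x \<in> S1"
    show "det2 (fwd n x *v direction (\<alpha>\<^sub>s x)) (direction (\<alpha>\<^sub>s ((T ^^ n) x))) = 0"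
      by (rule decays_parallel[OF det_cocycle[OF iterate_in_space[OF sp[OF x]]]
          decays_fwd_fwd[OF stable[OF x] sp[OF x]] stable[OF inv[OF x]] l(2)])
  next
    fix x and \<delta> :: real assume x: "x \<in> S1" and \<delta>: "0 < \<delta>"
    obtain C where C: "0 < C" "\<And>n. norm (fwd n x *v direction (\<alpha>\<^sub>s x)) \<le> C * exp ((- l + \<delta>) * real n)"
      using decaysE[OF stable[OF x] \<delta>] by blast
    have "exp l ^ n * norm (fwd n x *v direction (\<alpha>\<^sub>s x)) \<le> C * exp (\<delta> * real n)" for n
    proof -
      have "exp l ^ n * norm (fwd n x *v direction (\<alpha>\<^sub>s x)) \<le> exp l ^ n * (C * exp ((- l + \<delta>) * real n))"
        by (intro mult_left_mono C) auto
      also have "\<dots> = C * (exp (l * real n) * exp ((- l + \<delta>) * real n))"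
        by (simp add: exp_of_nat_mult[symmetric] mult.commute)
      also have "exp (l * real n) * exp ((- l + \<delta>) * real n) = exp (\<delta> * real n)"
        by (simp add: exp_add[symmetric] algebra_simps)
      finally show ?thesis .
    qed
    then show "\<exists>C>0. \<forall>n. exp l ^ n * norm (fwd n x *v direction (\<alpha>\<^sub>s x)) \<le> C * exp (\<delta> * real n)"
      using C(1) by blast
  qed simp
  have crit_u: "AE x in M. radius (exp (- l)) x (direction (\<alpha>\<^sub>u x)) = 0"
  proof (rule radius_critical_AE_0[OF S1(2) meas(2)])
    fix x n assume x: "x \<in> S1"
    show "det2 (fwd n x *v direction (\<alpha>\<^sub>u x)) (direction (\<alpha>\<^sub>u ((T ^^ n) x))) = 0"
      by (rule decays_parallel[OF inverse.det_cocycle[OF iterate_in_space[OF sp[OF x]]]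
          decays_bwd_fwd[OF unstable[OF x] sp[OF x]] unstable[OF inv[OF x]] l(2)])
  next
    fix x and \<delta> :: real assume x: "x \<in> S1" and \<delta>: "0 < \<delta>"
    show "\<exists>C>0. \<forall>n. exp (- l) ^ n * norm (fwd n x *v direction (\<alpha>\<^sub>u x)) \<le> C * exp (\<delta> * real n)"
      by (rule subexponential_fwd[OF sp[OF x] lim _ _ \<delta>]) (use x S1(1) in auto)
  qed simp
  from crit_s crit_u have "AE x in M. radius (exp l) x (direction (\<alpha>\<^sub>s x)) = 0 \<and>
      radius (exp (- l)) x (direction (\<alpha>\<^sub>u x)) = 0"
    by eventually_elim auto
  then obtain S2 where S2: "S2 \<subseteq> S1" "invariant_full_set M T S2"
    "\<And>x. x \<in> S2 \<Longrightarrow> radius (exp l) x (direction (\<alpha>\<^sub>s x)) = 0 \<and> radius (exp (- l)) x (direction (\<alpha>\<^sub>u x)) = 0"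
    using invariant_full_set_exists[OF S1(2)] by blast
  show ?thesis
    by (rule that[of S2 \<alpha>\<^sub>s \<alpha>\<^sub>u]) (use S0 S1 S2 meas range stable unstable distinct lim in auto)
qed

text \<open>At most one line carries a positive radius, so the fibre lies in a line. Of two
  independent directions, here at angles 0 and 1/4, at least one has radius zero.\<close>

lemma neutral_fibre:
  assumes x: "x \<in> space M"
  shows "\<not> attractor_fibre M T h A 1 x homeomorphic (cball 0 1 :: (real^2) set)"
    and "\<exists>\<alpha>. attractor_radius M T h A 1 x \<alpha> = 0"
proof -
  have "\<exists>u. attractor_fibre M T h A 1 x \<subseteq> span {u}"
  proof (cases "\<exists>u. u \<noteq> 0 \<and> radius 1 x u \<noteq> 0")
    case True
    then obtain u where u: "u \<noteq> 0" "radius 1 x u \<noteq> 0" by blast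
    have "y \<in> span {u}" if "norm y \<le> radius 1 x y" "y \<noteq> 0" for y
    proof -
      have "radius 1 x y \<noteq> 0"
        using that by auto
      then have "det2 u y = 0"
        using radius_two_directions[OF x, of 1 u y] u(2) by auto
      then obtain c where "y = c *\<^sub>R u"
        using det2_eq_0_imp_parallel[OF _ u(1)] by blast
      then show ?thesis
        by (simp add: span_base span_scale)
    qed
    then have "y \<in> span {u}" if "y = 0 \<or> norm y \<le> radius 1 x y" for y
      using that by (cases "y = 0") (auto simp: span_zero)
    then show ?thesis
      by (intro exI[of _ u]) (auto simp: attractor_fibre_eq[OF x])
  next
    case False
    then have "attractor_fibre M T h A 1 x \<subseteq> {0}"
      by (auto simp: attractor_fibre_eq[OF x])
    then show ?thesis
      by (intro exI[of _ 0]) auto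
  qed
  then show "\<not> attractor_fibre M T h A 1 x homeomorphic (cball 0 1 :: (real^2) set)"
    using subset_line_not_homeomorphic_disk by blast
  have "det2 (direction 0) (direction (1/4)) \<noteq> 0"
    by (subst det2_direction_eq_0_iff) auto
  then show "\<exists>\<alpha>. attractor_radius M T h A 1 x \<alpha> = 0"
    using radius_two_directions[OF x, of 1] by (auto simp: attractor_radius_eq[OF x])
qed

end

theorem proposition1p5:
  fixes M :: "'a measure" and \<gamma> :: "'a \<Rightarrow> 'a"
    and A :: "'a \<Rightarrow> real^2^2" and h :: "real \<Rightarrow> real"
    and \<beta>\<^sub>1 \<beta>\<^sub>2 :: real and \<Theta>' :: "'a set"
  assumes "prob_space M"
    and "bimeasurable_bij M \<gamma>"
    and "invariant_measure M \<gamma>"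
    and "ergodic_measure M \<gamma>"
    and "A \<in> borel_measurable M"
    and "\<And>\<theta>. \<theta> \<in> space M \<Longrightarrow> det (A \<theta>) = 1"
    and "bdd_above ((\<lambda>\<theta>. opnorm (A \<theta>)) ` space M)"
    and "\<And>x. 0 \<le> x \<Longrightarrow> 0 \<le> h x"
    and "C2_on {0..} h"
    and "strict_mono_on {0..} h"
    and "strictly_concave_on {0..} h"
    and "bounded (h ` {0..})"
    and "h 0 = 0"
    and "(h has_real_derivative 1) (at 0 within {0..})"
    and "(SUP x\<in>{0..}. h x) \<le> inverse (SUP \<theta>\<in>space M. opnorm (A \<theta>))"
    and "\<beta>\<^sub>1 = exp (- lyapunov M \<gamma> A)"
    and "\<beta>\<^sub>2 = exp (lyapunov M \<gamma> A)"
    and "invariant_full_set M \<gamma> \<Theta>'"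
  shows "\<exists>\<Theta>\<^sub>0 \<subseteq> \<Theta>'. invariant_full_set M \<gamma> \<Theta>\<^sub>0 \<and>
    (\<forall>\<theta>\<in>\<Theta>\<^sub>0. \<forall>\<beta>\<ge>0. \<beta> = \<beta>\<^sub>1 \<and> \<beta>\<^sub>1 < \<beta>\<^sub>2 \<longrightarrow>
        attractor_fibre M \<gamma> h A \<beta> \<theta> = {0} \<and>
        (\<exists>J. density_zero J \<and>
          (\<forall>v. ((\<lambda>n. norm (fibre_iter \<gamma> h A \<beta> n \<theta> v)) \<longlongrightarrow> 0)
                 (inf sequentially (principal (- J)))))) \<and>
    (\<forall>\<theta>\<in>\<Theta>\<^sub>0. \<forall>\<beta>\<ge>0. \<beta> = \<beta>\<^sub>1 \<and> \<beta>\<^sub>1 = \<beta>\<^sub>2 \<longrightarrow>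
        \<not> attractor_fibre M \<gamma> h A \<beta> \<theta> homeomorphic (cball 0 1 :: (real^2) set) \<and>
        (\<exists>\<alpha>. attractor_radius M \<gamma> h A \<beta> \<theta> \<alpha> = 0) \<and>
        (\<forall>v. (\<lambda>n. 1 / real n * (\<Sum>i<n. norm (fibre_iter \<gamma> h A \<beta> i \<theta> v))) \<longlonglongrightarrow> 0)) \<and>
    (\<forall>\<theta>\<in>\<Theta>\<^sub>0. \<forall>\<beta>\<ge>0. \<beta>\<^sub>1 < \<beta> \<and> \<beta> = \<beta>\<^sub>2 \<longrightarrow>
        (\<exists>a b. a \<noteq> b \<and> attractor_fibre M \<gamma> h A \<beta> \<theta> = closed_segment a b)) \<and>
    (\<beta>\<^sub>1 < \<beta>\<^sub>2 \<longrightarrow>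
      (\<exists>\<alpha>\<^sub>u \<alpha>\<^sub>s. \<alpha>\<^sub>u \<in> borel_measurable (restrict_space M \<Theta>\<^sub>0) \<and> \<alpha>\<^sub>u ` \<Theta>\<^sub>0 \<subseteq> {0..<1/2} \<and>
               \<alpha>\<^sub>s \<in> borel_measurable (restrict_space M \<Theta>\<^sub>0) \<and> \<alpha>\<^sub>s ` \<Theta>\<^sub>0 \<subseteq> {0..<1/2} \<and>
        (\<forall>\<theta>\<in>\<Theta>\<^sub>0. \<forall>\<beta>\<in>{\<beta>\<^sub>1<..\<beta>\<^sub>2}.
          (\<forall>\<alpha>\<in>{0..<1/2}. attractor_radius M \<gamma> h A \<beta> \<theta> \<alpha> > 0 \<longleftrightarrow> \<alpha> = \<alpha>\<^sub>u \<theta>) \<and>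
          attractor_fibre M \<gamma> h A \<beta> \<theta> =
            {r *\<^sub>R direction (\<alpha>\<^sub>u \<theta>) | r. \<bar>r\<bar> \<le> attractor_radius M \<gamma> h A \<beta> \<theta> (\<alpha>\<^sub>u \<theta>)} \<and>
          (\<forall>v. v \<notin> range (\<lambda>c. c *\<^sub>R direction (\<alpha>\<^sub>s \<theta>)) \<longrightarrow>
            (\<lambda>n. infdist (fibre_iter \<gamma> h A \<beta> n \<theta> v)
                   (endpoint_pair M \<gamma> h A \<alpha>\<^sub>u \<beta> ((\<gamma> ^^ n) \<theta>))) \<longlonglongrightarrow> 0))))"
proof -
  interpret prob_space M by fact
  define K where "K = (SUP \<theta>\<in>space M. opnorm (A \<theta>))"
  have A_le: "opnorm (A \<theta>) \<le> K" if "\<theta> \<in> space M" for \<theta>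
    unfolding K_def by (rule cSUP_upper[OF that assms(7)])
  obtain \<theta>\<^sub>1 where "\<theta>\<^sub>1 \<in> space M"
    using not_empty by auto
  then have K: "1 \<le> K"
    using opnorm_ge_1[OF assms(6)] A_le order_trans by blast
  have h_K: "h u * K \<le> 1" if "0 \<le> u" for u
  proof -
    have "h u \<le> (SUP x\<in>{0..}. h x)"
      using that by (intro cSUP_upper bounded_imp_bdd_above assms(12)) auto
    also have "\<dots> \<le> inverse K"
      using assms(15) by (simp add: K_def)
    finally show ?thesis
      using K by (simp add: field_simps)
  qed
  obtain h' where "\<And>x. x \<in> {0..} \<Longrightarrow> (h has_real_derivative h' x) (at x within {0..})"
    using assms(9) by (auto simp: C2_on_def)
  then have h_cont: "continuous_on {0..} h"
    by (rule DERIV_continuous_on)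
  interpret concave_skew_product M \<gamma> A K h
  proof unfold_locales
    show "emeasure M (\<gamma> -` B \<inter> space M) = emeasure M B" if "B \<in> sets M" for B
      using assms(3) that by (simp add: invariant_measure_def)
    show "emeasure M B = 0 \<or> emeasure M (space M - B) = 0"
      if "B \<in> sets M" "\<gamma> -` B \<inter> space M = B" for B
      using assms(4) that by (simp add: ergodic_measure_def)
  qed (use assms(2) in \<open>simp_all add: bimeasurable_bij_def assms(5,6,10,11,13,14) A_le h_cont h_K\<close>)
  define l where "l = lyapunov M \<gamma> A"
  have l: "0 \<le> l"
    unfolding l_def by (rule lyapunov_nonneg)
  have \<beta>: "\<beta>\<^sub>1 = exp (- l)" "\<beta>\<^sub>2 = exp l"
    using assms(16,17) by (simp_all add: l_def)
  show ?thesis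
  \<comment> \<open>For exponent 0 both critical parameters are 1, and the premises of parts (a) and
    (c) are false; for positive exponent the premise of (b) is false.\<close>
  proof (cases "l = 0")
    case True
    have AE: "AE x in M. (\<lambda>n. ln (opnorm (fwd n x)) / real n) \<longlonglongrightarrow> 0"
      using AE_lyapunov True by (simp add: l_def)
    obtain \<Theta>\<^sub>0 where \<Theta>\<^sub>0: "\<Theta>\<^sub>0 \<subseteq> \<Theta>'" "invariant_full_set M \<gamma> \<Theta>\<^sub>0"
      and lim: "\<And>x. x \<in> \<Theta>\<^sub>0 \<Longrightarrow> (\<lambda>n. ln (opnorm (fwd n x)) / real n) \<longlonglongrightarrow> 0"
      using invariant_full_set_exists[OF assms(18) AE] by blast
    have cesaro: "(\<lambda>n. 1 / real n * (\<Sum>i<n. norm (fibre_iter \<gamma> h A 1 i x v))) \<longlonglongrightarrow> 0" if "x \<in> \<Theta>\<^sub>0" for x v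
      by (rule fibre_cesaro[OF invariant_full_set_iterate(1)[OF \<Theta>\<^sub>0(2) that] lim[OF that]]) auto
    have \<beta>1: "\<beta>\<^sub>1 = 1" "\<beta>\<^sub>2 = 1"
      using \<beta> True by simp_all
    show ?thesis
      unfolding \<beta>1 using \<Theta>\<^sub>0 cesaro neutral_fibre[OF invariant_full_set_iterate(1)[OF \<Theta>\<^sub>0(2)]]
      by (intro exI[of _ \<Theta>\<^sub>0]) auto
  next
    case False
    then have l_pos: "0 < l" using l by simp
    obtain \<Theta>\<^sub>0 \<alpha>\<^sub>s \<alpha>\<^sub>u where \<Theta>\<^sub>0: "\<Theta>\<^sub>0 \<subseteq> \<Theta>'" "invariant_full_set M \<gamma> \<Theta>\<^sub>0"
      and meas: "\<alpha>\<^sub>s \<in> borel_measurable M" "\<alpha>\<^sub>u \<in> borel_measurable M"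
      and range: "\<And>x. \<alpha>\<^sub>s x \<in> {0..<1/2}" "\<And>x. \<alpha>\<^sub>u x \<in> {0..<1/2}"
      and split: "\<And>x. x \<in> \<Theta>\<^sub>0 \<Longrightarrow> decays l (\<lambda>n. fwd n x) (direction (\<alpha>\<^sub>s x))"
        "\<And>x. x \<in> \<Theta>\<^sub>0 \<Longrightarrow> decays l (\<lambda>n. bwd n x) (direction (\<alpha>\<^sub>u x))"
        "\<And>x. x \<in> \<Theta>\<^sub>0 \<Longrightarrow> \<alpha>\<^sub>s x \<noteq> \<alpha>\<^sub>u x"
        "\<And>x. x \<in> \<Theta>\<^sub>0 \<Longrightarrow> radius (exp l) x (direction (\<alpha>\<^sub>s x)) = 0"
        "\<And>x. x \<in> \<Theta>\<^sub>0 \<Longrightarrow> radius (exp (- l)) x (direction (\<alpha>\<^sub>u x)) = 0"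
      and lim: "\<And>x. x \<in> \<Theta>\<^sub>0 \<Longrightarrow> (\<lambda>n. ln (opnorm (fwd n x)) / real n) \<longlonglongrightarrow> l"
      using hyperbolic_splitting_critical[OF l_def l_pos assms(18)] by blast
    note hyp = l_pos \<Theta>\<^sub>0(2) range split
    note sp = invariant_full_set_iterate(1)[OF \<Theta>\<^sub>0(2)]
    have part_a: "attractor_fibre M \<gamma> h A \<beta>\<^sub>1 x = {0} \<and>
        (\<exists>J. density_zero J \<and> (\<forall>v. ((\<lambda>n. norm (fibre_iter \<gamma> h A \<beta>\<^sub>1 n x v)) \<longlongrightarrow> 0)
          (inf sequentially (principal (- J)))))" if x: "x \<in> \<Theta>\<^sub>0" for x
      unfolding \<beta> using attractor_fibre_critical[OF hyp x] critical_density[OF hyp x lim[OF x]] by blast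
    have part_c: "(\<forall>\<alpha>\<in>{0..<1/2}. attractor_radius M \<gamma> h A b x \<alpha> > 0 \<longleftrightarrow> \<alpha> = \<alpha>\<^sub>u x) \<and>
        attractor_fibre M \<gamma> h A b x =
          {r *\<^sub>R direction (\<alpha>\<^sub>u x) | r. \<bar>r\<bar> \<le> attractor_radius M \<gamma> h A b x (\<alpha>\<^sub>u x)} \<and>
        (\<forall>v. v \<notin> range (\<lambda>c. c *\<^sub>R direction (\<alpha>\<^sub>s x)) \<longrightarrow>
          (\<lambda>n. infdist (fibre_iter \<gamma> h A b n x v)
            (endpoint_pair M \<gamma> h A \<alpha>\<^sub>u b ((\<gamma> ^^ n) x))) \<longlonglongrightarrow> 0)"
      if x: "x \<in> \<Theta>\<^sub>0" and b: "b \<in> {\<beta>\<^sub>1<..\<beta>\<^sub>2}" for x b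
    proof -
      have b': "exp (- l) < b" "b \<le> exp l"
        using b by (auto simp: \<beta>)
      then have b0: "0 < b"
        using exp_gt_zero less_trans by blast
      show ?thesis
        unfolding attractor_radius_eq[OF sp[OF x] b0]
        using radius_pos_iff[OF hyp x b'] attractor_fibre_unstable[OF hyp x b0 b'(2)]
          fibre_iter_to_endpoint_pair[OF hyp x b'(1)] by blast
    qed
    have segment: "\<exists>a c. a \<noteq> c \<and> attractor_fibre M \<gamma> h A \<beta>\<^sub>2 x = closed_segment a c"
      if x: "x \<in> \<Theta>\<^sub>0" and lt: "\<beta>\<^sub>1 < \<beta>\<^sub>2" for x
    proof -
      define R where "R = attractor_radius M \<gamma> h A \<beta>\<^sub>2 x (\<alpha>\<^sub>u x)"
      have R: "0 < R"
        using part_c[OF x, of \<beta>\<^sub>2] lt range(2) by (auto simp: R_def)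
      have "attractor_fibre M \<gamma> h A \<beta>\<^sub>2 x = {r *\<^sub>R direction (\<alpha>\<^sub>u x) | r. \<bar>r\<bar> \<le> R}"
        using part_c[OF x, of \<beta>\<^sub>2] lt by (auto simp: R_def)
      also have "\<dots> = closed_segment ((- R) *\<^sub>R direction (\<alpha>\<^sub>u x)) (R *\<^sub>R direction (\<alpha>\<^sub>u x))"
        using R by (intro scaled_segment_eq) simp
      finally show ?thesis
        using R by (intro exI[of _ "(- R) *\<^sub>R direction (\<alpha>\<^sub>u x)"] exI[of _ "R *\<^sub>R direction (\<alpha>\<^sub>u x)"])
          (simp only: scaleR_cancel_right, simp)
    qed
    have ne: "\<beta>\<^sub>1 \<noteq> \<beta>\<^sub>2"
      using l_pos by (simp add: \<beta>)
    have meas': "\<alpha>\<^sub>u \<in> borel_measurable (restrict_space M \<Theta>\<^sub>0)" "\<alpha>\<^sub>s \<in> borel_measurable (restrict_space M \<Theta>\<^sub>0)"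
      using meas by (auto intro: measurable_restrict_space1)
    have range': "\<alpha>\<^sub>u ` \<Theta>\<^sub>0 \<subseteq> {0..<1/2}" "\<alpha>\<^sub>s ` \<Theta>\<^sub>0 \<subseteq> {0..<1/2}"
      using range by (auto simp del: atLeastLessThan_iff)
    show ?thesis
    proof (intro exI[of _ \<Theta>\<^sub>0] conjI \<Theta>\<^sub>0 impI)
      show "\<exists>\<alpha>\<^sub>u \<alpha>\<^sub>s. \<alpha>\<^sub>u \<in> borel_measurable (restrict_space M \<Theta>\<^sub>0) \<and> \<alpha>\<^sub>u ` \<Theta>\<^sub>0 \<subseteq> {0..<1/2} \<and>
               \<alpha>\<^sub>s \<in> borel_measurable (restrict_space M \<Theta>\<^sub>0) \<and> \<alpha>\<^sub>s ` \<Theta>\<^sub>0 \<subseteq> {0..<1/2} \<and>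
        (\<forall>\<theta>\<in>\<Theta>\<^sub>0. \<forall>\<beta>\<in>{\<beta>\<^sub>1<..\<beta>\<^sub>2}.
          (\<forall>\<alpha>\<in>{0..<1/2}. attractor_radius M \<gamma> h A \<beta> \<theta> \<alpha> > 0 \<longleftrightarrow> \<alpha> = \<alpha>\<^sub>u \<theta>) \<and>
          attractor_fibre M \<gamma> h A \<beta> \<theta> =
            {r *\<^sub>R direction (\<alpha>\<^sub>u \<theta>) | r. \<bar>r\<bar> \<le> attractor_radius M \<gamma> h A \<beta> \<theta> (\<alpha>\<^sub>u \<theta>)} \<and>
          (\<forall>v. v \<notin> range (\<lambda>c. c *\<^sub>R direction (\<alpha>\<^sub>s \<theta>)) \<longrightarrow>
            (\<lambda>n. infdist (fibre_iter \<gamma> h A \<beta> n \<theta> v)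
                   (endpoint_pair M \<gamma> h A \<alpha>\<^sub>u \<beta> ((\<gamma> ^^ n) \<theta>))) \<longlonglongrightarrow> 0))"
        by (rule exI[of _ \<alpha>\<^sub>u], rule exI[of _ \<alpha>\<^sub>s], intro conjI meas' range' ballI part_c)
    qed (use part_a segment ne in blast)+
  qed
qed

end
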